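(* Let $\mu_0$ be the uniform distribution on $S$, let $\nu_n$ denote the law on $S^n$ and $\boldsymbol\nu_n$ the corresponding law on $E=\mathcal M_1(S)$ defined in the context, let $\mathbf X^n$, $n\in\mathbb N$, be the stationary empirical-measure processes defined in the context, let $\boldsymbol\nu:=\delta_{\mu_0}$, and let $\mathbf X$ be the path concentrated on $\mu_0$ (constant in time, equal to $\mu_0$). (a) We have $\boldsymbol\nu_n\Rightarrow\boldsymbol\nu=\delta_{\mu_0}$ as $n\to\infty$. (b) The processes $\mathbf X^n$ converge weakly to $\mathbf X$ as $n\to\infty$ (in the Skorohod space $D_E[0,\infty)$).
   Context: Potential. Let $V\in C^1(\mathbb R)$ be an even function with $V\ge0$ and $\lim_{z\to\infty}V(z)=0$. Set $\Psi(z):=-zV'(z)$ and suppose $\Psi\ge0$. Assume that for some $\alpha>0$, $\beta>0$, $$\lim_{r\to\infty}r\,\Psi(r^{1+\alpha}z)=\beta|z|^{-\beta},\quad z\in[-\tfrac12,\tfrac12]\setminus\{0\},$$ uniformly on every compact subset of $[-\frac12,\frac12]\setminus\{0\}$ (it follows that $\beta\in(0,1)$ and $\alpha=(1-\beta)/\beta$). Suppose also that this convergence holds in $L^1([t,\infty);z^{-1}dz)$ uniformly with respect to $t\in\mathcal T$ for every compact subset $\mathcal T\subset[-\frac12,\frac12]\setminus\{0\}$, which yields $\lim_{r\to\infty}r\,V(r^{1+\alpha}z)=|z|^{-\beta}$ uniformly on compact subsets of $[-\frac12,\frac12]\setminus\{0\}$. In addition assume $V(z)\le z^{-\beta}$ for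 $z\in(0,1)$ and $V(z)\ge z^{-\beta}$ for $z\in[1,\infty)$, and $\Psi\le\beta V$. Particle system. $S$ is the circle of unit circumference; differences $x_i-x_j$ of points of $S$ are represented in $[-\frac12,\frac12]$. On $S^n$ let $$d\nu_n(x):=\frac1{Z_n}\exp\Big[-\sum_{i,j=1}^nV(n^{1+\alpha}(x_i-x_j))\Big]dx_1\cdots dx_n,$$ $Z_n$ being the normalization constant. Let $x^n=((x^n(t))_{t\ge0},(\hat P^n_\eta)_{\eta\in S^n})$, $x^n(t)=(x_1^n(t),\dots,x^n_n(t))$, be the $S^n$-valued diffusion started at $\eta$ under $\hat P^n_\eta$, given by the SDE $$dx_i(t)=-n^{1+\alpha}\sum_{j\ne i}V'(n^{1+\alpha}(x_i(t)-x_j(t)))\,dt+d\beta_i(t),\quad t\ge0,\ i=1,\dots,n,$$ with independent one-dimensional standard Brownian motions $\beta_i$ on $S$. It is the diffusion associated with the closure on $L^2(S^n,\nu_n)$ of the form $\mathcal E_n(f,f)=\frac12\int_{S^n}\sum_{i=1}^n(\partial f/\partial x_i)^2\,d\nu_n$, $f\in C^\infty(S^n)$; $\nu_n$ is invariant for it. Measure-valued processes. $E:=\mathcal M_1(S)$ is the space of probability measures on $S$ with the Prohorov metric. $\boldsymbol\nu_n$ is the image of $\nu_n$ under $(x_1,\dots,x_n)\mapsto\frac1n\sum_{i=1}^n\delta_{x_i}$. $X^n_t:=\frac1n\sum_{i=1}^n\delta_{x^n_i(t)}$, and for $\mu=\frac1n\sum_j\delta_{\eta_j}$, $P^n_\mu$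 is the law of $(X^n_t)_{t\ge0}$ when $x^n$ is started at $\eta=(\eta_1,\dots,\eta_n)$. $\mathbf X^n:=((X^n_t)_{t\ge0},P^n)$ with $P^n:=\int P^n_\mu\,\boldsymbol\nu_n(d\mu)$, i.e. the stationary version. *)

theory Defs
  imports "HOL-Probability.Probability"
begin

section \<open>The circle of unit circumference\<close>

text \<open>The circle is the group of reals modulo the integers, each class being represented by its
  element in the interval from 0 (included) to 1 (excluded).\<close>

typedef circle = "{0..<1::real}"
  morphisms rep_circle abs_circle
  by (rule exI[of _ 0]) simp

definition to_circle :: "real \<Rightarrow> circle" where
  "to_circle a = abs_circle (frac a)"

text \<open>The difference of two points, represented in the interval from -1/2 (included) to 1/2
  (excluded).\<close>

definition circle_diff :: "circle \<Rightarrow> circle \<Rightarrow> real" where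
  "circle_diff x y = frac (rep_circle x - rep_circle y + 1/2) - 1/2"

definition rotate_circle :: "circle \<Rightarrow> real \<Rightarrow> circle" where
  "rotate_circle x a = to_circle (rep_circle x + a)"

lemma circle_diff_round:
  "circle_diff x y = (rep_circle x - rep_circle y) - of_int (round (rep_circle x - rep_circle y))"
  unfolding circle_diff_def frac_def round_def by simp

lemma circle_diff_bounds: "- (1/2) \<le> circle_diff x y" "circle_diff x y < 1/2"
  unfolding circle_diff_def using frac_ge_0[of "rep_circle x - rep_circle y + 1/2"]
    frac_lt_1[of "rep_circle x - rep_circle y + 1/2"] by linarith+

lemma abs_circle_diff_le:
  "\<bar>circle_diff x y\<bar> \<le> \<bar>rep_circle x - rep_circle y - of_int k\<bar>"
  unfolding circle_diff_round by (rule round_diff_minimal)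

lemma abs_circle_diff_commute: "\<bar>circle_diff x y\<bar> = \<bar>circle_diff y x\<bar>"
proof -
  have "\<bar>circle_diff x y\<bar> \<le> \<bar>circle_diff y x\<bar>" for x y
    using abs_circle_diff_le[of x y "- round (rep_circle y - rep_circle x)"]
    by (simp add: circle_diff_round[of y x])
  thus ?thesis by (meson antisym)
qed

lemma abs_circle_diff_triangle:
  "\<bar>circle_diff x z\<bar> \<le> \<bar>circle_diff x y\<bar> + \<bar>circle_diff y z\<bar>"
  using abs_circle_diff_le[of x z
      "round (rep_circle x - rep_circle y) + round (rep_circle y - rep_circle z)"]
  by (simp add: circle_diff_round[of x y] circle_diff_round[of y z])

lemma circle_diff_eq_0: "circle_diff x y = 0 \<longleftrightarrow> x = y"
proof
  assume "circle_diff x y = 0"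
  hence eq: "rep_circle x - rep_circle y = of_int (round (rep_circle x - rep_circle y))"
    by (simp add: circle_diff_round)
  have "rep_circle x \<in> {0..<1}" "rep_circle y \<in> {0..<1}"
    by (rule rep_circle)+
  hence "\<bar>rep_circle x - rep_circle y\<bar> < 1" by auto
  hence "\<bar>of_int (round (rep_circle x - rep_circle y)) :: real\<bar> < 1" using eq by simp
  hence "round (rep_circle x - rep_circle y) = 0" by linarith
  with eq have "rep_circle x = rep_circle y" by simp
  thus "x = y" by (simp add: rep_circle_inject)
qed (simp add: circle_diff_round)

instantiation circle :: metric_space
begin

definition dist_circle :: "circle \<Rightarrow> circle \<Rightarrow> real" where
  "dist_circle x y = \<bar>circle_diff x y\<bar>"

definition uniformity_circle :: "(circle \<times> circle) filter" where
  "uniformity_circle = (INF e\<in>{0<..}. principal {(x, y). dist x y < e})"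

definition open_circle :: "circle set \<Rightarrow> bool" where
  "open_circle U \<longleftrightarrow> (\<forall>x\<in>U. \<forall>\<^sub>F (x', y) in uniformity. x' = x \<longrightarrow> y \<in> U)"

instance
proof
  fix x y z :: circle
  show "dist x y = 0 \<longleftrightarrow> x = y"
    by (simp add: dist_circle_def circle_diff_eq_0)
  show "dist x y \<le> dist x z + dist y z"
    using abs_circle_diff_triangle[of x y z]
    by (simp add: dist_circle_def abs_circle_diff_commute[of y z])
qed (auto simp: uniformity_circle_def open_circle_def)

end

text \<open>Arc length; as a probability measure it is the uniform distribution.\<close>

definition circle_lebesgue :: "circle measure" where
  "circle_lebesgue = distr (restrict_space lborel {0..<1}) borel to_circle"

text \<open>The Borel sigma-algebra on n-tuples of points of the circle.\<close>

abbreviation circle_power :: "nat \<Rightarrow> (nat \<Rightarrow> circle) measure" where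
  "circle_power n \<equiv> (\<Pi>\<^sub>M i\<in>{..<n}. borel)"


section \<open>The Prohorov metric\<close>

text \<open>The value 0 away from the probability measures is a dummy; the type of abstract metrics
  needs nonnegativity there.\<close>

definition prohorov_dist :: "'a::metric_space measure \<Rightarrow> 'a measure \<Rightarrow> real" where
  "prohorov_dist \<mu> \<nu> =
     (if \<mu> \<in> space (prob_algebra borel) \<and> \<nu> \<in> space (prob_algebra borel)
      then Inf {\<epsilon>. \<epsilon> > 0 \<and>
        (\<forall>A\<in>sets borel. measure \<mu> A \<le> measure \<nu> (\<Union>a\<in>A. ball a \<epsilon>) + \<epsilon> \<and>
                        measure \<nu> A \<le> measure \<mu> (\<Union>a\<in>A. ball a \<epsilon>) + \<epsilon>)}
      else 0)"

definition prohorov_metric :: "'a::metric_space measure metric" where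
  "prohorov_metric = metric (space (prob_algebra borel), prohorov_dist)"

context
  fixes R :: "'a::metric_space measure \<Rightarrow> 'a measure \<Rightarrow> real \<Rightarrow> bool"
  defines "R \<equiv> \<lambda>\<mu> \<nu> \<epsilon>. \<epsilon> > 0 \<and>
     (\<forall>A\<in>sets borel. measure \<mu> A \<le> measure \<nu> (\<Union>a\<in>A. ball a \<epsilon>) + \<epsilon> \<and>
                     measure \<nu> A \<le> measure \<mu> (\<Union>a\<in>A. ball a \<epsilon>) + \<epsilon>)"
begin

private lemma prohorov_alt:
  assumes "\<mu> \<in> space (prob_algebra borel)" "\<nu> \<in> space (prob_algebra borel)"
  shows "prohorov_dist \<mu> \<nu> = Inf {\<epsilon>. R \<mu> \<nu> \<epsilon>}"
  using assms by (simp add: prohorov_dist_def R_def)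

private lemma prohorov_bdd: "bdd_below {\<epsilon>. R \<mu> \<nu> \<epsilon>}"
  by (rule bdd_belowI[of _ 0]) (auto simp: R_def)

private lemma prohorov_nonempty:
  assumes "\<mu> \<in> space (prob_algebra borel)" "\<nu> \<in> space (prob_algebra borel)"
  shows "{\<epsilon>. R \<mu> \<nu> \<epsilon>} \<noteq> {}"
proof -
  interpret M: prob_space \<mu> using assms by (simp add: space_prob_algebra)
  interpret N: prob_space \<nu> using assms by (simp add: space_prob_algebra)
  have "R \<mu> \<nu> 1"
    unfolding R_def
    by (intro conjI ballI)
       (auto intro!: order_trans[OF M.prob_le_1] order_trans[OF N.prob_le_1])
  thus ?thesis by blast
qed

private lemma prohorov_less:
  assumes "\<mu> \<in> space (prob_algebra borel)" "\<nu> \<in> space (prob_algebra borel)"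
    and "prohorov_dist \<mu> \<nu> < e"
  obtains \<epsilon> where "R \<mu> \<nu> \<epsilon>" "\<epsilon> < e"
proof -
  have "\<exists>\<epsilon>\<in>{\<epsilon>. R \<mu> \<nu> \<epsilon>}. \<epsilon> < e"
    using assms(3) prohorov_nonempty[OF assms(1,2)] prohorov_bdd
    unfolding prohorov_alt[OF assms(1,2)] by (simp add: cInf_less_iff)
  thus ?thesis using that by blast
qed

private lemma prohorov_le:
  assumes "\<mu> \<in> space (prob_algebra borel)" "\<nu> \<in> space (prob_algebra borel)" "R \<mu> \<nu> \<epsilon>"
  shows "prohorov_dist \<mu> \<nu> \<le> \<epsilon>"
  unfolding prohorov_alt[OF assms(1,2)]
  by (rule cInf_lower[OF _ prohorov_bdd]) (simp add: assms)

private lemma prohorov_nonneg: "0 \<le> prohorov_dist (\<mu>::'a measure) \<nu>"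
proof (cases "\<mu> \<in> space (prob_algebra borel) \<and> \<nu> \<in> space (prob_algebra borel)")
  case True
  thus ?thesis using prohorov_nonempty[of \<mu> \<nu>]
    by (simp add: prohorov_alt) (intro cInf_greatest, auto simp: R_def)
qed (auto simp: prohorov_dist_def)

private lemma prohorov_R_half:
  assumes "prob_space (\<nu>::'a measure)" "prob_space (\<kappa>::'a measure)"
    "sets \<nu> = sets borel" "sets \<kappa> = sets borel"
    and 1: "\<And>A. A \<in> sets borel \<Longrightarrow> measure (\<mu>::'a measure) A \<le> measure \<nu> (\<Union>a\<in>A. ball a \<epsilon>) + \<epsilon>"
    and 2: "\<And>A. A \<in> sets borel \<Longrightarrow> measure \<nu> A \<le> measure \<kappa> (\<Union>a\<in>A. ball a \<delta>) + \<delta>"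
    and A: "A \<in> sets borel"
  shows "measure \<mu> A \<le> measure \<kappa> (\<Union>a\<in>A. ball a (\<epsilon> + \<delta>)) + (\<epsilon> + \<delta>)"
proof -
  interpret K: prob_space \<kappa> by fact
  let ?B = "\<Union>a\<in>A. ball a \<epsilon>"
  have "measure \<mu> A \<le> measure \<nu> ?B + \<epsilon>" using 1[OF A] .
  also have "measure \<nu> ?B \<le> measure \<kappa> (\<Union>a\<in>?B. ball a \<delta>) + \<delta>"
    by (rule 2) (intro borel_open open_UN ballI open_ball)
  also have "measure \<kappa> (\<Union>a\<in>?B. ball a \<delta>) \<le> measure \<kappa> (\<Union>a\<in>A. ball a (\<epsilon> + \<delta>))"
  proof (rule K.finite_measure_mono)
    show "(\<Union>a\<in>?B. ball a \<delta>) \<subseteq> (\<Union>a\<in>A. ball a (\<epsilon> + \<delta>))"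
    proof
      fix x assume "x \<in> (\<Union>a\<in>?B. ball a \<delta>)"
      then obtain a b where ab: "a \<in> A" "dist a b < \<epsilon>" "dist b x < \<delta>" by auto
      have "dist a x < \<epsilon> + \<delta>" using ab dist_triangle[of a x b] by linarith
      thus "x \<in> (\<Union>a\<in>A. ball a (\<epsilon> + \<delta>))" using ab by auto
    qed
    show "(\<Union>a\<in>A. ball a (\<epsilon> + \<delta>)) \<in> sets \<kappa>"
      unfolding \<open>sets \<kappa> = sets borel\<close> by (intro borel_open open_UN ballI open_ball)
  qed
  finally show ?thesis by simp
qed

private lemma prohorov_closed_le:
  assumes "prob_space (\<nu>::'a measure)" "sets \<nu> = sets borel"
    and R: "\<And>e. e > 0 \<Longrightarrow> \<exists>\<epsilon><e. R \<mu> \<nu> \<epsilon>" and C: "closed C"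
  shows "measure \<mu> C \<le> measure \<nu> C"
proof -
  interpret N: prob_space \<nu> by fact
  define B where "B n = (\<Union>a\<in>C. ball a (inverse (real (Suc n))))" for n
  have CB: "C = (\<Inter>n. B n)"
  proof (intro set_eqI iffI)
    fix x assume "x \<in> C" thus "x \<in> (\<Inter>n. B n)" by (force simp: B_def)
  next
    fix x assume x: "x \<in> (\<Inter>n. B n)"
    have "\<exists>y\<in>C. dist y x < e" if "e > 0" for e
    proof -
      obtain n where "inverse (real (Suc n)) < e" using reals_Archimedean \<open>e > 0\<close> by blast
      moreover have "x \<in> B n" using x by blast
      then obtain y where "y \<in> C" "dist y x < inverse (real (Suc n))"
        by (auto simp: B_def)
      ultimately show ?thesis by (meson less_trans)
    qed
    thus "x \<in> C" using closed_approachable[OF C] by blast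
  qed
  have dec: "decseq B"
  proof (rule decseq_SucI)
    fix n
    have "inverse (real (Suc (Suc n))) \<le> inverse (real (Suc n))" by (simp add: field_simps)
    thus "B (Suc n) \<subseteq> B n" unfolding B_def by (intro UN_mono subset_ball) auto
  qed
  have B: "B n \<in> sets \<nu>" for n
    unfolding B_def assms(2) by (intro borel_open open_UN ballI open_ball)
  have lim: "(\<lambda>n. measure \<nu> (B n) + inverse (real (Suc n))) \<longlonglongrightarrow> measure \<nu> C + 0"
    unfolding CB using B dec
    by (intro tendsto_add N.finite_Lim_measure_decseq LIMSEQ_inverse_real_of_nat) auto
  have "measure \<mu> C \<le> measure \<nu> (B n) + inverse (real (Suc n))" for n
  proof -
    obtain \<epsilon> where \<epsilon>: "\<epsilon> < inverse (real (Suc n))" "R \<mu> \<nu> \<epsilon>"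
      using R[of "inverse (real (Suc n))"] by auto
    have "measure \<mu> C \<le> measure \<nu> (\<Union>a\<in>C. ball a \<epsilon>) + \<epsilon>"
      using \<epsilon>(2) C unfolding R_def by auto
    also have "measure \<nu> (\<Union>a\<in>C. ball a \<epsilon>) \<le> measure \<nu> (B n)"
      using \<epsilon>(1) B by (intro N.finite_measure_mono) (auto simp: B_def)
    finally show ?thesis using \<epsilon>(1) by linarith
  qed
  thus ?thesis using LIMSEQ_le_const[OF lim] by auto
qed

lemma Metric_space_prohorov: "Metric_space (space (prob_algebra borel)) (prohorov_dist :: 'a measure \<Rightarrow> _)"
proof
  fix \<mu> \<nu> :: "'a measure"
  show "0 \<le> prohorov_dist \<mu> \<nu>" by (rule prohorov_nonneg)
  show "prohorov_dist \<mu> \<nu> = prohorov_dist \<nu> \<mu>"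
    unfolding prohorov_dist_def by (auto simp: conj_commute)
next
  fix \<mu> \<nu> :: "'a measure"
  assume M: "\<mu> \<in> space (prob_algebra borel)" and N: "\<nu> \<in> space (prob_algebra borel)"
  have p: "prob_space \<mu>" "prob_space \<nu>" and s: "sets \<mu> = sets borel" "sets \<nu> = sets borel"
    using M N by (auto simp: space_prob_algebra)
  interpret P1: prob_space \<mu> by fact
  interpret P2: prob_space \<nu> by fact
  show "prohorov_dist \<mu> \<nu> = 0 \<longleftrightarrow> \<mu> = \<nu>"
  proof
    assume 0: "prohorov_dist \<mu> \<nu> = 0"
    have R: "\<exists>\<epsilon><e. R \<mu> \<nu> \<epsilon>" if "e > 0" for e
      using prohorov_less[OF M N, of e] 0 that by metis
    have R': "\<exists>\<epsilon><e. R \<nu> \<mu> \<epsilon>" if "e > 0" for e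
      using R[OF that] by (auto simp: R_def)
    have eq: "measure \<mu> C = measure \<nu> C" if "closed C" for C
      using prohorov_closed_le[OF p(2) s(2) R that] prohorov_closed_le[OF p(1) s(1) R' that]
      by simp
    show "\<mu> = \<nu>"
    proof (rule measure_eqI_generator_eq[where E = "Collect closed" and \<Omega> = UNIV and A = "\<lambda>_. UNIV"])
      show "Int_stable (Collect closed :: 'a set set)" by (auto simp: Int_stable_def)
      show "emeasure \<mu> X = emeasure \<nu> X" if "X \<in> Collect closed" for X
        using eq that by (simp add: P1.emeasure_eq_measure P2.emeasure_eq_measure)
      show "sets \<mu> = sigma_sets UNIV (Collect closed)" "sets \<nu> = sigma_sets UNIV (Collect closed)"
        by (simp_all add: s borel_eq_closed)
    qed auto
  next
    assume eq: "\<mu> = \<nu>"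
    have "R \<mu> \<nu> e" if "e > 0" for e
    proof -
      have "measure \<mu> A \<le> measure \<mu> (\<Union>a\<in>A. ball a e) + e" for A
      proof -
        have "measure \<mu> A \<le> measure \<mu> (\<Union>a\<in>A. ball a e)"
        proof (rule P1.finite_measure_mono)
          show "A \<subseteq> (\<Union>a\<in>A. ball a e)" using that by force
          show "(\<Union>a\<in>A. ball a e) \<in> sets \<mu>"
            unfolding s by (intro borel_open open_UN ballI open_ball)
        qed
        thus ?thesis using that by linarith
      qed
      thus ?thesis using that eq by (simp add: R_def)
    qed
    hence "prohorov_dist \<mu> \<nu> \<le> e" if "e > 0" for e using prohorov_le[OF M N] that by blast
    hence "prohorov_dist \<mu> \<nu> \<le> 0" by (meson dense_ge)
    thus "prohorov_dist \<mu> \<nu> = 0" using prohorov_nonneg[of \<mu> \<nu>] by simp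
  qed
next
  fix \<mu> \<nu> \<kappa> :: "'a measure"
  assume M: "\<mu> \<in> space (prob_algebra borel)" and N: "\<nu> \<in> space (prob_algebra borel)"
    and K: "\<kappa> \<in> space (prob_algebra borel)"
  have p: "prob_space \<mu>" "prob_space \<nu>" "prob_space \<kappa>"
    and s: "sets \<mu> = sets borel" "sets \<nu> = sets borel" "sets \<kappa> = sets borel"
    using M N K by (auto simp: space_prob_algebra)
  show "prohorov_dist \<mu> \<kappa> \<le> prohorov_dist \<mu> \<nu> + prohorov_dist \<nu> \<kappa>"
  proof (rule field_le_epsilon)
    fix e :: real assume "e > 0"
    obtain \<epsilon> where 1: "R \<mu> \<nu> \<epsilon>" "\<epsilon> < prohorov_dist \<mu> \<nu> + e / 2"
      using prohorov_less[OF M N, of "prohorov_dist \<mu> \<nu> + e / 2"] \<open>e > 0\<close> by auto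
    obtain \<delta> where 2: "R \<nu> \<kappa> \<delta>" "\<delta> < prohorov_dist \<nu> \<kappa> + e / 2"
      using prohorov_less[OF N K, of "prohorov_dist \<nu> \<kappa> + e / 2"] \<open>e > 0\<close> by auto
    have "R \<mu> \<kappa> (\<epsilon> + \<delta>)"
      unfolding R_def
    proof (intro conjI ballI)
      show "0 < \<epsilon> + \<delta>" using 1 2 by (simp add: R_def)
      fix A :: "'a set" assume A: "A \<in> sets borel"
      show "measure \<mu> A \<le> measure \<kappa> (\<Union>a\<in>A. ball a (\<epsilon> + \<delta>)) + (\<epsilon> + \<delta>)"
        by (rule prohorov_R_half[OF p(2,3) s(2,3) _ _ A]) (use 1 2 in \<open>auto simp: R_def\<close>)
      have "measure \<kappa> A \<le> measure \<mu> (\<Union>a\<in>A. ball a (\<delta> + \<epsilon>)) + (\<delta> + \<epsilon>)"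
        by (rule prohorov_R_half[OF p(2,1) s(2,1) _ _ A]) (use 1 2 in \<open>auto simp: R_def\<close>)
      thus "measure \<kappa> A \<le> measure \<mu> (\<Union>a\<in>A. ball a (\<epsilon> + \<delta>)) + (\<epsilon> + \<delta>)"
        by (simp add: add.commute)
    qed
    hence "prohorov_dist \<mu> \<kappa> \<le> \<epsilon> + \<delta>" by (rule prohorov_le[OF M K])
    thus "prohorov_dist \<mu> \<kappa> \<le> prohorov_dist \<mu> \<nu> + prohorov_dist \<nu> \<kappa> + e"
      using 1 2 by linarith
  qed
qed

end

lemma mspace_prohorov [simp]: "mspace prohorov_metric = space (prob_algebra borel)"
  unfolding prohorov_metric_def using Metric_space_prohorov by (rule Metric_space.mspace_metric)

lemma mdist_prohorov [simp]: "mdist prohorov_metric = prohorov_dist"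
  unfolding prohorov_metric_def using Metric_space_prohorov by (rule Metric_space.mdist_metric)


section \<open>Weak convergence and the Skorohod space\<close>

definition borel_of :: "'a topology \<Rightarrow> 'a measure" where
  "borel_of X = sigma (topspace X) {U. openin X U}"

definition weak_conv_in :: "'a topology \<Rightarrow> (nat \<Rightarrow> 'a measure) \<Rightarrow> 'a measure \<Rightarrow> bool" where
  "weak_conv_in X N L \<longleftrightarrow>
     L \<in> space (prob_algebra (borel_of X)) \<and>
     (\<forall>\<^sub>F n in sequentially. N n \<in> space (prob_algebra (borel_of X))) \<and>
     (\<forall>f. continuous_map X euclideanreal f \<and> bounded (f ` topspace X) \<longrightarrow>
        (\<lambda>n. \<integral>x. f x \<partial>N n) \<longlonglongrightarrow> (\<integral>x. f x \<partial>L))"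

definition cadlag :: "'e metric \<Rightarrow> (real \<Rightarrow> 'e) set" where
  "cadlag m = {p \<in> {0..} \<rightarrow>\<^sub>E mspace m.
     (\<forall>t\<ge>0. limitin (mtopology_of m) p (p t) (at_right t)) \<and>
     (\<forall>t>0. \<exists>l. limitin (mtopology_of m) p l (at_left t))}"

text \<open>Convergence in the Skorohod J1 topology, with time changes that are increasing bijections
  of the half-line.\<close>

definition skorohod_conv :: "'e metric \<Rightarrow> (nat \<Rightarrow> real \<Rightarrow> 'e) \<Rightarrow> (real \<Rightarrow> 'e) \<Rightarrow> bool" where
  "skorohod_conv m p q \<longleftrightarrow>
     (\<exists>\<tau> :: nat \<Rightarrow> real \<Rightarrow> real.
        (\<forall>k. strict_mono_on {0..} (\<tau> k) \<and> \<tau> k ` {0..} = {0..}) \<and>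
        (\<forall>T\<ge>0. uniform_limit {0..T} \<tau> (\<lambda>t. t) sequentially) \<and>
        (\<forall>T\<ge>0. \<forall>\<epsilon>>0. \<forall>\<^sub>F k in sequentially. \<forall>t\<in>{0..T}. mdist m (p k t) (q (\<tau> k t)) < \<epsilon>))"

text \<open>The Skorohod topology is metrizable, hence its open sets are exactly the sets that are
  sequentially open for the convergence above.\<close>

definition skorohod_topology :: "'e metric \<Rightarrow> (real \<Rightarrow> 'e) topology" where
  "skorohod_topology m = topology (\<lambda>U. U \<subseteq> cadlag m \<and>
     (\<forall>p q. range p \<subseteq> cadlag m \<and> q \<in> U \<and> skorohod_conv m p q
        \<longrightarrow> (\<forall>\<^sub>F k in sequentially. p k \<in> U)))"

lemma openin_skorohod_topology:
  "openin (skorohod_topology m) U \<longleftrightarrow> U \<subseteq> cadlag m \<and>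
     (\<forall>p q. range p \<subseteq> cadlag m \<and> q \<in> U \<and> skorohod_conv m p q
        \<longrightarrow> (\<forall>\<^sub>F k in sequentially. p k \<in> U))"
proof -
  have "istopology (\<lambda>U. U \<subseteq> cadlag m \<and>
     (\<forall>p q. range p \<subseteq> cadlag m \<and> q \<in> U \<and> skorohod_conv m p q
        \<longrightarrow> (\<forall>\<^sub>F k in sequentially. p k \<in> U)))" (is "istopology ?O")
    unfolding istopology_def
  proof (intro conjI allI impI)
    fix S T assume "?O S" "?O T"
    thus "S \<inter> T \<subseteq> cadlag m" by blast
    fix p q assume "range p \<subseteq> cadlag m \<and> q \<in> S \<inter> T \<and> skorohod_conv m p q"
    hence "\<forall>\<^sub>F k in sequentially. p k \<in> S" "\<forall>\<^sub>F k in sequentially. p k \<in> T"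
      using \<open>?O S\<close> \<open>?O T\<close> by blast+
    thus "\<forall>\<^sub>F k in sequentially. p k \<in> S \<inter> T" by eventually_elim simp
  next
    fix K assume K: "\<forall>S\<in>K. ?O S"
    thus "\<Union>K \<subseteq> cadlag m" by blast
    fix p q assume pq: "range p \<subseteq> cadlag m \<and> q \<in> \<Union>K \<and> skorohod_conv m p q"
    then obtain S where S: "S \<in> K" "q \<in> S" by blast
    hence "\<forall>\<^sub>F k in sequentially. p k \<in> S" using K pq by blast
    thus "\<forall>\<^sub>F k in sequentially. p k \<in> \<Union>K" by eventually_elim (use S in blast)
  qed
  thus ?thesis unfolding skorohod_topology_def by (simp add: topology_inverse')
qed

lemma topspace_skorohod_topology [simp]: "topspace (skorohod_topology m) = cadlag m"
proof
  show "topspace (skorohod_topology m) \<subseteq> cadlag m"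
    unfolding topspace_def openin_skorohod_topology by blast
  have "openin (skorohod_topology m) (cadlag m)"
    unfolding openin_skorohod_topology by (auto intro!: always_eventually)
  thus "cadlag m \<subseteq> topspace (skorohod_topology m)" by (rule openin_subset)
qed


section \<open>The potential\<close>

definition Psi :: "(real \<Rightarrow> real) \<Rightarrow> real \<Rightarrow> real" where
  "Psi V z = - z * deriv V z"

text \<open>In the \<open>L\<^sup>1\<close> condition the half-line is read as starting at the absolute value of t (for
  negative t it would contain the singularity of the limit at 0). The integral is taken in the
  extended sense, so that its smallness includes integrability.\<close>

locale admissible_potential =
  fixes V :: "real \<Rightarrow> real" and \<alpha> \<beta> :: real
  assumes V_differentiable: "\<And>z. V differentiable (at z)"
    and V_C1: "continuous_on UNIV (deriv V)"
    and V_even: "\<And>z. V (- z) = V z"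
    and V_nonneg: "\<And>z. V z \<ge> 0"
    and V_at_top: "(V \<longlongrightarrow> 0) at_top"
    and Psi_nonneg: "\<And>z. Psi V z \<ge> 0"
    and alpha_pos: "\<alpha> > 0"
    and beta_pos: "\<beta> > 0"
    and Psi_scaling: "\<And>K. compact K \<Longrightarrow> K \<subseteq> {-1/2..1/2} - {0} \<Longrightarrow>
          uniform_limit K (\<lambda>r z. r * Psi V (r powr (1 + \<alpha>) * z))
            (\<lambda>z. \<beta> * \<bar>z\<bar> powr (- \<beta>)) at_top"
    and Psi_scaling_L1: "\<And>K \<epsilon>. compact K \<Longrightarrow> K \<subseteq> {-1/2..1/2} - {0} \<Longrightarrow> \<epsilon> > 0 \<Longrightarrow>
          \<forall>\<^sub>F r in at_top. \<forall>t\<in>K.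
            (\<integral>\<^sup>+z\<in>{\<bar>t\<bar>..}.
               ennreal (\<bar>r * Psi V (r powr (1 + \<alpha>) * z) - \<beta> * z powr (- \<beta>)\<bar> / z) \<partial>lborel)
            < ennreal \<epsilon>"
    and V_le: "\<And>z. 0 < z \<Longrightarrow> z < 1 \<Longrightarrow> V z \<le> z powr (- \<beta>)"
    and V_ge: "\<And>z. 1 \<le> z \<Longrightarrow> V z \<ge> z powr (- \<beta>)"
    and Psi_le: "\<And>z. Psi V z \<le> \<beta> * V z"


section \<open>The particle system\<close>

text \<open>A configuration of n particles is a function on the indices 0, ..., n-1. The double sum
  includes the (constant) diagonal terms.\<close>

definition energy :: "(real \<Rightarrow> real) \<Rightarrow> real \<Rightarrow> nat \<Rightarrow> (nat \<Rightarrow> circle) \<Rightarrow> real" where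
  "energy V \<alpha> n x = (\<Sum>i<n. \<Sum>j<n. V (real n powr (1 + \<alpha>) * circle_diff (x i) (x j)))"

definition partition_fun :: "(real \<Rightarrow> real) \<Rightarrow> real \<Rightarrow> nat \<Rightarrow> real" where
  "partition_fun V \<alpha> n = (\<integral>x. exp (- energy V \<alpha> n x) \<partial>(\<Pi>\<^sub>M i\<in>{..<n}. circle_lebesgue))"

definition gibbs :: "(real \<Rightarrow> real) \<Rightarrow> real \<Rightarrow> nat \<Rightarrow> (nat \<Rightarrow> circle) measure" where
  "gibbs V \<alpha> n = density (\<Pi>\<^sub>M i\<in>{..<n}. circle_lebesgue)
     (\<lambda>x. ennreal (exp (- energy V \<alpha> n x) / partition_fun V \<alpha> n))"

text \<open>The map from \<open>(x\<^sub>0, \<dots>, x\<^sub>n\<^sub>-\<^sub>1)\<close> to the average of the Dirac measures at these points.\<close>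

definition empirical :: "nat \<Rightarrow> (nat \<Rightarrow> circle) \<Rightarrow> circle measure" where
  "empirical n x = distr (uniform_count_measure {..<n}) borel x"

lemma measure_empirical:
  assumes "A \<in> sets borel"
  shows "measure (empirical n x) A = (\<Sum>i<n. indicator A (x i)) / real n"
proof -
  have "measure (empirical n x) A = measure (uniform_count_measure {..<n}) (x -` A \<inter> {..<n})"
    unfolding empirical_def using assms by (subst measure_distr) (auto simp: space_uniform_count_measure)
  also have "\<dots> = real (card (x -` A \<inter> {..<n})) / real n"
    by (subst measure_uniform_count_measure) auto
  also have "real (card (x -` A \<inter> {..<n})) = (\<Sum>i<n. indicator A (x i))"
    by (simp add: indicator_def sum.If_cases Int_def vimage_def conj_commute)
  finally show ?thesis .
qed

definition empirical_gibbs :: "(real \<Rightarrow> real) \<Rightarrow> real \<Rightarrow> nat \<Rightarrow> circle measure measure" where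
  "empirical_gibbs V \<alpha> n =
     distr (gibbs V \<alpha> n) (borel_of (mtopology_of prohorov_metric)) (empirical n)"

text \<open>n independent standard Brownian motions relative to a filtration F (indexed by times
  \<open>t \<ge> 0\<close>; the values of F at negative times are irrelevant).\<close>

definition brownian_motions ::
  "'w measure \<Rightarrow> (real \<Rightarrow> 'w measure) \<Rightarrow> nat \<Rightarrow> (nat \<Rightarrow> real \<Rightarrow> 'w \<Rightarrow> real) \<Rightarrow> bool" where
  "brownian_motions M F n B \<longleftrightarrow>
     (\<forall>t\<ge>0. subalgebra M (F t)) \<and>
     (\<forall>s t. 0 \<le> s \<and> s \<le> t \<longrightarrow> sets (F s) \<subseteq> sets (F t)) \<and>
     (\<forall>i<n. \<forall>t\<ge>0. B i t \<in> borel_measurable (F t)) \<and>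
     (AE \<omega> in M. \<forall>i<n. B i 0 \<omega> = 0 \<and> continuous_on {0..} (\<lambda>t. B i t \<omega>)) \<and>
     (\<forall>s t. 0 \<le> s \<and> s < t \<longrightarrow>
        (\<forall>i<n. distributed M lborel (\<lambda>\<omega>. B i t \<omega> - B i s \<omega>) (normal_density 0 (sqrt (t - s)))) \<and>
        prob_space.indep_vars M (\<lambda>_. borel) (\<lambda>i \<omega>. B i t \<omega> - B i s \<omega>) {..<n} \<and>
        prob_space.indep_set M (sets (F s))
          (sets (vimage_algebra (space M) (\<lambda>\<omega>. \<lambda>i\<in>{..<n}. B i t \<omega> - B i s \<omega>)
             (\<Pi>\<^sub>M i\<in>{..<n}. borel))))"

definition drift :: "(real \<Rightarrow> real) \<Rightarrow> real \<Rightarrow> nat \<Rightarrow> (nat \<Rightarrow> circle) \<Rightarrow> nat \<Rightarrow> real" where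
  "drift V \<alpha> n x i = - (real n powr (1 + \<alpha>)) *
     (\<Sum>j\<in>{..<n} - {i}. deriv V (real n powr (1 + \<alpha>) * circle_diff (x i) (x j)))"

text \<open>Weak solutions of the SDE. The noise is additive, so the SDE in integrated form involves no
  stochastic integral; Brownian motion on the circle is the image of a real Brownian motion.\<close>

definition sde_solution ::
  "(real \<Rightarrow> real) \<Rightarrow> real \<Rightarrow> nat \<Rightarrow> 'w measure \<Rightarrow> (real \<Rightarrow> 'w \<Rightarrow> nat \<Rightarrow> circle) \<Rightarrow> (nat \<Rightarrow> circle) \<Rightarrow> bool"
where
  "sde_solution V \<alpha> n M x \<eta> \<longleftrightarrow> prob_space M \<and>
     (\<exists>F B. brownian_motions M F n B \<and>
        (\<forall>t\<ge>0. x t \<in> F t \<rightarrow>\<^sub>M circle_power n) \<and>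
        (AE \<omega> in M. x 0 \<omega> = \<eta>) \<and>
        (AE \<omega> in M. \<forall>t\<ge>0. \<forall>i<n.
           x t \<omega> i = rotate_circle (x 0 \<omega> i)
             ((\<integral>s\<in>{0..t}. drift V \<alpha> n (x s \<omega>) i \<partial>lborel) + B i t \<omega>)))"

text \<open>A family \<open>(x, (P\<^sub>\<eta>)\<^sub>\<eta>)\<close> on a measurable space \<open>\<Omega>\<close>: a process with continuous
  paths and a probability kernel such that under \<open>P\<^sub>\<eta>\<close> the process solves the SDE started at
  \<open>\<eta>\<close>.\<close>

definition sde_diffusion ::
  "(real \<Rightarrow> real) \<Rightarrow> real \<Rightarrow> nat \<Rightarrow> 'w measure \<Rightarrow> (real \<Rightarrow> 'w \<Rightarrow> nat \<Rightarrow> circle)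
    \<Rightarrow> ((nat \<Rightarrow> circle) \<Rightarrow> 'w measure) \<Rightarrow> bool"
where
  "sde_diffusion V \<alpha> n \<Omega> x P \<longleftrightarrow>
     (\<forall>t\<ge>0. x t \<in> \<Omega> \<rightarrow>\<^sub>M circle_power n) \<and>
     (\<forall>\<omega>\<in>space \<Omega>. \<forall>i<n. continuous_on {0..} (\<lambda>t. x t \<omega> i)) \<and>
     P \<in> circle_power n \<rightarrow>\<^sub>M prob_algebra \<Omega> \<and>
     (\<forall>\<eta>\<in>space (circle_power n). sde_solution V \<alpha> n (P \<eta>) x \<eta>)"

text \<open>The path of empirical measures, and its law on the Skorohod space when x has law M.\<close>

definition empirical_path :: "nat \<Rightarrow> (real \<Rightarrow> 'w \<Rightarrow> nat \<Rightarrow> circle) \<Rightarrow> 'w \<Rightarrow> real \<Rightarrow> circle measure"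
  where "empirical_path n x \<omega> = (\<lambda>t\<in>{0..}. empirical n (x t \<omega>))"

definition empirical_law ::
  "nat \<Rightarrow> (real \<Rightarrow> 'w \<Rightarrow> nat \<Rightarrow> circle) \<Rightarrow> 'w measure \<Rightarrow> (real \<Rightarrow> circle measure) measure" where
  "empirical_law n x M = distr M (borel_of (skorohod_topology prohorov_metric)) (empirical_path n x)"

text \<open>The mixture of the laws of the empirical process over the initial configuration. The law
  started at a measure \<open>\<mu>\<close> is the one for any configuration with empirical measure \<open>\<mu>\<close>, so the
  integral over \<open>\<mu>\<close> with respect to the image measure \<open>empirical_gibbs\<close> is the integral over
  configurations with respect to \<open>gibbs\<close>.\<close>

definition stationary_empirical_law ::
  "(real \<Rightarrow> real) \<Rightarrow> real \<Rightarrow> nat \<Rightarrow> (real \<Rightarrow> 'w \<Rightarrow> nat \<Rightarrow> circle)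
    \<Rightarrow> ((nat \<Rightarrow> circle) \<Rightarrow> 'w measure) \<Rightarrow> (real \<Rightarrow> circle measure) measure"
where
  "stationary_empirical_law V \<alpha> n x P = gibbs V \<alpha> n \<bind> (\<lambda>\<eta>. empirical_law n x (P \<eta>))"

end

(* Since V(z) z^beta is nondecreasing and tends to 1, the rescaled interaction n V(n^(1+alpha) z)
   increases to |z|^(-beta): the energy is n times a mean-field energy. That energy is, up to small errors, a
   mixture of triangular kernels; these are positive definite because they count overlaps of
   arcs. So no configuration has an energy lower by a multiple of n than the average one, the density
   of the Gibbs measure is subexponential, and Hoeffding's inequality makes the deviations of the
   empirical measure from arc length exponentially improbable. For the processes this estimate, the
   invariance and a union bound handle polynomially many times up to a given horizon. Between
   these times particles hardly move: the drift is polynomially bounded in n, and Brownian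
   oscillations are controlled by chaining. *)

theory Submission
  imports Defs
begin

section \<open>The circle\<close>

text \<open>Three obstacles shape the proof. The limit kernel is singular, while positive
  definiteness is used for all configurations, including those with coinciding particles. It is
  therefore truncated to a bounded minorant, whose diagonal costs only a constant once the factor n
  is divided out. The truncation loses an arbitrarily small multiple of n in the exponent, which is
  harmless because the Hoeffding rate is a fixed multiple of n. For the processes neither tightness
  nor a generator enters: the limit path is constant, so locally uniform closeness with trivial time
  changes suffices. The mesh is a high power of 1/n; exponential smallness absorbs the number of
  grid times, and the fourth moment of the noise makes the total oscillation probability vanish.
  Each solution carries its own Brownian motions, so the exceptional events are stated through the
  particles alone and can then be averaged over the initial configuration. Finally, the open sets of
  the path space are defined through sequences, so Borel measurability of the empirical paths is
  obtained from approximations with countably many values.\<close>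

lemma rep_circle_bounds: "0 \<le> rep_circle x" "rep_circle x < 1"
  using rep_circle[of x] by auto

lemma rep_to_circle [simp]: "rep_circle (to_circle a) = frac a"
  unfolding to_circle_def by (rule abs_circle_inverse) (simp add: frac_ge_0 frac_lt_1)

lemma to_circle_rep [simp]: "to_circle (rep_circle x) = x"
  using rep_circle_bounds[of x] by (simp add: to_circle_def frac_eq rep_circle_inverse)

lemma dist_to_circle_le: "dist (to_circle a) (to_circle b) \<le> \<bar>a - b\<bar>"
  using abs_circle_diff_le[of "to_circle a" "to_circle b" "\<lfloor>b\<rfloor> - \<lfloor>a\<rfloor>"]
  by (simp add: dist_circle_def frac_def algebra_simps)

lemma dist_rotate_circle_le: "dist (rotate_circle x a) (rotate_circle x b) \<le> \<bar>a - b\<bar>"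
  using dist_to_circle_le[of "rep_circle x + a" "rep_circle x + b"] by (simp add: rotate_circle_def)

lemma dist_circle_le_rep: "dist x y \<le> \<bar>rep_circle x - rep_circle y\<bar>"
  using dist_to_circle_le[of "rep_circle x" "rep_circle y"] by simp

lemma continuous_on_to_circle: "continuous_on A to_circle"
proof (rule continuous_onI)
  fix x e :: real assume "e > 0"
  show "\<exists>d>0. \<forall>x'\<in>A. dist x' x < d \<longrightarrow> dist (to_circle x') (to_circle x) \<le> e"
    by (rule exI[of _ e])
       (use \<open>e > 0\<close> dist_to_circle_le in \<open>fastforce simp: dist_real_def intro: order_trans less_imp_le\<close>)
qed

lemma to_circle_measurable [measurable]: "to_circle \<in> borel \<rightarrow>\<^sub>M borel"
  by (rule borel_measurable_continuous_onI[OF continuous_on_to_circle])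

lemma rep_circle_measurable [measurable]: "rep_circle \<in> borel_measurable borel"
proof (rule borel_measurableI_le)
  fix a :: real
  show "{x \<in> space borel. rep_circle x \<le> a} \<in> sets borel"
  proof (cases "a < 1")
    case True
    have "{x. rep_circle x \<le> a} = to_circle ` {0..a}"
    proof safe
      fix x assume "rep_circle x \<le> a"
      thus "x \<in> to_circle ` {0..a}"
        by (intro image_eqI[of _ _ "rep_circle x"]) (auto simp: rep_circle_bounds)
    next
      fix b assume "b \<in> {0..a}"
      thus "rep_circle (to_circle b) \<le> a" using True by (simp add: frac_eq)
    qed
    also have "closed \<dots>"
      by (intro compact_imp_closed compact_continuous_image continuous_on_to_circle) simp
    finally show ?thesis by simp
  next
    case False
    have "rep_circle x \<le> a" for x using rep_circle_bounds[of x] False by linarith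
    thus ?thesis by simp
  qed
qed

lemma circle_diff_measurable [measurable (raw)]:
  assumes [measurable]: "f \<in> M \<rightarrow>\<^sub>M borel" "g \<in> M \<rightarrow>\<^sub>M borel"
  shows "(\<lambda>w. circle_diff (f w) (g w)) \<in> borel_measurable M"
  unfolding circle_diff_def frac_def by measurable

lemma dist_circle_measurable [measurable (raw)]:
  fixes f g :: "'a \<Rightarrow> circle"
  assumes [measurable]: "f \<in> M \<rightarrow>\<^sub>M borel" "g \<in> M \<rightarrow>\<^sub>M borel"
  shows "(\<lambda>w. dist (f w) (g w)) \<in> borel_measurable M"
  unfolding dist_circle_def by measurable

section \<open>Arc length and its rotation invariance\<close>

lemma sets_circle_lebesgue [measurable_cong, simp]: "sets circle_lebesgue = sets borel"
  by (simp add: circle_lebesgue_def)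

lemma space_circle_lebesgue [simp]: "space circle_lebesgue = UNIV"
  by (simp add: circle_lebesgue_def)

lemma nn_integral_circle_lebesgue:
  assumes [measurable]: "h \<in> borel_measurable borel"
  shows "(\<integral>\<^sup>+x. h x \<partial>circle_lebesgue) = (\<integral>\<^sup>+u\<in>{0..<1}. h (to_circle u) \<partial>lborel)"
proof -
  have [measurable]: "to_circle \<in> restrict_space lborel {0..<1} \<rightarrow>\<^sub>M borel"
    by (rule measurable_restrict_space1) simp
  have "(\<integral>\<^sup>+x. h x \<partial>circle_lebesgue) = (\<integral>\<^sup>+u. h (to_circle u) \<partial>restrict_space lborel {0..<1})"
    unfolding circle_lebesgue_def by (subst nn_integral_distr) simp_all
  also have "\<dots> = (\<integral>\<^sup>+u\<in>{0..<1}. h (to_circle u) \<partial>lborel)"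
    by (subst nn_integral_restrict_space) simp_all
  finally show ?thesis .
qed

lemma prob_space_circle_lebesgue: "prob_space circle_lebesgue"
proof
  have "emeasure circle_lebesgue UNIV = (\<integral>\<^sup>+x. 1 \<partial>circle_lebesgue)" by simp
  also have "\<dots> = 1" by (subst nn_integral_circle_lebesgue) simp_all
  finally show "emeasure circle_lebesgue (space circle_lebesgue) = 1" by simp
qed

text \<open>Adding \<open>c\<close> modulo 1 exchanges two intervals: with
  \<open>d = frac c\<close>, one piece is translated onto \<open>{d..<1}\<close> and the other onto
  \<open>{0..<d}\<close>.\<close>

lemma nn_integral_frac_shift:
  assumes [measurable]: "h \<in> borel_measurable borel"
  shows "(\<integral>\<^sup>+u\<in>{0..<1}. h (frac (u + c)) \<partial>lborel) = (\<integral>\<^sup>+u\<in>{0..<1::real}. h u \<partial>lborel)"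
proof -
  define d where "d = frac c"
  have d: "0 \<le> d" "d < 1" by (simp_all add: d_def frac_ge_0 frac_lt_1)
  have fr: "frac (u + c) = (if u + d < 1 then u + d else u + d - 1)" if "0 \<le> u" "u < 1" for u
    using that frac_add[of u c] by (simp add: d_def frac_eq)
  have "(\<integral>\<^sup>+u\<in>{0..<1}. h (frac (u + c)) \<partial>lborel) =
        (\<integral>\<^sup>+u. (h (d + 1 * u) * indicator {d..<1} (d + 1 * u) +
              h ((d - 1) + 1 * u) * indicator {0..<d} ((d - 1) + 1 * u)) \<partial>lborel)"
    using d by (intro nn_integral_cong) (auto simp: indicator_def fr add.commute algebra_simps)
  also have "\<dots> = (\<integral>\<^sup>+u. h (d + 1 * u) * indicator {d..<1} (d + 1 * u) \<partial>lborel) +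
              (\<integral>\<^sup>+u. h ((d - 1) + 1 * u) * indicator {0..<d} ((d - 1) + 1 * u) \<partial>lborel)"
    by (rule nn_integral_add) simp_all
  also have "(\<integral>\<^sup>+u. h (d + 1 * u) * indicator {d..<1} (d + 1 * u) \<partial>lborel) =
      (\<integral>\<^sup>+u. h u * indicator {d..<1} u \<partial>lborel)"
    by (subst nn_integral_real_affine[of "\<lambda>u. h u * indicator {d..<1} u" 1 d]) simp_all
  also have "(\<integral>\<^sup>+u. h ((d - 1) + 1 * u) * indicator {0..<d} ((d - 1) + 1 * u) \<partial>lborel) =
      (\<integral>\<^sup>+u. h u * indicator {0..<d} u \<partial>lborel)"
    by (subst nn_integral_real_affine[of "\<lambda>u. h u * indicator {0..<d} u" 1 "d - 1"]) simp_all
  also have "(\<integral>\<^sup>+u. h u * indicator {d..<1} u \<partial>lborel) + (\<integral>\<^sup>+u. h u * indicator {0..<d} u \<partial>lborel) =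
     (\<integral>\<^sup>+u. h u * indicator {d..<1} u + h u * indicator {0..<d} u \<partial>lborel)"
    by (rule nn_integral_add[symmetric]) simp_all
  also have "\<dots> = (\<integral>\<^sup>+u\<in>{0..<1}. h u \<partial>lborel)"
    using d by (intro nn_integral_cong) (auto simp: indicator_def)
  finally show ?thesis .
qed

text \<open>By rotation invariance the difference to any fixed point is uniform on the interval from
  -1/2 to 1/2.\<close>

lemma nn_integral_circle_diff:
  assumes [measurable]: "h \<in> borel_measurable borel"
  shows "(\<integral>\<^sup>+y. h (circle_diff y x) \<partial>circle_lebesgue) = (\<integral>\<^sup>+u\<in>{0..<1}. h (u - 1/2) \<partial>lborel)"
proof -
  have eq: "circle_diff (to_circle u) x = frac (u + (1/2 - rep_circle x)) - 1/2"
    if "0 \<le> u" "u < 1" for u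
    using that by (simp add: circle_diff_def frac_eq algebra_simps)
  have "(\<integral>\<^sup>+y. h (circle_diff y x) \<partial>circle_lebesgue) =
      (\<integral>\<^sup>+u\<in>{0..<1}. h (circle_diff (to_circle u) x) \<partial>lborel)"
    by (rule nn_integral_circle_lebesgue) measurable
  also have "\<dots> = (\<integral>\<^sup>+u\<in>{0..<1}. h (frac (u + (1/2 - rep_circle x)) - 1/2) \<partial>lborel)"
    by (intro nn_integral_cong) (auto simp: indicator_def eq)
  also have "\<dots> = (\<integral>\<^sup>+u\<in>{0..<1}. h (u - 1/2) \<partial>lborel)"
    by (rule nn_integral_frac_shift[of "\<lambda>u. h (u - 1/2)"]) measurable
  finally show ?thesis .
qed

lemma frac_half_shift: "frac (a + 1/2) = (if frac a < 1/2 then frac a + 1/2 else frac a - 1/2)" for a :: real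
  by (simp add: frac_add frac_eq)

lemma dist_circle_frac:
  "dist x y = min (frac (rep_circle x - rep_circle y)) (1 - frac (rep_circle x - rep_circle y))"
  using frac_ge_0[of "rep_circle x - rep_circle y"] frac_lt_1[of "rep_circle x - rep_circle y"]
  unfolding dist_circle_def circle_diff_def by (auto simp: frac_half_shift)

lemma dist_circle_le_half: "dist x y \<le> 1/2" for x y :: circle
  unfolding dist_circle_frac by linarith

section \<open>Overlaps of arcs and the triangular kernel\<close>

text \<open>The arc of length \<open>s\<close> starts at \<open>x\<close> instead of being centred
  there, so that membership is a single inequality; overlaps of two such arcs are
  unaffected.\<close>

definition circle_arc :: "real \<Rightarrow> circle \<Rightarrow> circle set" where
  "circle_arc s x = {y. frac (rep_circle y - rep_circle x) < s}"

lemma circle_arc_measurable [measurable]: "circle_arc s x \<in> sets borel"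
  unfolding circle_arc_def frac_def by measurable

lemma emeasure_arc_Int:
  assumes s: "0 \<le> s" "s \<le> 1"
  shows "emeasure circle_lebesgue (circle_arc s x \<inter> circle_arc s y) =
    emeasure lborel ({0..<s} \<inter> {u. frac (u + (rep_circle x - rep_circle y)) < s})"
proof -
  define c where "c = rep_circle x - rep_circle y"
  define h where "h u = (indicator {u. u < s \<and> frac (u + c) < s} u :: ennreal)" for u
  have [measurable]: "h \<in> borel_measurable borel" unfolding h_def frac_def by measurable
  have eq: "indicator (circle_arc s x \<inter> circle_arc s y) (to_circle u) = h (frac (u + (- rep_circle x)))"
    if "0 \<le> u" "u < 1" for u
  proof -
    have "frac (frac (u - rep_circle x) + c) = frac (u - rep_circle y)"
      using frac_add[of "frac (u - rep_circle x)" c] frac_add[of "u - rep_circle x" c]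
      by (simp add: c_def)
    thus ?thesis using that by (simp add: h_def circle_arc_def indicator_def frac_eq)
  qed
  have "emeasure circle_lebesgue (circle_arc s x \<inter> circle_arc s y) =
      (\<integral>\<^sup>+z. indicator (circle_arc s x \<inter> circle_arc s y) z \<partial>circle_lebesgue)"
    by (rule nn_integral_indicator[symmetric]) simp
  also have "\<dots> = (\<integral>\<^sup>+u\<in>{0..<1}. indicator (circle_arc s x \<inter> circle_arc s y) (to_circle u) \<partial>lborel)"
    by (rule nn_integral_circle_lebesgue) measurable
  also have "\<dots> = (\<integral>\<^sup>+u\<in>{0..<1}. h (frac (u + (- rep_circle x))) \<partial>lborel)"
    by (rule nn_integral_cong, rename_tac u, case_tac "u \<in> {0..<1::real}") (simp_all add: eq)
  also have "\<dots> = (\<integral>\<^sup>+u\<in>{0..<1}. h u \<partial>lborel)"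
    by (rule nn_integral_frac_shift) measurable
  also have "\<dots> = (\<integral>\<^sup>+u. indicator ({0..<s} \<inter> {u. frac (u + c) < s}) u \<partial>lborel)"
    using s by (intro nn_integral_cong) (auto simp: h_def indicator_def)
  also have "\<dots> = emeasure lborel ({0..<s} \<inter> {u. frac (u + c) < s})"
    unfolding frac_def by (rule nn_integral_indicator) measurable
  finally show ?thesis by (simp add: c_def)
qed

lemma measure_arc:
  assumes "0 \<le> s" "s \<le> 1"
  shows "measure circle_lebesgue (circle_arc s x) = s"
proof -
  have "{0..<s} \<inter> {u. frac u < s} = {0..<s}" using assms by (auto simp: frac_eq)
  hence "emeasure circle_lebesgue (circle_arc s x) = ennreal s"
    using emeasure_arc_Int[OF assms, of x x] assms by simp
  thus ?thesis using assms by (simp add: measure_def)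
qed

text \<open>Arcs of length at most 1/2 can meet at one end only; longer ones may meet at both, and
  then the bound fails. The two cases say which arc comes first.\<close>

lemma measure_arc_Int_le:
  assumes "0 \<le> s" "s \<le> 1/2"
  shows "measure circle_lebesgue (circle_arc s x \<inter> circle_arc s y) \<le> max 0 (s - dist x y)"
proof -
  define c where "c = frac (rep_circle x - rep_circle y)"
  have c: "0 \<le> c" "c < 1" by (simp_all add: c_def frac_ge_0 frac_lt_1)
  have fr: "frac (u + (rep_circle x - rep_circle y)) = (if u + c < 1 then u + c else u + c - 1)"
    if "0 \<le> u" "u < 1" for u
    using that frac_add[of u "rep_circle x - rep_circle y"] by (simp add: c_def frac_eq)
  have "emeasure circle_lebesgue (circle_arc s x \<inter> circle_arc s y) \<le> ennreal (max 0 (s - dist x y))"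
  proof (cases "c \<le> 1/2")
    case True
    hence "emeasure circle_lebesgue (circle_arc s x \<inter> circle_arc s y) \<le> emeasure lborel {0..<s - c}"
      using assms c by (subst emeasure_arc_Int) (auto intro!: emeasure_mono simp: fr split: if_splits)
    also have "\<dots> = ennreal (max 0 (s - dist x y))"
      using True unfolding dist_circle_frac c_def[symmetric]
      by (cases "0 \<le> s - c") (auto simp: max_def min_def)
    finally show ?thesis .
  next
    case False
    hence "emeasure circle_lebesgue (circle_arc s x \<inter> circle_arc s y) \<le> emeasure lborel {1 - c..<s}"
      using assms c by (subst emeasure_arc_Int) (auto intro!: emeasure_mono simp: fr split: if_splits)
    also have "\<dots> = ennreal (max 0 (s - dist x y))"
      using False unfolding dist_circle_frac c_def[symmetric]
      by (cases "1 - c \<le> s") (auto simp: max_def min_def)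
    finally show ?thesis .
  qed
  thus ?thesis
    unfolding finite_measure.emeasure_eq_measure[OF prob_space.axioms(1)[OF prob_space_circle_lebesgue]]
    by (metis ennreal_le_iff max.cobounded1)
qed

text \<open>The triangular kernel dominates the overlap of two arcs, so its double sum dominates a mean
  square; this is its positive definiteness.\<close>

lemma sum_triangle_ge:
  fixes x :: "nat \<Rightarrow> circle"
  assumes s: "0 \<le> s" "s \<le> 1/2"
  shows "(\<Sum>i<n. \<Sum>j<n. max 0 (s - dist (x i) (x j))) \<ge> (real n * s)\<^sup>2"
proof -
  interpret L: prob_space circle_lebesgue by (rule prob_space_circle_lebesgue)
  \<comment> \<open>\<open>X y\<close> counts the arcs that contain \<open>y\<close>. Its mean is n
    s and its second moment is the sum of all overlaps, so the claim is nonnegativity of the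
    variance.\<close>
  define X where "X y = (\<Sum>i<n. indicator (circle_arc s (x i)) y :: real)" for y
  have X2: "(X y)\<^sup>2 = (\<Sum>i<n. \<Sum>j<n. indicator (circle_arc s (x i) \<inter> circle_arc s (x j)) y)" for y
    unfolding X_def power2_eq_square sum_product by (simp add: indicator_inter_arith)
  have "L.expectation X = real n * s"
    unfolding X_def using s by (subst Bochner_Integration.integral_sum) (simp_all add: measure_arc L.emeasure_eq_measure)
  moreover have "L.expectation (\<lambda>y. (X y)\<^sup>2) =
      (\<Sum>i<n. \<Sum>j<n. measure circle_lebesgue (circle_arc s (x i) \<inter> circle_arc s (x j)))"
    unfolding X2 by (simp add: L.emeasure_eq_measure)
  moreover have "integrable circle_lebesgue X" "integrable circle_lebesgue (\<lambda>y. (X y)\<^sup>2)"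
    unfolding X2 by (simp_all add: X_def[abs_def] L.emeasure_eq_measure)
  hence "L.expectation (\<lambda>y. (X y)\<^sup>2) - (L.expectation X)\<^sup>2 \<ge> 0"
    using L.variance_eq[of X] L.variance_positive[of X] by simp
  moreover have "(\<Sum>i<n. \<Sum>j<n. measure circle_lebesgue (circle_arc s (x i) \<inter> circle_arc s (x j)))
      \<le> (\<Sum>i<n. \<Sum>j<n. max 0 (s - dist (x i) (x j)))"
    by (intro sum_mono measure_arc_Int_le s)
  ultimately show ?thesis by simp
qed

section \<open>The interaction\<close>

context admissible_potential
begin

lemma V_deriv: "(V has_real_derivative deriv V z) (at z)"
  using V_differentiable[of z] by (simp add: DERIV_deriv_iff_real_differentiable)

lemma V_continuous: "continuous_on A V"
  by (meson V_deriv DERIV_isCont continuous_at_imp_continuous_on)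

lemma V_measurable [measurable]: "V \<in> borel_measurable borel"
  by (rule borel_measurable_continuous_onI[OF V_continuous])

lemma deriv_V_measurable [measurable]: "deriv V \<in> borel_measurable borel"
  by (rule borel_measurable_continuous_onI[OF V_C1])

lemma V_abs: "V \<bar>z\<bar> = V z"
  by (simp add: V_even abs_if)

lemma deriv_V_nonpos: "z > 0 \<Longrightarrow> deriv V z \<le> 0"
  using Psi_nonneg[of z] by (simp add: Psi_def mult_le_0_iff)

lemma V_antimono: "0 \<le> a \<Longrightarrow> a \<le> b \<Longrightarrow> V b \<le> V a"
  by (cases "a = b")
     (auto intro!: DERIV_nonpos_imp_decreasing_open[of a b V] V_deriv V_continuous deriv_V_nonpos)

lemma V_le_V0: "V z \<le> V 0"
  using V_antimono[of 0 "\<bar>z\<bar>"] by (simp add: V_abs)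

section \<open>The exponents, and comparison of \<open>V\<close> with a pure power\<close>

text \<open>The substitution \<open>r = (u / z) powr (1 / (1 + \<alpha>))\<close> removes
  \<open>z\<close> from the argument of \<open>Psi V\<close>. The left side then no longer depends
  on \<open>z\<close>, and comparing two values of \<open>z\<close> determines the exponent.\<close>

lemma Psi_scaling_at:
  assumes "0 < z" "z \<le> 1/2"
  shows "((\<lambda>u. Psi V u * u powr (1 / (1 + \<alpha>))) \<longlongrightarrow> \<beta> * z powr (1 / (1 + \<alpha>) - \<beta>)) at_top"
proof -
  define p where "p = 1 / (1 + \<alpha>)"
  have p: "p > 0" and pa: "p * (1 + \<alpha>) = 1" using alpha_pos by (simp_all add: p_def)
  have lim: "((\<lambda>r. r * Psi V (r powr (1 + \<alpha>) * z)) \<longlongrightarrow> \<beta> * \<bar>z\<bar> powr (- \<beta>)) at_top"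
    using Psi_scaling[of "{z}"] assms by (simp add: tendsto_uniform_limitI)
  have top: "filterlim (\<lambda>u. (u / z) powr p) at_top at_top"
    using p assms by real_asymp
  have "((\<lambda>u. (u / z) powr p * Psi V (((u / z) powr p) powr (1 + \<alpha>) * z)) \<longlongrightarrow> \<beta> * \<bar>z\<bar> powr (- \<beta>)) at_top"
    using filterlim_compose[OF lim top] .
  hence "((\<lambda>u. z powr p * ((u / z) powr p * Psi V (((u / z) powr p) powr (1 + \<alpha>) * z)))
      \<longlongrightarrow> z powr p * (\<beta> * \<bar>z\<bar> powr (- \<beta>))) at_top"
    by (rule tendsto_mult_left)
  also have "z powr p * (\<beta> * \<bar>z\<bar> powr (- \<beta>)) = \<beta> * z powr (p - \<beta>)"
    using assms by (simp add: powr_diff powr_minus field_simps)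
  finally have "((\<lambda>u. z powr p * ((u / z) powr p * Psi V (((u / z) powr p) powr (1 + \<alpha>) * z)))
      \<longlongrightarrow> \<beta> * z powr (p - \<beta>)) at_top" .
  moreover have "\<forall>\<^sub>F u in at_top. z powr p * ((u / z) powr p * Psi V (((u / z) powr p) powr (1 + \<alpha>) * z))
      = Psi V u * u powr p"
    using eventually_gt_at_top[of 0]
  proof eventually_elim
    case (elim u)
    thus ?case using assms by (simp add: powr_powr pa powr_divide)
  qed
  ultimately show ?thesis unfolding p_def by (subst (asm) tendsto_cong) auto
qed

lemma beta_eq: "\<beta> = 1 / (1 + \<alpha>)"
proof -
  define q where "q = 1 / (1 + \<alpha>) - \<beta>"
  have "\<beta> * (1/2) powr q = \<beta> * (1/4) powr q"
    using tendsto_unique[OF _ Psi_scaling_at[of "1/2"] Psi_scaling_at[of "1/4"]]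
    by (simp add: q_def)
  hence "(1/2) powr q = (1/4::real) powr q" using beta_pos by simp
  hence "q * ln (1/2) = q * ln (1/4::real)" by (simp add: powr_def)
  hence "q = 0" by simp
  thus ?thesis by (simp add: q_def)
qed

lemma beta_less_1: "\<beta> < 1"
  using alpha_pos by (simp add: beta_eq)

lemma beta_alpha: "\<beta> * (1 + \<alpha>) = 1"
  using alpha_pos by (simp add: beta_eq)

lemma Psi_asymp: "((\<lambda>u. Psi V u * u powr \<beta>) \<longlongrightarrow> \<beta>) at_top"
  using Psi_scaling_at[of "1/2"] by (simp add: beta_eq[symmetric])

text \<open>The derivative is \<open>(\<beta> * V z - Psi V z) * z powr (\<beta> - 1)\<close>, so
  \<open>Psi_le\<close> is exactly its nonnegativity.\<close>

lemma V_powr_mono: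
  assumes "0 < a" "a \<le> b"
  shows "V a * a powr \<beta> \<le> V b * b powr \<beta>"
proof (rule DERIV_nonneg_imp_nondecreasing[OF assms(2)])
  fix z assume z: "a \<le> z" "z \<le> b"
  hence "z > 0" using assms by simp
  have "((\<lambda>z. V z * z powr \<beta>) has_real_derivative
      V z * (\<beta> * z powr (\<beta> - 1)) + deriv V z * z powr \<beta>) (at z)"
    using \<open>z > 0\<close> by (auto intro!: derivative_eq_intros V_deriv)
  moreover have "V z * (\<beta> * z powr (\<beta> - 1)) + deriv V z * z powr \<beta> =
      (\<beta> * V z - Psi V z) * z powr (\<beta> - 1)"
    using \<open>z > 0\<close> by (simp add: Psi_def powr_diff field_simps)
  ultimately show "\<exists>y. ((\<lambda>z. V z * z powr \<beta>) has_real_derivative y) (at z) \<and> 0 \<le> y"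
    using Psi_le[of z] by (intro exI[of _ "(\<beta> * V z - Psi V z) * z powr (\<beta> - 1)"]) simp
qed

text \<open>Beyond some point \<open>V z - (1 + \<epsilon>) z\<^sup>-\<^sup>\<beta>\<close> is nondecreasing, hence at most its limit 0. Together
  with the assumed lower bound this makes \<open>V\<close> an exact power from 1 on.\<close>

lemma V_le_powr:
  assumes "0 < z"
  shows "V z \<le> z powr (- \<beta>)"
proof -
  have "V z * z powr \<beta> \<le> 1 + \<epsilon>" if "\<epsilon> > 0" for \<epsilon>
  proof -
    have "\<forall>\<^sub>F u in at_top. Psi V u * u powr \<beta> < (1 + \<epsilon>) * \<beta>"
      using order_tendstoD(2)[OF Psi_asymp] that beta_pos by simp
    then obtain Z where Z: "Psi V u * u powr \<beta> < (1 + \<epsilon>) * \<beta>" if "u \<ge> Z" for u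
      by (auto simp: eventually_at_top_linorder)
    \<comment> \<open>The point \<open>c\<close> lies beyond the threshold of the asymptotics and
      also beyond \<open>z\<close>, so the bound found at \<open>c\<close> is carried back to
      \<open>z\<close> by \<open>V_powr_mono\<close>.\<close>
    define c where "c = max Z (max 1 z)"
    define U where "U u = V u - (1 + \<epsilon>) * u powr (- \<beta>)" for u
    have mono: "U c \<le> U b" if "c \<le> b" for b
    proof (rule DERIV_nonneg_imp_nondecreasing[OF that])
      fix u assume "c \<le> u" "u \<le> b"
      hence u: "u > 0" "u \<ge> Z" by (auto simp: c_def)
      have "(U has_real_derivative deriv V u - (1 + \<epsilon>) * (- \<beta> * u powr (- \<beta> - 1))) (at u)"
        unfolding U_def using u by (auto intro!: derivative_eq_intros V_deriv)
      moreover have "deriv V u - (1 + \<epsilon>) * (- \<beta> * u powr (- \<beta> - 1)) =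
          ((1 + \<epsilon>) * \<beta> - Psi V u * u powr \<beta>) * u powr (- \<beta> - 1)"
        using u by (simp add: Psi_def powr_diff powr_minus field_simps)
      ultimately show "\<exists>y. (U has_real_derivative y) (at u) \<and> 0 \<le> y"
        using Z[OF u(2)] by (metis diff_ge_0_iff_ge less_imp_le mult_nonneg_nonneg powr_ge_zero)
    qed
    have "(U \<longlongrightarrow> 0 - (1 + \<epsilon>) * 0) at_top"
      unfolding U_def
      by (intro tendsto_intros V_at_top tendsto_neg_powr filterlim_ident) (use beta_pos in simp)
    moreover have "\<forall>\<^sub>F b in at_top. U c \<le> U b"
      using eventually_ge_at_top[of c] by eventually_elim (rule mono)
    ultimately have "U c \<le> 0" by (auto intro: tendsto_lowerbound)
    moreover have "c > 0" by (simp add: c_def)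
    ultimately have "V c * c powr \<beta> \<le> 1 + \<epsilon>"
      by (simp add: U_def powr_minus field_simps)
    moreover have "V z * z powr \<beta> \<le> V c * c powr \<beta>"
      by (rule V_powr_mono[OF assms]) (simp add: c_def)
    ultimately show ?thesis by linarith
  qed
  hence "V z * z powr \<beta> \<le> 1" by (rule field_le_epsilon)
  thus ?thesis using assms by (simp add: powr_minus field_simps)
qed

text \<open>Compactness handles the interval from -1 to 1; outside it the absolute derivative is at
  most \<open>Psi V z\<close>, hence at most \<open>\<beta> * V 0\<close>.\<close>

lemma deriv_V_bounded:
  obtains C where "C > 0" "\<And>z. \<bar>deriv V z\<bar> \<le> C"
proof -
  have "compact ((deriv V) ` {-1..1})"
    by (intro compact_continuous_image continuous_on_subset[OF V_C1]) auto
  then obtain C where C: "\<And>z. z \<in> {-1..1} \<Longrightarrow> \<bar>deriv V z\<bar> \<le> C"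
    by (force dest!: compact_imp_bounded simp: bounded_iff)
  have "\<bar>deriv V z\<bar> \<le> \<beta> * V 0" if "z \<notin> {-1..1}" for z
  proof -
    have "\<bar>z\<bar> > 1" using that by auto
    have "1 * \<bar>deriv V z\<bar> \<le> \<bar>z\<bar> * \<bar>deriv V z\<bar>"
      by (rule mult_right_mono) (use \<open>\<bar>z\<bar> > 1\<close> in auto)
    also have "\<dots> = Psi V z" using Psi_nonneg[of z]
      by (simp add: Psi_def abs_mult[symmetric])
    also have "\<dots> \<le> \<beta> * V 0"
      using Psi_le[of z] V_le_V0[of z] beta_pos by (meson mult_left_mono less_imp_le order_trans)
    finally show ?thesis by simp
  qed
  hence "\<bar>deriv V z\<bar> \<le> max 1 (max C (\<beta> * V 0))" for z
    using C[of z] by (cases "z \<in> {-1..1}") (auto simp: le_max_iff_disj)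
  thus ?thesis by (intro that[of "max 1 (max C (\<beta> * V 0))"]) auto
qed

text \<open>This is where \<open>\<beta> (1 + \<alpha>) = 1\<close> makes the interaction a mean-field one.\<close>

lemma scaled_V_le:
  assumes "n \<ge> 1" "z \<noteq> 0"
  shows "real n * V (real n powr (1 + \<alpha>) * z) \<le> \<bar>z\<bar> powr (- \<beta>)"
proof -
  have n: "real n > 0" using assms by simp
  have "V (real n powr (1 + \<alpha>) * z) = V (real n powr (1 + \<alpha>) * \<bar>z\<bar>)"
    by (metis V_abs abs_mult abs_of_nonneg powr_ge_zero)
  also have "\<dots> \<le> (real n powr (1 + \<alpha>) * \<bar>z\<bar>) powr (- \<beta>)"
    using n assms by (intro V_le_powr) simp
  also have "\<dots> = real n powr (- (\<beta> * (1 + \<alpha>))) * \<bar>z\<bar> powr (- \<beta>)"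
    using n by (simp add: powr_mult powr_powr algebra_simps)
  also have "\<dots> = \<bar>z\<bar> powr (- \<beta>) / real n"
    using n unfolding beta_alpha by (simp add: powr_minus field_simps)
  finally show ?thesis using n by (simp add: field_simps)
qed

text \<open>Two regimes: from microscopic distance 1 on the powers of n cancel as in
  \<open>scaled_V_le\<close>; below it \<open>V\<close> is at least \<open>V 1\<close>, which is at
  least 1, so the scaled interaction is at least n. A minorant must therefore lie below both the
  singular power and n, which is why it has to be bounded.\<close>

lemma scaled_V_ge:
  assumes "n \<ge> 1" "g \<le> real n" "z \<noteq> 0 \<Longrightarrow> g \<le> \<bar>z\<bar> powr (- \<beta>)"
  shows "g \<le> real n * V (real n powr (1 + \<alpha>) * z)"
proof -
  define w where "w = real n powr (1 + \<alpha>) * \<bar>z\<bar>"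
  have n: "real n > 0" using assms by simp
  have w: "V (real n powr (1 + \<alpha>) * z) = V w"
    unfolding w_def by (metis V_abs abs_mult abs_of_nonneg powr_ge_zero)
  show ?thesis
  proof (cases "w \<ge> 1")
    case True
    hence z: "z \<noteq> 0" by (auto simp: w_def)
    have "real n * w powr (- \<beta>) = real n * (real n powr (- (\<beta> * (1 + \<alpha>))) * \<bar>z\<bar> powr (- \<beta>))"
      using n z by (simp add: w_def powr_mult powr_powr algebra_simps)
    also have "\<dots> = \<bar>z\<bar> powr (- \<beta>)"
      using n unfolding beta_alpha by (simp add: powr_minus field_simps)
    finally have "g \<le> real n * w powr (- \<beta>)" using assms(3)[OF z] by simp
    also have "\<dots> \<le> real n * V w" using V_ge[OF True] n by (intro mult_left_mono) auto
    finally show ?thesis unfolding w .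
  next
    case False
    hence "V 1 \<le> V w" by (intro V_antimono) (auto simp: w_def)
    hence "1 \<le> V w" using V_ge[of 1] by simp
    hence "real n * 1 \<le> real n * V w" using n by (intro mult_left_mono) auto
    thus ?thesis using assms(2) unfolding w by simp
  qed
qed

end

text \<open>A bounded minorant of \<open>z\<^sup>-\<^sup>\<beta>\<close>: its second-order Taylor formula at 1/2, with the singular
  part of the remainder (\<open>s < \<delta>\<close>) cut off. It is a mixture of triangular kernels.\<close>

definition tent_weight :: "real \<Rightarrow> real \<Rightarrow> real" where
  "tent_weight \<beta> s = \<beta> * (\<beta> + 1) * s powr (- \<beta> - 2)"

definition power_tent :: "real \<Rightarrow> real \<Rightarrow> real \<Rightarrow> real" where
  "power_tent \<beta> \<delta> z = (1/2) powr (- \<beta>) + \<beta> * (1/2) powr (- \<beta> - 1) * (1/2 - z)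
     + integral {\<delta>..1/2} (\<lambda>s. tent_weight \<beta> s * max 0 (s - z))"

text \<open>The mean of \<open>dist powr (- \<beta>)\<close> under arc length, as
  \<open>nn_integral_power_circle\<close> shows.\<close>

definition power_mean :: "real \<Rightarrow> real" where
  "power_mean \<beta> = 2 * (1/2) powr (1 - \<beta>) / (1 - \<beta>)"

section \<open>The truncated kernel and its double sums\<close>

context
  fixes \<beta> :: real
  assumes \<beta>: "0 < \<beta>" "\<beta> < 1"
begin

lemma tent_weight_nonneg: "0 \<le> tent_weight \<beta> s"
  using \<beta> by (simp add: tent_weight_def)

lemma tent_integrable:
  assumes "0 < a" "continuous_on {a..1/2} f"
  shows "(\<lambda>s. tent_weight \<beta> s * f s) integrable_on {a..1/2::real}"
  unfolding tent_weight_def using assms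
  by (intro integrable_continuous_interval continuous_intros) auto

text \<open>Integrating from \<open>z\<close> instead of \<delta> would give the exact Taylor
  remainder. The integrand is nonnegative and vanishes for \<open>s \<le> z\<close>, so the cutoff
  can only lower the value.\<close>

lemma power_tent_le_powr:
  assumes z: "0 < z" "z \<le> 1/2" and \<delta>: "0 < \<delta>" "\<delta> \<le> 1/2"
  shows "power_tent \<beta> \<delta> z \<le> z powr (- \<beta>)"
proof -
  define f where "f s = tent_weight \<beta> s * max 0 (s - z)" for s
  have int: "f integrable_on {a..1/2}" if "0 < a" for a
    unfolding f_def by (rule tent_integrable[OF that]) (intro continuous_intros)
  have "integral {\<delta>..1/2} f \<le> integral {z..1/2} f"
  proof (cases "z \<le> \<delta>")
    case True
    thus ?thesis using int z \<delta>
      by (intro integral_subset_le) (auto simp: f_def tent_weight_nonneg)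
  next
    case False
    have "integral {\<delta>..z} f + integral {z..1/2} f = integral {\<delta>..1/2} f"
      using False z \<delta> by (intro Henstock_Kurzweil_Integration.integral_combine int) auto
    moreover have "integral {\<delta>..z} f = integral {\<delta>..z} (\<lambda>_. 0)"
      by (rule Henstock_Kurzweil_Integration.integral_cong) (auto simp: f_def)
    ultimately show ?thesis by simp
  qed
  also have "integral {z..1/2} f = integral {z..1/2} (\<lambda>s. tent_weight \<beta> s * (s - z))"
    by (rule Henstock_Kurzweil_Integration.integral_cong) (auto simp: f_def)
  \<comment> \<open>The antiderivative comes from integration by parts: \<open>tent_weight\<close>
    is the second derivative of \<open>s powr (- \<beta>)\<close>.\<close>
  also have "\<dots> = (- \<beta> * (1/2) powr (- \<beta> - 1) * (1/2 - z) - (1/2) powr (- \<beta>))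
      - (- \<beta> * z powr (- \<beta> - 1) * (z - z) - z powr (- \<beta>))"
  proof (intro integral_unique fundamental_theorem_of_calculus z(2))
    fix s assume "s \<in> {z..1/2}"
    hence s: "s > 0" using z by simp
    have "((\<lambda>s. - \<beta> * s powr (- \<beta> - 1) * (s - z) - s powr (- \<beta>)) has_real_derivative
        - \<beta> * ((- \<beta> - 1) * s powr (- \<beta> - 1 - 1)) * (s - z) + - \<beta> * s powr (- \<beta> - 1)
          - (- \<beta>) * s powr (- \<beta> - 1)) (at s within {z..1/2})"
      using s by (auto intro!: derivative_eq_intros)
    also have "- \<beta> * ((- \<beta> - 1) * s powr (- \<beta> - 1 - 1)) * (s - z) + - \<beta> * s powr (- \<beta> - 1)
          - (- \<beta>) * s powr (- \<beta> - 1) = tent_weight \<beta> s * (s - z)"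
      by (simp add: tent_weight_def algebra_simps)
    finally show "((\<lambda>s. - \<beta> * s powr (- \<beta> - 1) * (s - z) - s powr (- \<beta>)) has_vector_derivative
        tent_weight \<beta> s * (s - z)) (at s within {z..1/2})"
      by (simp add: has_real_derivative_iff_has_vector_derivative)
  qed
  finally show ?thesis by (simp add: power_tent_def f_def[abs_def])
qed

text \<open>This is what the cutoff buys: a bound depending on \<beta> and \<delta> only, which
  serves for coinciding particles and for the diagonal of the double sums.\<close>

lemma power_tent_le_0:
  assumes "0 \<le> z" "0 < \<delta>"
  shows "power_tent \<beta> \<delta> z \<le> power_tent \<beta> \<delta> 0"
  unfolding power_tent_def using assms \<beta>
  by (intro add_mono mult_left_mono integral_le tent_integrable continuous_intros tent_weight_nonneg)
     (auto intro!: mult_left_mono tent_weight_nonneg)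

lemma tent_weight_integral_square:
  assumes "0 < \<delta>" "\<delta> \<le> 1/2"
  shows "integral {\<delta>..1/2} (\<lambda>s. tent_weight \<beta> s * s\<^sup>2) =
    \<beta> * (\<beta> + 1) / (1 - \<beta>) * ((1/2) powr (1 - \<beta>) - \<delta> powr (1 - \<beta>))"
proof -
  have "integral {\<delta>..1/2} (\<lambda>s. tent_weight \<beta> s * s\<^sup>2) =
    \<beta> * (\<beta> + 1) / (1 - \<beta>) * (1/2) powr (1 - \<beta>) - \<beta> * (\<beta> + 1) / (1 - \<beta>) * \<delta> powr (1 - \<beta>)"
  proof (intro integral_unique fundamental_theorem_of_calculus assms(2))
    fix s assume "s \<in> {\<delta>..1/2}"
    hence s: "s > 0" using assms by simp
    have "((\<lambda>s. \<beta> * (\<beta> + 1) / (1 - \<beta>) * s powr (1 - \<beta>)) has_real_derivative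
        \<beta> * (\<beta> + 1) / (1 - \<beta>) * ((1 - \<beta>) * s powr (1 - \<beta> - 1))) (at s within {\<delta>..1/2})"
      using s by (auto intro!: derivative_eq_intros)
    also have "\<beta> * (\<beta> + 1) / (1 - \<beta>) * ((1 - \<beta>) * s powr (1 - \<beta> - 1)) = tent_weight \<beta> s * s\<^sup>2"
      using s \<beta> by (simp add: tent_weight_def powr_diff powr_minus field_simps power2_eq_square)
    finally show "((\<lambda>s. \<beta> * (\<beta> + 1) / (1 - \<beta>) * s powr (1 - \<beta>)) has_vector_derivative
        tent_weight \<beta> s * s\<^sup>2) (at s within {\<delta>..1/2})"
      by (simp add: has_real_derivative_iff_has_vector_derivative)
  qed
  thus ?thesis by (simp add: algebra_simps)
qed

text \<open>No distance exceeds 1/2, so the linear term is a triangular kernel as well, and the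
  minorant is a constant plus triangular kernels with nonnegative weights.
  \<open>sum_triangle_ge\<close> replaces each kernel by its mean \<open>s\<^sup>2\<close>, so the
  bound is \<open>n\<^sup>2\<close> times the mean of the minorant. It falls short of
  \<open>power_mean\<close> by the part of the mixture below \<delta>.\<close>

lemma sum_power_tent_ge:
  fixes x :: "nat \<Rightarrow> circle"
  assumes \<delta>: "0 < \<delta>" "\<delta> \<le> 1/2"
  shows "(real n)\<^sup>2 * (power_mean \<beta> - \<beta> * (\<beta> + 1) / (1 - \<beta>) * \<delta> powr (1 - \<beta>))
    \<le> (\<Sum>i<n. \<Sum>j<n. power_tent \<beta> \<delta> (dist (x i) (x j)))"
proof -
  let ?w = "tent_weight \<beta>"
  have int: "(\<lambda>s. ?w s * max 0 (s - z)) integrable_on {\<delta>..1/2}" for z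
    by (rule tent_integrable[OF \<delta>(1)]) (intro continuous_intros)
  have "(\<Sum>i<n. \<Sum>j<n. power_tent \<beta> \<delta> (dist (x i) (x j))) =
      (real n)\<^sup>2 * (1/2) powr (- \<beta>)
      + \<beta> * (1/2) powr (- \<beta> - 1) * (\<Sum>i<n. \<Sum>j<n. 1/2 - dist (x i) (x j))
      + (\<Sum>i<n. \<Sum>j<n. integral {\<delta>..1/2} (\<lambda>s. ?w s * max 0 (s - dist (x i) (x j))))"
    by (simp add: power_tent_def sum.distrib sum_distrib_left power2_eq_square)
  also have "(\<Sum>i<n. \<Sum>j<n. 1/2 - dist (x i) (x j)) = (\<Sum>i<n. \<Sum>j<n. max 0 (1/2 - dist (x i) (x j)))"
    using dist_circle_le_half by (intro sum.cong refl) (simp add: max_def)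
  also have "(\<Sum>i<n. \<Sum>j<n. integral {\<delta>..1/2} (\<lambda>s. ?w s * max 0 (s - dist (x i) (x j)))) =
      integral {\<delta>..1/2} (\<lambda>s. \<Sum>i<n. \<Sum>j<n. ?w s * max 0 (s - dist (x i) (x j)))"
    by (simp add: Henstock_Kurzweil_Integration.integral_sum integrable_sum int)
  also have "\<dots> = integral {\<delta>..1/2} (\<lambda>s. ?w s * (\<Sum>i<n. \<Sum>j<n. max 0 (s - dist (x i) (x j))))"
    by (simp add: sum_distrib_left)
  finally have eq: "(\<Sum>i<n. \<Sum>j<n. power_tent \<beta> \<delta> (dist (x i) (x j))) =
      (real n)\<^sup>2 * (1/2) powr (- \<beta>)
      + \<beta> * (1/2) powr (- \<beta> - 1) * (\<Sum>i<n. \<Sum>j<n. max 0 (1/2 - dist (x i) (x j)))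
      + integral {\<delta>..1/2} (\<lambda>s. ?w s * (\<Sum>i<n. \<Sum>j<n. max 0 (s - dist (x i) (x j))))" .
  have "(real n)\<^sup>2 * integral {\<delta>..1/2} (\<lambda>s. ?w s * s\<^sup>2) =
      integral {\<delta>..1/2} (\<lambda>s. ?w s * (real n * s)\<^sup>2)"
    by (simp add: power_mult_distrib mult.left_commute flip: integral_mult_right)
  also have "\<dots> \<le> integral {\<delta>..1/2} (\<lambda>s. ?w s * (\<Sum>i<n. \<Sum>j<n. max 0 (s - dist (x i) (x j))))"
    using \<delta> by (intro integral_le tent_integrable continuous_intros mult_left_mono sum_triangle_ge
        tent_weight_nonneg) auto
  finally have 2: "(real n)\<^sup>2 * integral {\<delta>..1/2} (\<lambda>s. ?w s * s\<^sup>2) \<le> \<dots>" .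
  have 1: "\<beta> * (1/2) powr (- \<beta> - 1) * (real n * (1/2))\<^sup>2
      \<le> \<beta> * (1/2) powr (- \<beta> - 1) * (\<Sum>i<n. \<Sum>j<n. max 0 (1/2 - dist (x i) (x j)))"
    using \<beta> by (intro mult_left_mono sum_triangle_ge) auto
  have "(1/2::real) powr (- \<beta>) = 2 * (1/2) powr (1 - \<beta>)"
    "(1/2::real) powr (- \<beta> - 1) = 4 * (1/2) powr (1 - \<beta>)"
    by (simp_all add: powr_diff powr_minus field_simps)
  \<comment> \<open>The mean of the full kernel is the sum of the means of its constant, its linear
    term and the whole mixture down to 0.\<close>
  moreover have "2 * H / (1 - \<beta>) = 2 * H + \<beta> * H + \<beta> * (\<beta> + 1) / (1 - \<beta>) * H" for H
    using \<beta> by (simp add: divide_simps) (simp add: algebra_simps)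
  from this[of "(1/2) powr (1 - \<beta>)"]
  have "power_mean \<beta> - \<beta> * (\<beta> + 1) / (1 - \<beta>) * \<delta> powr (1 - \<beta>) =
      2 * (1/2) powr (1 - \<beta>) + \<beta> * (4 * (1/2) powr (1 - \<beta>)) / 4
      + integral {\<delta>..1/2} (\<lambda>s. ?w s * s\<^sup>2)"
    unfolding tent_weight_integral_square[OF \<delta>] power_mean_def by (simp add: right_diff_distrib)
  ultimately have "(real n)\<^sup>2 * (power_mean \<beta> - \<beta> * (\<beta> + 1) / (1 - \<beta>) * \<delta> powr (1 - \<beta>)) =
      (real n)\<^sup>2 * (1/2) powr (- \<beta>) + \<beta> * (1/2) powr (- \<beta> - 1) * (real n * (1/2))\<^sup>2
      + (real n)\<^sup>2 * integral {\<delta>..1/2} (\<lambda>s. ?w s * s\<^sup>2)"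
    by (simp add: algebra_simps power2_eq_square)
  also have "\<dots> \<le> (\<Sum>i<n. \<Sum>j<n. power_tent \<beta> \<delta> (dist (x i) (x j)))"
    unfolding eq using 1 2 by linarith
  finally show ?thesis .
qed

lemma nn_integral_power_circle:
  "(\<integral>\<^sup>+u\<in>{0..<1}. ennreal (\<bar>u - 1/2\<bar> powr (- \<beta>)) \<partial>lborel) = ennreal (power_mean \<beta>)"
proof -
  let ?c = "(1/2) powr (1 - \<beta>) / (1 - \<beta>)"
  have c: "?c \<ge> 0" using \<beta> by simp
  have I: "(\<integral>\<^sup>+v. ennreal (indicator {0..1/2} v * v powr (- \<beta>)) \<partial>lborel) = ennreal ?c"
    using has_integral_powr_from_0[of "- \<beta>" "1/2"] \<beta>
    by (intro nn_integral_has_integral_lebesgue) (auto simp: add.commute)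
  let ?f = "\<lambda>u. ennreal (indicator {0..1/2} (u - 1/2) * (u - 1/2) powr (- \<beta>))"
  let ?g = "\<lambda>u. ennreal (indicator {0..1/2} (1/2 - u) * (1/2 - u) powr (- \<beta>))"
  have "(\<integral>\<^sup>+u\<in>{0..<1}. ennreal (\<bar>u - 1/2\<bar> powr (- \<beta>)) \<partial>lborel) = (\<integral>\<^sup>+u. (?f u + ?g u) \<partial>lborel)"
  proof (rule nn_integral_cong_AE)
    show "AE u in lborel. ennreal (\<bar>u - 1/2\<bar> powr (- \<beta>)) * indicator {0..<1} u = ?f u + ?g u"
      \<comment> \<open>Only the endpoint 1 has to be discarded: it belongs to the closed half
        interval but not to \<open>{0..<1}\<close>. At the singularity both sides vanish, since
        \<open>0 powr (- \<beta>)\<close> is 0.\<close>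
      using AE_lborel_singleton[of 1]
      by eventually_elim (auto simp: indicator_def abs_if)
  qed
  also have "\<dots> = (\<integral>\<^sup>+u. ?f u \<partial>lborel) + (\<integral>\<^sup>+u. ?g u \<partial>lborel)"
    by (rule nn_integral_add) simp_all
  also have "(\<integral>\<^sup>+u. ?f u \<partial>lborel) = ennreal ?c"
    unfolding I[symmetric] by (subst nn_integral_real_affine[of _ 1 "1/2"]) simp_all
  also have "(\<integral>\<^sup>+u. ?g u \<partial>lborel) = ennreal ?c"
    unfolding I[symmetric] by (subst nn_integral_real_affine[of _ "-1" "1/2"]) simp_all
  also have "ennreal ?c + ennreal ?c = ennreal (power_mean \<beta>)"
    using c by (simp add: power_mean_def flip: ennreal_plus)
  finally show ?thesis .
qed

end

section \<open>The Gibbs measure\<close>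

abbreviation uniform_power :: "nat \<Rightarrow> (nat \<Rightarrow> circle) measure" where
  "uniform_power n \<equiv> (\<Pi>\<^sub>M i\<in>{..<n}. circle_lebesgue)"

lemma sets_uniform_power [measurable_cong]: "sets (uniform_power n) = sets (circle_power n)"
  by (rule sets_PiM_cong) simp_all

lemma space_uniform_power: "space (uniform_power n) = space (circle_power n)"
  by (rule sets_eq_imp_space_eq[OF sets_uniform_power])

lemma prob_space_uniform_power: "prob_space (uniform_power n)"
  by (rule prob_space_PiM) (rule prob_space_circle_lebesgue)

lemma circle_power_component [measurable]:
  "i < n \<Longrightarrow> (\<lambda>x. x i) \<in> circle_power n \<rightarrow>\<^sub>M borel"
  by measurable

text \<open>Coordinate \<open>i\<close> is integrated out first: whatever the others are, its
  difference to coordinate \<open>j\<close> is uniform.\<close>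

lemma nn_integral_uniform_power_diff:
  assumes [measurable]: "h \<in> borel_measurable borel" and ij: "i < n" "j < n" "i \<noteq> j"
  shows "(\<integral>\<^sup>+x. h (circle_diff (x i) (x j)) \<partial>uniform_power n) = (\<integral>\<^sup>+u\<in>{0..<1}. h (u - 1/2) \<partial>lborel)"
proof -
  interpret L: prob_space circle_lebesgue by (rule prob_space_circle_lebesgue)
  interpret product_sigma_finite "\<lambda>_::nat. circle_lebesgue" ..
  define I where "I = {..<n} - {i}"
  interpret I: prob_space "\<Pi>\<^sub>M i\<in>I. circle_lebesgue"
    by (rule prob_space_PiM) (rule prob_space_circle_lebesgue)
  have ins: "{..<n} = insert i I" and I: "finite I" "i \<notin> I" "j \<in> I"
    using ij by (auto simp: I_def)
  have "(\<integral>\<^sup>+x. h (circle_diff (x i) (x j)) \<partial>uniform_power n) =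
      (\<integral>\<^sup>+x. (\<integral>\<^sup>+y. h (circle_diff ((x(i := y)) i) ((x(i := y)) j)) \<partial>circle_lebesgue)
        \<partial>(\<Pi>\<^sub>M i\<in>I. circle_lebesgue))"
    unfolding ins using I
    by (intro product_nn_integral_insert)
       (auto intro!: measurable_compose[OF _ assms(1)] circle_diff_measurable measurable_component_singleton
         simp: measurable_cong_sets[OF refl sets_circle_lebesgue, symmetric])
  also have "\<dots> = (\<integral>\<^sup>+x. (\<integral>\<^sup>+u\<in>{0..<1}. h (u - 1/2) \<partial>lborel) \<partial>(\<Pi>\<^sub>M i\<in>I. circle_lebesgue))"
    using ij by (intro nn_integral_cong) (simp add: nn_integral_circle_diff)
  also have "\<dots> = (\<integral>\<^sup>+u\<in>{0..<1}. h (u - 1/2) \<partial>lborel)"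
    by (simp add: I.emeasure_space_1)
  finally show ?thesis .
qed

context admissible_potential
begin

lemma energy_measurable [measurable]: "energy V \<alpha> n \<in> borel_measurable (circle_power n)"
  unfolding energy_def by measurable

lemma energy_nonneg: "0 \<le> energy V \<alpha> n x"
  unfolding energy_def by (intro sum_nonneg V_nonneg)

section \<open>The energy of a configuration against its mean\<close>

text \<open>The diagonal adds the same constant to every energy, so it cancels when the lower bound
  is compared with the mean.\<close>

lemma energy_split:
  "energy V \<alpha> n x = real n * V 0
     + (\<Sum>i<n. \<Sum>j\<in>{..<n} - {i}. V (real n powr (1 + \<alpha>) * circle_diff (x i) (x j)))"
proof -
  have "(\<Sum>j<n. V (real n powr (1 + \<alpha>) * circle_diff (x i) (x j))) =
      V 0 + (\<Sum>j\<in>{..<n} - {i}. V (real n powr (1 + \<alpha>) * circle_diff (x i) (x j)))"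
    if "i < n" for i
    using that by (subst sum.remove[of _ i]) (simp_all add: circle_diff_eq_0[THEN iffD2])
  thus ?thesis by (simp add: energy_def sum.distrib)
qed

text \<open>Off the diagonal the scaled interaction is replaced by the minorant. Completing the
  double sum adds n diagonal values of the minorant; after division by n they cost
  \<open>power_tent \<beta> \<delta> 0\<close>, independently of n.\<close>

lemma energy_ge:
  assumes n: "n \<ge> 1" "power_tent \<beta> \<delta> 0 \<le> real n" and \<delta>: "0 < \<delta>" "\<delta> \<le> 1/2"
  shows "real n * (V 0 + power_mean \<beta> - \<beta> * (\<beta> + 1) / (1 - \<beta>) * \<delta> powr (1 - \<beta>)) - power_tent \<beta> \<delta> 0
    \<le> energy V \<alpha> n x"
proof -
  let ?J = "power_mean \<beta> - \<beta> * (\<beta> + 1) / (1 - \<beta>) * \<delta> powr (1 - \<beta>)"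
  let ?v = "\<lambda>i j. V (real n powr (1 + \<alpha>) * circle_diff (x i) (x j))"
  let ?g = "\<lambda>i j. power_tent \<beta> \<delta> (dist (x i) (x j))"
  have g: "?g i j \<le> real n * ?v i j" for i j
  proof (rule scaled_V_ge[OF n(1)])
    show "?g i j \<le> real n"
      using power_tent_le_0[OF beta_pos beta_less_1 zero_le_dist \<delta>(1)] n(2) by (rule order_trans)
    assume "circle_diff (x i) (x j) \<noteq> 0"
    hence "dist (x i) (x j) > 0" by (simp add: circle_diff_eq_0)
    thus "?g i j \<le> \<bar>circle_diff (x i) (x j)\<bar> powr (- \<beta>)"
      using power_tent_le_powr[OF beta_pos beta_less_1 _ dist_circle_le_half \<delta>]
      by (simp add: dist_circle_def)
  qed
  have "(real n)\<^sup>2 * ?J \<le> (\<Sum>i<n. \<Sum>j<n. ?g i j)"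
    by (rule sum_power_tent_ge[OF beta_pos beta_less_1 \<delta>])
  also have "\<dots> = (\<Sum>i<n. ?g i i + (\<Sum>j\<in>{..<n} - {i}. ?g i j))"
    by (intro sum.cong refl sum.remove) auto
  also have "\<dots> \<le> (\<Sum>i<n. power_tent \<beta> \<delta> 0 + (\<Sum>j\<in>{..<n} - {i}. real n * ?v i j))"
    using g by (intro sum_mono add_mono) auto
  also have "\<dots> = real n * power_tent \<beta> \<delta> 0 + real n * (energy V \<alpha> n x - real n * V 0)"
    unfolding energy_split by (simp add: sum.distrib sum_distrib_left)
  finally have "real n * (real n * ?J) \<le> real n * (power_tent \<beta> \<delta> 0 + (energy V \<alpha> n x - real n * V 0))"
    by (simp add: power2_eq_square algebra_simps)
  hence "real n * ?J \<le> power_tent \<beta> \<delta> 0 + (energy V \<alpha> n x - real n * V 0)"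
    using n by (subst (asm) mult_le_cancel_left_pos) auto
  thus ?thesis by (simp add: algebra_simps)
qed

text \<open>The difference of two distinct independent particles is uniform, so by
  \<open>scaled_V_le\<close> each ordered pair contributes at most
  \<open>power_mean \<beta> / n\<close>, and there are fewer than \<open>n\<^sup>2\<close> such
  pairs.\<close>

lemma expectation_energy_le:
  assumes n: "n \<ge> 1"
  shows "integrable (uniform_power n) (energy V \<alpha> n)"
    and "(\<integral>x. energy V \<alpha> n x \<partial>uniform_power n) \<le> real n * (V 0 + power_mean \<beta>)"
proof -
  interpret U: prob_space "uniform_power n" by (rule prob_space_uniform_power)
  let ?v = "\<lambda>i j x. V (real n powr (1 + \<alpha>) * circle_diff (x i) (x j))"
  have int: "integrable (uniform_power n) (?v i j)" if "i < n" "j < n" for i j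
    using that by (intro U.integrable_const_bound[of _ "V 0"]) (auto simp: V_nonneg V_le_V0)
  show "integrable (uniform_power n) (energy V \<alpha> n)"
    unfolding energy_def by (intro Bochner_Integration.integrable_sum int) auto
  have cn: "0 \<le> power_mean \<beta> / real n"
    using beta_less_1 by (simp add: power_mean_def)
  have pair: "(\<integral>x. ?v i j x \<partial>uniform_power n) \<le> power_mean \<beta> / real n"
    if ij: "i < n" "j < n" "i \<noteq> j" for i j
  proof -
    have "(\<integral>\<^sup>+x. ennreal (?v i j x) \<partial>uniform_power n) =
        (\<integral>\<^sup>+u\<in>{0..<1}. ennreal (V (real n powr (1 + \<alpha>) * (u - 1/2))) \<partial>lborel)"
      by (rule nn_integral_uniform_power_diff[OF _ ij]) measurable
    also have "\<dots> \<le> (\<integral>\<^sup>+u. ennreal (1 / real n) * (ennreal (\<bar>u - 1/2\<bar> powr (- \<beta>)) * indicator {0..<1} u) \<partial>lborel)"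
    proof (rule nn_integral_mono_AE)
      show "AE u in lborel. ennreal (V (real n powr (1 + \<alpha>) * (u - 1/2))) * indicator {0..<1} u
          \<le> ennreal (1 / real n) * (ennreal (\<bar>u - 1/2\<bar> powr (- \<beta>)) * indicator {0..<1} u)"
        \<comment> \<open>The singular point is a null set; \<open>scaled_V_le\<close> excludes
          it.\<close>
        using AE_lborel_singleton[of "1/2"]
      proof eventually_elim
        case (elim u)
        hence "V (real n powr (1 + \<alpha>) * (u - 1/2)) \<le> 1 / real n * \<bar>u - 1/2\<bar> powr (- \<beta>)"
          using scaled_V_le[OF n, of "u - 1/2"] n by (simp add: field_simps)
        thus ?case
          by (cases "u \<in> {0..<1}") (auto simp flip: ennreal_mult intro!: ennreal_leI)
      qed
    qed
    also have "\<dots> = ennreal (1 / real n) * ennreal (power_mean \<beta>)"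
      by (simp add: nn_integral_cmult nn_integral_power_circle[OF beta_pos beta_less_1])
    also have "\<dots> = ennreal (power_mean \<beta> / real n)"
      by (simp flip: ennreal_mult')
    finally show ?thesis
      using int[OF ij(1,2)] cn by (simp add: nn_integral_eq_integral V_nonneg)
  qed
  have int': "integrable (uniform_power n) (\<lambda>x. \<Sum>j\<in>{..<n} - {i}. ?v i j x)" if "i < n" for i
    using that by (intro Bochner_Integration.integrable_sum int) auto
  have "(\<integral>x. (\<Sum>i<n. \<Sum>j\<in>{..<n} - {i}. ?v i j x) \<partial>uniform_power n) =
      (\<Sum>i<n. \<integral>x. (\<Sum>j\<in>{..<n} - {i}. ?v i j x) \<partial>uniform_power n)"
    by (rule Bochner_Integration.integral_sum) (use int' in auto)
  also have "\<dots> = (\<Sum>i<n. \<Sum>j\<in>{..<n} - {i}. \<integral>x. ?v i j x \<partial>uniform_power n)"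
    by (intro sum.cong refl Bochner_Integration.integral_sum int) auto
  finally have sums: "(\<integral>x. (\<Sum>i<n. \<Sum>j\<in>{..<n} - {i}. ?v i j x) \<partial>uniform_power n) =
      (\<Sum>i<n. \<Sum>j\<in>{..<n} - {i}. \<integral>x. ?v i j x \<partial>uniform_power n)" .
  have "(\<integral>x. energy V \<alpha> n x \<partial>uniform_power n) =
      real n * V 0 + (\<Sum>i<n. \<Sum>j\<in>{..<n} - {i}. \<integral>x. ?v i j x \<partial>uniform_power n)"
    unfolding energy_split
    by (subst Bochner_Integration.integral_add)
       (use int in \<open>auto simp: U.prob_space sums intro!: Bochner_Integration.integrable_sum\<close>)
  also have "\<dots> \<le> real n * V 0 + (\<Sum>i<n. \<Sum>j\<in>{..<n} - {i}. power_mean \<beta> / real n)"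
    using pair by (intro add_left_mono sum_mono) auto
  also have "\<dots> \<le> real n * V 0 + (\<Sum>i<n. power_mean \<beta>)"
  proof (intro add_left_mono sum_mono)
    fix i
    have "(\<Sum>j\<in>{..<n} - {i}. power_mean \<beta> / real n) \<le> (\<Sum>j<n. power_mean \<beta> / real n)"
      using cn by (intro sum_mono2) auto
    thus "(\<Sum>j\<in>{..<n} - {i}. power_mean \<beta> / real n) \<le> power_mean \<beta>" using n by simp
  qed
  finally show "(\<integral>x. energy V \<alpha> n x \<partial>uniform_power n) \<le> real n * (V 0 + power_mean \<beta>)"
    by (simp add: algebra_simps)
qed

text \<open>Jensen's inequality, through the tangent line of the exponential.\<close>

lemma partition_fun_ge:
  assumes n: "n \<ge> 1"
  shows "exp (- real n * (V 0 + power_mean \<beta>)) \<le> partition_fun V \<alpha> n"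
proof -
  interpret U: prob_space "uniform_power n" by (rule prob_space_uniform_power)
  define a where "a = real n * (V 0 + power_mean \<beta>)"
  note E = expectation_energy_le[OF n]
  \<comment> \<open>The tangent is taken at the upper bound \<open>a\<close> of the mean energy, so
    the factor after \<open>exp (- a)\<close> is at least 1.\<close>
  have "exp (- a) * 1 \<le> exp (- a) * (1 + a - (\<integral>x. energy V \<alpha> n x \<partial>uniform_power n))"
    using E(2) by (intro mult_left_mono) (auto simp: a_def)
  also have "\<dots> = (\<integral>x. exp (- a) * (1 + a - energy V \<alpha> n x) \<partial>uniform_power n)"
    using E(1) by (simp add: U.prob_space)
  also have "\<dots> \<le> (\<integral>x. exp (- energy V \<alpha> n x) \<partial>uniform_power n)"
  proof (rule integral_mono)
    show "integrable (uniform_power n) (\<lambda>x. exp (- energy V \<alpha> n x))"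
      by (rule U.integrable_const_bound[of _ 1]) (auto simp: energy_nonneg)
    fix x
    have "exp (- a) * (1 + (a - energy V \<alpha> n x)) \<le> exp (- a) * exp (a - energy V \<alpha> n x)"
      by (intro mult_left_mono exp_ge_add_one_self) auto
    also have "\<dots> = exp (- energy V \<alpha> n x)" by (simp flip: exp_add)
    finally show "exp (- a) * (1 + a - energy V \<alpha> n x) \<le> exp (- energy V \<alpha> n x)"
      by (simp add: add_diff_eq)
  qed (use E(1) in simp)
  finally show ?thesis by (simp add: partition_fun_def a_def)
qed

section \<open>Normalisation and the bound on the density\<close>

lemma partition_fun_pos: "n \<ge> 1 \<Longrightarrow> 0 < partition_fun V \<alpha> n"
  by (rule less_le_trans[OF _ partition_fun_ge]) auto

lemma sets_gibbs [measurable_cong]: "sets (gibbs V \<alpha> n) = sets (circle_power n)"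
  by (simp add: gibbs_def sets_uniform_power)

lemma space_gibbs: "space (gibbs V \<alpha> n) = space (circle_power n)"
  by (rule sets_eq_imp_space_eq[OF sets_gibbs])

lemma prob_space_gibbs:
  assumes n: "n \<ge> 1"
  shows "prob_space (gibbs V \<alpha> n)"
proof
  interpret U: prob_space "uniform_power n" by (rule prob_space_uniform_power)
  have int: "integrable (uniform_power n) (\<lambda>x. exp (- energy V \<alpha> n x) / partition_fun V \<alpha> n)"
    by (intro integrable_divide_zero impI U.integrable_const_bound[of _ 1]) (auto simp: energy_nonneg)
  have "emeasure (gibbs V \<alpha> n) (space (gibbs V \<alpha> n)) =
      (\<integral>\<^sup>+x. ennreal (exp (- energy V \<alpha> n x) / partition_fun V \<alpha> n) \<partial>uniform_power n)"
    unfolding gibbs_def by (subst emeasure_density) (auto intro!: nn_integral_cong)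
  also have "\<dots> = ennreal (\<integral>x. exp (- energy V \<alpha> n x) / partition_fun V \<alpha> n \<partial>uniform_power n)"
    using partition_fun_pos[OF n] by (intro nn_integral_eq_integral int) auto
  also have "\<dots> = 1"
    using partition_fun_pos[OF n] by (simp add: partition_fun_def)
  finally show "emeasure (gibbs V \<alpha> n) (space (gibbs V \<alpha> n)) = 1" .
qed

text \<open>The uniform measure minimises the energy up to \<open>o(n)\<close>, so the Gibbs density is subexponential.\<close>

lemma measure_gibbs_le:
  assumes "\<epsilon> > 0"
  obtains C N where "C > 0" "\<And>n A. n \<ge> N \<Longrightarrow> A \<in> sets (circle_power n) \<Longrightarrow>
    measure (gibbs V \<alpha> n) A \<le> C * exp (\<epsilon> * real n) * measure (uniform_power n) A"
proof -
  \<comment> \<open>The loss per particle in \<open>energy_ge\<close> is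
    \<open>k * \<delta> powr (1 - \<beta>)\<close>. It tends to 0 with \<delta> because \<beta> is
    below 1, so \<delta> can be chosen to push it below \<epsilon>.\<close>
  define k where "k = \<beta> * (\<beta> + 1) / (1 - \<beta>)"
  have "((\<lambda>\<delta>::real. k * \<delta> powr (1 - \<beta>)) \<longlongrightarrow> 0) (at_right 0)"
    using beta_less_1 by real_asymp
  hence "\<forall>\<^sub>F \<delta> in at_right 0. k * \<delta> powr (1 - \<beta>) < \<epsilon>"
    using assms by (intro order_tendstoD) auto
  moreover have "\<forall>\<^sub>F \<delta> in at_right 0. \<delta> \<in> {0<..<1/2::real}"
    by (rule eventually_at_right_real) simp
  ultimately have "\<forall>\<^sub>F \<delta> in at_right (0::real). k * \<delta> powr (1 - \<beta>) < \<epsilon> \<and> \<delta> \<in> {0<..<1/2}"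
    by (rule eventually_conj)
  then obtain \<delta> where \<delta>: "k * \<delta> powr (1 - \<beta>) < \<epsilon>" "0 < \<delta>" "\<delta> \<le> 1/2"
    using eventually_happens'[OF trivial_limit_at_right_real] by fastforce
  define M where "M = power_tent \<beta> \<delta> 0"
  \<comment> \<open>From this index on the bounded minorant is at most n, as
    \<open>energy_ge\<close> demands. The remaining diagonal cost \<open>M\<close> becomes the
    constant \<open>exp M\<close>.\<close>
  define N where "N = max 1 (nat \<lceil>M\<rceil>)"
  show ?thesis
  proof (rule that[of "exp M" N])
    fix n A assume n: "n \<ge> N" and A: "A \<in> sets (circle_power n)"
    interpret U: prob_space "uniform_power n" by (rule prob_space_uniform_power)
    have n1: "n \<ge> 1" and nM: "M \<le> real n" using n by (auto simp: N_def)
    interpret G: prob_space "gibbs V \<alpha> n" by (rule prob_space_gibbs[OF n1])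
    let ?D = "exp M * exp (\<epsilon> * real n)"
    have D: "exp (- energy V \<alpha> n x) / partition_fun V \<alpha> n \<le> ?D" for x
    proof -
      have "real n * (V 0 + power_mean \<beta> - k * \<delta> powr (1 - \<beta>)) - M \<le> energy V \<alpha> n x"
        unfolding k_def M_def by (rule energy_ge[OF n1 _ \<delta>(2,3)]) (use nM in \<open>simp add: M_def\<close>)
      moreover have "real n * (k * \<delta> powr (1 - \<beta>)) \<le> real n * \<epsilon>"
        using \<delta>(1) by (intro mult_left_mono) auto
      ultimately have "- energy V \<alpha> n x \<le> M + \<epsilon> * real n + (- real n * (V 0 + power_mean \<beta>))"
        by (simp add: algebra_simps)
      hence "exp (- energy V \<alpha> n x) \<le> ?D * exp (- real n * (V 0 + power_mean \<beta>))"
        by (simp flip: exp_add)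
      also have "\<dots> \<le> ?D * partition_fun V \<alpha> n"
        by (intro mult_left_mono partition_fun_ge n1) auto
      finally show ?thesis using partition_fun_pos[OF n1] by (simp add: divide_le_eq)
    qed
    have "emeasure (gibbs V \<alpha> n) A =
        (\<integral>\<^sup>+x. ennreal (exp (- energy V \<alpha> n x) / partition_fun V \<alpha> n) * indicator A x \<partial>uniform_power n)"
      unfolding gibbs_def using A by (subst emeasure_density) (auto simp: sets_uniform_power)
    also have "\<dots> \<le> (\<integral>\<^sup>+x. ennreal ?D * indicator A x \<partial>uniform_power n)"
      using D by (intro nn_integral_mono mult_right_mono ennreal_leI) auto
    also have "\<dots> = ennreal ?D * emeasure (uniform_power n) A"
      using A by (subst nn_integral_cmult_indicator) (auto simp: sets_uniform_power)
    finally have "ennreal (measure (gibbs V \<alpha> n) A) \<le> ennreal (?D * measure (uniform_power n) A)"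
      by (simp add: G.emeasure_eq_measure U.emeasure_eq_measure ennreal_mult)
    thus "measure (gibbs V \<alpha> n) A \<le> ?D * measure (uniform_power n) A"
      by (subst (asm) ennreal_le_iff) auto
  qed simp
qed

end

section \<open>Empirical measures\<close>

definition cell :: "nat \<Rightarrow> nat \<Rightarrow> circle set" where
  "cell m k = {x. real k \<le> real m * rep_circle x \<and> real m * rep_circle x < real k + 1}"

text \<open>The tolerance is the square of the mesh: added up over \<open>m\<close> cells, the
  errors amount to 1/m, the bound on the diameter of a cell.\<close>

definition atypical :: "nat \<Rightarrow> nat \<Rightarrow> (nat \<Rightarrow> circle) set" where
  "atypical n m = {x \<in> space (circle_power n).
     \<exists>k<m. 1 / (real m)\<^sup>2 \<le> \<bar>measure (empirical n x) (cell m k) - 1 / real m\<bar>}"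

lemma cell_measurable [measurable]: "cell m k \<in> sets borel"
  unfolding cell_def by measurable

lemma measure_cell:
  assumes "k < m"
  shows "measure circle_lebesgue (cell m k) = 1 / real m"
proof -
  have m: "real m > 0" "real k + 1 \<le> real m" using assms by auto
  have "indicator (cell m k) (to_circle u) * indicator {0..<1} u =
      (indicator {real k / real m..<(real k + 1) / real m} u :: ennreal)" for u
  proof (cases "0 \<le> u \<and> u < 1")
    case True
    thus ?thesis using m by (simp add: cell_def indicator_def frac_eq field_simps)
  next
    case False
    moreover have "0 \<le> u \<and> u < 1" if "real k / real m \<le> u" "u < (real k + 1) / real m"
    proof
      show "0 \<le> u" by (rule order_trans[OF _ that(1)]) simp
      have "u < (real k + 1) / real m" by fact
      also have "\<dots> \<le> 1" using m by simp
      finally show "u < 1" .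
    qed
    ultimately show ?thesis by (auto simp: indicator_def)
  qed
  hence "(\<integral>\<^sup>+u\<in>{0..<1}. indicator (cell m k) (to_circle u) \<partial>lborel) =
      (\<integral>\<^sup>+u. indicator {real k / real m..<(real k + 1) / real m} u \<partial>lborel)" by simp
  also have "\<dots> = ennreal ((real k + 1) / real m - real k / real m)"
    using m by (subst nn_integral_indicator) (auto simp: divide_right_mono)
  also have "(real k + 1) / real m - real k / real m = 1 / real m" by (simp add: add_divide_distrib)
  finally have "emeasure circle_lebesgue (cell m k) = ennreal (1 / real m)"
    by (subst nn_integral_indicator[symmetric], simp, subst nn_integral_circle_lebesgue) simp_all
  thus ?thesis by (simp add: measure_def)
qed

lemma UN_cell: "x \<in> (\<Union>k<m. cell m k)" if "m > 0"
proof -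
  have x: "0 \<le> real m * rep_circle x" "real m * rep_circle x < real m"
    using that rep_circle_bounds[of x] by auto
  define k where "k = nat \<lfloor>real m * rep_circle x\<rfloor>"
  have "x \<in> cell m k" using x(1) unfolding cell_def k_def by simp
  moreover have "k < m" using x unfolding k_def by (simp add: nat_less_iff floor_less_iff)
  ultimately show ?thesis by blast
qed

lemma disjoint_cell: "disjoint_family (cell m)"
  by (auto simp: disjoint_family_on_def cell_def)

lemma dist_cell:
  assumes "x \<in> cell m k" "y \<in> cell m k" "m > 0"
  shows "dist x y < 1 / real m"
proof -
  have "\<bar>real m * rep_circle x - real m * rep_circle y\<bar> < 1"
    using assms by (auto simp: cell_def abs_if)
  hence "real m * \<bar>rep_circle x - rep_circle y\<bar> < 1"
    by (metis abs_mult abs_of_nat right_diff_distrib)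
  hence "\<bar>rep_circle x - rep_circle y\<bar> < 1 / real m" using assms(3) by (simp add: field_simps)
  with dist_circle_le_rep[of x y] show ?thesis by linarith
qed

section \<open>Prohorov distance from cell masses and from labelled particles\<close>

lemma prohorov_dist_le:
  assumes "\<mu> \<in> space (prob_algebra borel)" "\<nu> \<in> space (prob_algebra borel)" "0 < e"
    and "\<And>A. A \<in> sets borel \<Longrightarrow> measure \<mu> A \<le> measure \<nu> (\<Union>a\<in>A. ball a e) + e"
    and "\<And>A. A \<in> sets borel \<Longrightarrow> measure \<nu> A \<le> measure \<mu> (\<Union>a\<in>A. ball a e) + e"
  shows "prohorov_dist \<mu> \<nu> \<le> e"
  unfolding prohorov_dist_def using assms
  by (auto intro!: cInf_lower bdd_belowI[of _ 0])

text \<open>\<open>A\<close> is covered by the cells that it meets. Their diameter is below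
  \<open>e\<close>, so their union stays in the \<open>e\<close>-neighbourhood of \<open>A\<close>;
  at most \<open>m\<close> cells each lose \<open>1 / m\<^sup>2\<close>.\<close>

lemma prohorov_cells_aux:
  fixes \<mu> \<nu> :: "circle measure"
  assumes "prob_space \<mu>" "prob_space \<nu>" "sets \<mu> = sets borel" "sets \<nu> = sets borel"
    and m: "m > 0" "1 / real m < e"
    and close: "\<And>k. k < m \<Longrightarrow> measure \<mu> (cell m k) \<le> measure \<nu> (cell m k) + 1 / (real m)\<^sup>2"
  shows "measure \<mu> A \<le> measure \<nu> (\<Union>a\<in>A. ball a e) + e"
proof -
  interpret \<mu>: prob_space \<mu> by fact
  interpret \<nu>: prob_space \<nu> by fact
  define K where "K = {k. k < m \<and> cell m k \<inter> A \<noteq> {}}"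
  have K: "finite K" "card K \<le> m" "K \<subseteq> {..<m}"
    using card_mono[of "{..<m}" K] by (auto simp: K_def)
  have "measure \<mu> A \<le> measure \<mu> (\<Union>k\<in>K. cell m k)"
  proof (rule \<mu>.finite_measure_mono)
    show "A \<subseteq> (\<Union>k\<in>K. cell m k)" using UN_cell[OF m(1)] unfolding K_def by blast
  qed (use K assms(3) in auto)
  also have "\<dots> \<le> (\<Sum>k\<in>K. measure \<mu> (cell m k))"
    using K by (intro \<mu>.finite_measure_subadditive_finite) (auto simp: assms(3))
  also have "\<dots> \<le> (\<Sum>k\<in>K. measure \<nu> (cell m k) + 1 / (real m)\<^sup>2)"
    using K by (intro sum_mono close) auto
  also have "\<dots> = measure \<nu> (\<Union>k\<in>K. cell m k) + card K * (1 / (real m)\<^sup>2)"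
    using K disjoint_cell[of m] unfolding sum.distrib
    by (subst \<nu>.finite_measure_finite_Union)
       (auto simp: assms(4) disjoint_family_on_def)
  also have "\<dots> \<le> measure \<nu> (\<Union>a\<in>A. ball a e) + m * (1 / (real m)\<^sup>2)"
  proof (intro add_mono mult_right_mono \<nu>.finite_measure_mono)
    show "(\<Union>k\<in>K. cell m k) \<subseteq> (\<Union>a\<in>A. ball a e)"
    proof
      fix x assume "x \<in> (\<Union>k\<in>K. cell m k)"
      then obtain k a where "x \<in> cell m k" "a \<in> cell m k" "a \<in> A" by (auto simp: K_def)
      thus "x \<in> (\<Union>a\<in>A. ball a e)" using dist_cell[of a m k x] m by force
    qed
    show "(\<Union>a\<in>A. ball a e) \<in> sets \<nu>"
      unfolding assms(4) by (intro borel_open open_UN ballI open_ball)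
  qed (use K in auto)
  also have "m * (1 / (real m)\<^sup>2) \<le> e"
    using m by (simp add: power2_eq_square)
  finally show ?thesis by simp
qed

lemma prohorov_cells:
  assumes "\<mu> \<in> space (prob_algebra borel)" "\<nu> \<in> space (prob_algebra borel)"
    and "m > 0" "1 / real m < e"
    and "\<And>k. k < m \<Longrightarrow> \<bar>measure \<mu> (cell m k) - measure \<nu> (cell m k)\<bar> \<le> 1 / (real m)\<^sup>2"
  shows "prohorov_dist \<mu> \<nu> \<le> e"
proof (rule prohorov_dist_le[OF assms(1,2)])
  have "0 \<le> 1 / real m" by simp
  thus "0 < e" using assms(4) by linarith
  have c: "measure \<mu> (cell m k) \<le> measure \<nu> (cell m k) + 1 / (real m)\<^sup>2"
    "measure \<nu> (cell m k) \<le> measure \<mu> (cell m k) + 1 / (real m)\<^sup>2" if "k < m" for k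
    using assms(5)[OF that] by linarith+
  fix A :: "circle set"
  show "measure \<mu> A \<le> measure \<nu> (\<Union>a\<in>A. ball a e) + e"
    by (rule prohorov_cells_aux[where m = m]) (use assms c in \<open>auto simp: space_prob_algebra\<close>)
  show "measure \<nu> A \<le> measure \<mu> (\<Union>a\<in>A. ball a e) + e"
    by (rule prohorov_cells_aux[where m = m]) (use assms c in \<open>auto simp: space_prob_algebra\<close>)
qed

lemma circle_lebesgue_in_prob: "circle_lebesgue \<in> space (prob_algebra borel)"
  by (simp add: space_prob_algebra prob_space_circle_lebesgue)

lemma empirical_in_prob:
  assumes "n \<ge> 1"
  shows "empirical n x \<in> space (prob_algebra borel)"
proof -
  interpret prob_space "uniform_count_measure {..<n}"
    by (rule prob_space_uniform_count_measure)
       (use assms in \<open>auto simp: lessThan_empty_iff bot_nat_def\<close>)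
  have "x \<in> uniform_count_measure {..<n} \<rightarrow>\<^sub>M borel"
    by (auto simp: measurable_def sets_uniform_count_measure space_uniform_count_measure)
  thus ?thesis by (simp add: empirical_def space_prob_algebra prob_space_distr)
qed

text \<open>The common labels couple the two measures: a particle of one configuration in
  \<open>A\<close> has its partner in the \<open>e\<close>-neighbourhood of
  \<open>A\<close>.\<close>

lemma prohorov_empirical_le:
  assumes n: "n \<ge> 1" and d: "\<And>i. i < n \<Longrightarrow> dist (x i) (y i) < e"
  shows "prohorov_dist (empirical n x) (empirical n y) \<le> e"
proof -
  have e: "0 < e" using d[of 0] n zero_le_dist[of "x 0" "y 0"] by linarith
  have aux: "measure (empirical n x) A \<le> measure (empirical n y) (\<Union>a\<in>A. ball a e) + e"
    if A: "A \<in> sets borel" and d: "\<And>i. i < n \<Longrightarrow> dist (x i) (y i) < e" for x y A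
  proof -
    have "(\<Sum>i<n. indicator A (x i)) \<le> (\<Sum>i<n. indicator (\<Union>a\<in>A. ball a e) (y i) :: real)"
      using d by (intro sum_mono) (auto simp: indicator_def)
    moreover have "(\<Union>a\<in>A. ball a e) \<in> sets borel"
      by (intro borel_open open_UN ballI open_ball)
    ultimately have "measure (empirical n x) A \<le> measure (empirical n y) (\<Union>a\<in>A. ball a e)"
      using A by (simp add: measure_empirical divide_right_mono)
    thus ?thesis using e by linarith
  qed
  show ?thesis
    by (rule prohorov_dist_le[OF empirical_in_prob[OF n] empirical_in_prob[OF n] e])
       (auto intro!: aux d simp: dist_commute[of "y _" "x _"])
qed

section \<open>Exponential estimates for atypical configurations\<close>

lemma atypical_measurable [measurable]: "atypical n m \<in> sets (circle_power n)"
  unfolding atypical_def measure_empirical[OF cell_measurable] by measurable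

lemma prohorov_typical:
  assumes "n \<ge> 1" "x \<in> space (circle_power n)" "x \<notin> atypical n m" "m > 0" "1 / real m < e"
  shows "prohorov_dist (empirical n x) circle_lebesgue \<le> e"
  using assms(2,3) unfolding atypical_def
  by (intro prohorov_cells[OF empirical_in_prob[OF assms(1)] circle_lebesgue_in_prob assms(4,5)])
     (auto simp: measure_cell not_le intro: less_imp_le)

lemma measure_uniform_atypical:
  assumes n: "n \<ge> 1" and m: "m \<ge> 1"
  shows "measure (uniform_power n) (atypical n m) \<le> 2 * real m * exp (- 2 * real n / real m ^ 4)"
proof -
  interpret U: prob_space "uniform_power n" by (rule prob_space_uniform_power)
  interpret L: prob_space circle_lebesgue by (rule prob_space_circle_lebesgue)
  define B where "B k = {x \<in> space (uniform_power n).
    real n / (real m)\<^sup>2 \<le> \<bar>(\<Sum>i<n. indicator (cell m k) (x i)) - real n * (1 / real m)\<bar>}" for k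
  have B: "U.prob (B k) \<le> 2 * exp (- 2 * real n / real m ^ 4)" if k: "k < m" for k
  proof -
    have comp: "distr (uniform_power n) borel (\<lambda>x. x i) = circle_lebesgue" if "i < n" for i
      using distr_PiM_component[of "{..<n}" "\<lambda>_. circle_lebesgue" i] that
      by (simp add: prob_space_circle_lebesgue cong: distr_cong)
    \<comment> \<open>Independence of the coordinates is read off from their joint law, which is the
      product of the marginals.\<close>
    have "distr (uniform_power n) (circle_power n) (\<lambda>x. \<lambda>i\<in>{..<n}. x i) = uniform_power n"
    proof -
      have "distr (uniform_power n) (circle_power n) (\<lambda>x. \<lambda>i\<in>{..<n}. x i) =
          distr (uniform_power n) (uniform_power n) (\<lambda>x. x)"
        by (rule distr_cong) (auto simp: sets_uniform_power space_PiM)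
      thus ?thesis by simp
    qed
    also have "\<dots> = (\<Pi>\<^sub>M i\<in>{..<n}. distr (uniform_power n) borel (\<lambda>x. x i))"
      by (rule PiM_cong) (simp_all add: comp)
    finally have "U.indep_vars (\<lambda>_. borel) (\<lambda>i x. x i) {..<n}"
      using n by (subst U.indep_vars_iff_distr_eq_PiM') (auto simp: lessThan_empty_iff bot_nat_def)
    hence ind: "U.indep_vars (\<lambda>_. borel) (\<lambda>i x. indicator (cell m k) (x i) :: real) {..<n}"
      by (rule U.indep_vars_compose2) measurable
    have ex: "U.expectation (\<lambda>x. indicator (cell m k) (x i) :: real) = 1 / real m" if "i < n" for i
    proof -
      have "U.expectation (\<lambda>x. indicator (cell m k) (x i) :: real) =
          (\<integral>y. indicator (cell m k) y \<partial>distr (uniform_power n) borel (\<lambda>x. x i))"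
        using that by (subst integral_distr) simp_all
      thus ?thesis using k that by (simp add: comp measure_cell)
    qed
    interpret H: Hoeffding_ineq "uniform_power n" "{..<n}" "\<lambda>i x. indicator (cell m k) (x i)"
      "\<lambda>_. 0" "\<lambda>_. 1" "real n * (1 / real m)"
    proof unfold_locales
      show "U.indep_vars (\<lambda>_. borel) (\<lambda>i x. indicator (cell m k) (x i) :: real) {..<n}" by (rule ind)
    qed (simp_all add: ex)
    \<comment> \<open>Hoeffding's inequality for n summands of range 1 with deviation
      \<open>n / m\<^sup>2\<close>; the exponent is twice the squared deviation divided by
      n.\<close>
    have "U.prob (B k) \<le> 2 * exp (- 2 * (real n / (real m)\<^sup>2)\<^sup>2 / real n)"
      using H.Hoeffding_ineq_abs_ge[of "real n / (real m)\<^sup>2"] n by (simp add: B_def)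
    also have "- 2 * (real n / (real m)\<^sup>2)\<^sup>2 / real n = - 2 * real n / real m ^ 4"
      using n m by (simp add: power_divide field_simps power2_eq_square eval_nat_numeral)
    finally show ?thesis .
  qed
  have "atypical n m \<subseteq> (\<Union>k<m. B k)"
  proof
    fix x assume "x \<in> atypical n m"
    then obtain k where k: "k < m" "x \<in> space (uniform_power n)"
      "1 / (real m)\<^sup>2 \<le> \<bar>(\<Sum>i<n. indicator (cell m k) (x i)) / real n - 1 / real m\<bar>"
      by (auto simp: atypical_def measure_empirical space_uniform_power)
    have "real n * (1 / (real m)\<^sup>2) \<le> real n * \<bar>(\<Sum>i<n. indicator (cell m k) (x i)) / real n - 1 / real m\<bar>"
      using k(3) by (rule mult_left_mono) simp
    also have "\<dots> = \<bar>real n * ((\<Sum>i<n. indicator (cell m k) (x i)) / real n - 1 / real m)\<bar>"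
      by (simp add: abs_mult)
    also have "real n * ((\<Sum>i<n. indicator (cell m k) (x i)) / real n - 1 / real m) =
        (\<Sum>i<n. indicator (cell m k) (x i)) - real n * (1 / real m)"
      using n by (simp add: right_diff_distrib)
    finally show "x \<in> (\<Union>k<m. B k)" using k(1,2) by (auto simp: B_def)
  qed
  hence "U.prob (atypical n m) \<le> U.prob (\<Union>k<m. B k)"
    by (rule U.finite_measure_mono) (auto simp: B_def)
  also have "\<dots> \<le> (\<Sum>k<m. U.prob (B k))"
    by (rule U.finite_measure_subadditive_finite) (auto simp: B_def)
  also have "\<dots> \<le> (\<Sum>k<m. 2 * exp (- 2 * real n / real m ^ 4))"
    by (intro sum_mono B) auto
  finally show ?thesis by simp
qed

lemma (in admissible_potential) measure_gibbs_atypical: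
  assumes m: "m \<ge> 1"
  obtains C \<kappa> N where "C > 0" "\<kappa> > 0"
    "\<And>n. n \<ge> N \<Longrightarrow> measure (gibbs V \<alpha> n) (atypical n m) \<le> C * exp (- \<kappa> * real n)"
proof -
  \<comment> \<open>Half the Hoeffding rate is given to the density factor, the other half survives
    as decay.\<close>
  define \<kappa> where "\<kappa> = 1 / real m ^ 4"
  have \<kappa>: "\<kappa> > 0" using m by (simp add: \<kappa>_def)
  obtain C N where C: "C > 0" "\<And>n A. n \<ge> N \<Longrightarrow> A \<in> sets (circle_power n) \<Longrightarrow>
    measure (gibbs V \<alpha> n) A \<le> C * exp (\<kappa> * real n) * measure (uniform_power n) A"
    using measure_gibbs_le[OF \<kappa>] by metis
  show ?thesis
  proof (rule that[of "C * (2 * real m)" \<kappa> "max 1 N"])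
    fix n assume n: "n \<ge> max 1 N"
    have "measure (gibbs V \<alpha> n) (atypical n m)
        \<le> C * exp (\<kappa> * real n) * measure (uniform_power n) (atypical n m)"
      using n by (intro C) auto
    also have "\<dots> \<le> C * exp (\<kappa> * real n) * (2 * real m * exp (- 2 * real n / real m ^ 4))"
      using n m C(1) by (intro mult_left_mono measure_uniform_atypical) auto
    also have "\<dots> = C * (2 * real m) * (exp (\<kappa> * real n) * exp (- 2 * \<kappa> * real n))"
      by (simp add: \<kappa>_def)
    also have "exp (\<kappa> * real n) * exp (- 2 * \<kappa> * real n) = exp (- \<kappa> * real n)"
      by (simp flip: exp_add)
    finally show "measure (gibbs V \<alpha> n) (atypical n m) \<le> C * (2 * real m) * exp (- \<kappa> * real n)" .
  qed (use m C(1) \<kappa> in auto)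
qed

section \<open>Measurability and weak convergence\<close>

lemma space_borel_of [simp]: "space (borel_of T) = topspace T"
  unfolding borel_of_def by (rule space_measure_of) (auto dest: openin_subset)

lemma openin_borel_of: "openin T U \<Longrightarrow> U \<in> sets (borel_of T)"
  unfolding borel_of_def by (subst sets_measure_of) (auto dest: openin_subset)

lemma continuous_map_borel_of:
  assumes "continuous_map T euclideanreal f"
  shows "f \<in> borel_measurable (borel_of T)"
proof (rule borel_measurableI)
  fix S :: "real set" assume "open S"
  hence "openin T {x \<in> topspace T. f x \<in> S}"
    using assms by (simp add: openin_continuous_map_preimage)
  thus "f -` S \<inter> space (borel_of T) \<in> sets (borel_of T)"
    by (auto dest!: openin_borel_of simp: vimage_def Int_def conj_commute)
qed

text \<open>The relations \<open>R m\<close> play the role of the entourages of a uniformity. The topology may be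
  neither metrizable nor second countable, so pointwise limits of measurable maps are handled by making
  the approximations measurable for the discrete sigma-algebra.\<close>

lemma measurable_borel_of_approx:
  fixes R :: "nat \<Rightarrow> 'p \<Rightarrow> 'p \<Rightarrow> bool"
  assumes X: "\<And>w. w \<in> space M \<Longrightarrow> X w \<in> topspace T"
    and X': "\<And>k. X' k \<in> M \<rightarrow>\<^sub>M count_space UNIV"
    and S: "\<And>k w. X' k w \<in> S"
    and nbhd: "\<And>U p. openin T U \<Longrightarrow> p \<in> U \<Longrightarrow> \<exists>m. \<forall>q\<in>topspace T. R m p q \<longrightarrow> q \<in> U"
    and tri: "\<And>m p q r. p \<in> topspace T \<Longrightarrow> q \<in> S \<Longrightarrow> r \<in> topspace T \<Longrightarrow>
        R (h m) p q \<Longrightarrow> R (h m) q r \<Longrightarrow> R m p r"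
    and conv: "\<And>m w. w \<in> space M \<Longrightarrow>
        \<forall>\<^sub>F k in sequentially. R m (X w) (X' k w) \<and> R m (X' k w) (X w)"
  shows "X \<in> M \<rightarrow>\<^sub>M borel_of T"
  unfolding borel_of_def
proof (rule measurable_measure_of)
  show "{U. openin T U} \<subseteq> Pow (topspace T)" by (auto dest: openin_subset)
  show "X \<in> space M \<rightarrow> topspace T" using X by auto
  fix U assume "U \<in> {U. openin T U}"
  hence U: "openin T U" by simp
  \<comment> \<open>\<open>A m\<close> is the interior of \<open>U\<close> at scale
    \<open>R m\<close>. Being in \<open>U\<close> means that the approximations eventually lie in
    one \<open>A m\<close>, a countable combination of events; no regularity of \<open>A m\<close>
    enters, since the approximations are measurable for the discrete sigma-algebra.\<close>
  define A where "A m = {p. \<forall>q\<in>topspace T. R m p q \<longrightarrow> q \<in> U}" for m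
  have "X w \<in> U \<longleftrightarrow> (\<exists>m. \<forall>\<^sub>F k in sequentially. X' k w \<in> A m)" if w: "w \<in> space M" for w
  proof
    assume XU: "X w \<in> U"
    then obtain m where m: "\<forall>q\<in>topspace T. R m (X w) q \<longrightarrow> q \<in> U"
      using nbhd[OF U] by blast
    have "\<forall>\<^sub>F k in sequentially. X' k w \<in> A (h m)"
      using conv[OF w, of "h m"]
    proof eventually_elim
      case (elim k)
      thus ?case unfolding A_def using m tri[OF X[OF w] S] by blast
    qed
    thus "\<exists>m. \<forall>\<^sub>F k in sequentially. X' k w \<in> A m" by blast
  next
    assume "\<exists>m. \<forall>\<^sub>F k in sequentially. X' k w \<in> A m"
    then obtain m where "\<forall>\<^sub>F k in sequentially. X' k w \<in> A m" by blast
    hence "\<forall>\<^sub>F k in sequentially. X w \<in> U"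
      using conv[OF w, of m] by eventually_elim (use X[OF w] in \<open>auto simp: A_def\<close>)
    thus "X w \<in> U" by (simp add: eventually_False_sequentially)
  qed
  hence "X -` U \<inter> space M = {w \<in> space M. \<exists>m. \<exists>K. \<forall>k\<ge>K. X' k w \<in> A m}"
    by (auto simp: eventually_sequentially)
  also have "\<dots> \<in> sets M"
  proof -
    have [measurable]: "Measurable.pred M (\<lambda>w. X' k w \<in> A m)" for k m
      using X'[of k] by (rule measurable_compose) simp
    show ?thesis by measurable
  qed
  finally show "X -` U \<inter> space M \<in> sets M" .
qed

text \<open>Weak convergence to a point mass is concentration near the point: a test function
  deviates by at most \<open>e/2\<close> on a neighbourhood, and by at most twice its bound on the
  exceptional set.\<close>

lemma weak_conv_in_return:
  fixes Q :: "nat \<Rightarrow> 'a measure" and X :: "nat \<Rightarrow> 'a \<Rightarrow> 'p"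
  assumes q: "q \<in> topspace T"
    and nbhd: "\<And>U. openin T U \<Longrightarrow> q \<in> U \<Longrightarrow> \<exists>m. \<forall>p\<in>topspace T. R m p \<longrightarrow> p \<in> U"
    and Q: "\<forall>\<^sub>F n in sequentially. prob_space (Q n) \<and> X n \<in> Q n \<rightarrow>\<^sub>M borel_of T
              \<and> L n = distr (Q n) (borel_of T) (X n)"
    and conc: "\<And>m. \<exists>A. (\<forall>\<^sub>F n in sequentially. A n \<in> sets (Q n)
              \<and> (\<forall>w\<in>space (Q n) - A n. R m (X n w))) \<and> (\<lambda>n. measure (Q n) (A n)) \<longlonglongrightarrow> 0"
  shows "weak_conv_in T L (return (borel_of T) q)"
  unfolding weak_conv_in_def
proof (intro conjI allI impI)
  have q': "q \<in> space (borel_of T)" using q by simp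
  show "return (borel_of T) q \<in> space (prob_algebra (borel_of T))"
    using q' by (simp add: space_prob_algebra prob_space_return)
  show "\<forall>\<^sub>F n in sequentially. L n \<in> space (prob_algebra (borel_of T))"
    using Q by eventually_elim (auto simp: space_prob_algebra intro: prob_space.prob_space_distr)
  fix f assume f: "continuous_map T euclideanreal f \<and> bounded (f ` topspace T)"
  hence f_meas: "f \<in> borel_measurable (borel_of T)" by (simp add: continuous_map_borel_of)
  obtain B where B: "\<And>p. p \<in> topspace T \<Longrightarrow> \<bar>f p\<bar> \<le> B"
    using f by (auto simp: bounded_iff)
  have B0: "0 \<le> B" using B[OF q] by linarith
  have "(\<lambda>n. \<integral>x. f x \<partial>L n) \<longlonglongrightarrow> f q"
  proof (rule tendstoI)
    fix e :: real assume e: "e > 0"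
    define U where "U = {p \<in> topspace T. f p \<in> {f q - e/2<..<f q + e/2}}"
    have "openin T U"
      unfolding U_def using f by (intro openin_continuous_map_preimage[of _ euclideanreal]) auto
    moreover have "q \<in> U" using q e by (simp add: U_def)
    ultimately have "\<exists>m. \<forall>p\<in>topspace T. R m p \<longrightarrow> p \<in> U" by (rule nbhd)
    then obtain m where m: "\<And>p. p \<in> topspace T \<Longrightarrow> R m p \<Longrightarrow> p \<in> U" by blast
    obtain A where A: "\<forall>\<^sub>F n in sequentially. A n \<in> sets (Q n) \<and> (\<forall>w\<in>space (Q n) - A n. R m (X n w))"
      and A0: "(\<lambda>n. measure (Q n) (A n)) \<longlonglongrightarrow> 0" using conc[of m] by blast
    have "(\<lambda>n. e/2 + 2 * B * measure (Q n) (A n)) \<longlonglongrightarrow> e/2 + 2 * B * 0"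
      by (intro tendsto_intros A0)
    moreover have "e/2 + 2 * B * 0 < e" using e by simp
    ultimately have "\<forall>\<^sub>F n in sequentially. e/2 + 2 * B * measure (Q n) (A n) < e"
      by (rule order_tendstoD(2))
    thus "\<forall>\<^sub>F n in sequentially. dist (\<integral>x. f x \<partial>L n) (f q) < e"
      using A Q
    proof eventually_elim
      case (elim n)
      interpret Q: prob_space "Q n" using elim by simp
      have [measurable]: "X n \<in> Q n \<rightarrow>\<^sub>M borel_of T" "A n \<in> sets (Q n)" "f \<in> borel_measurable (borel_of T)"
        using elim f_meas by auto
      have XT: "X n w \<in> topspace T" if "w \<in> space (Q n)" for w
        using measurable_space[of "X n" "Q n" "borel_of T" w] that by simp
      have int: "integrable (Q n) (\<lambda>w. f (X n w))"
        by (rule Q.integrable_const_bound[of _ B]) (auto intro!: AE_I2 B XT)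
      have "(\<integral>x. f x \<partial>L n) - f q = (\<integral>w. f (X n w) - f q \<partial>Q n)"
        using elim int by (simp add: integral_distr Q.prob_space)
      also have "\<bar>\<dots>\<bar> \<le> (\<integral>w. \<bar>f (X n w) - f q\<bar> \<partial>Q n)"
        by (rule integral_abs_bound)
      also have "\<dots> \<le> (\<integral>w. e/2 + 2 * B * indicator (A n) w \<partial>Q n)"
      proof (rule integral_mono)
        fix w assume w: "w \<in> space (Q n)"
        show "\<bar>f (X n w) - f q\<bar> \<le> e/2 + 2 * B * indicator (A n) w"
        proof (cases "w \<in> A n")
          case True
          thus ?thesis using B[OF XT[OF w]] B[OF q] e by simp
        next
          case False
          hence "X n w \<in> U" using elim w by (intro m XT) auto
          hence "f q - e/2 < f (X n w)" "f (X n w) < f q + e/2" by (auto simp: U_def)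
          hence "\<bar>f (X n w) - f q\<bar> \<le> e/2" by linarith
          thus ?thesis using False by simp
        qed
      qed (use int in \<open>auto simp: Q.emeasure_eq_measure\<close>)
      also have "\<dots> = e/2 + 2 * B * measure (Q n) (A n)"
        by (simp add: Q.prob_space Q.emeasure_eq_measure)
      finally show ?case using elim by (simp add: dist_real_def)
    qed
  qed
  thus "(\<lambda>n. \<integral>x. f x \<partial>L n) \<longlonglongrightarrow> (\<integral>x. f x \<partial>return (borel_of T) q)"
    using integral_return[OF q' f_meas] by simp
qed

section \<open>Oscillations of Brownian motion\<close>

text \<open>Chaining sums over \<open>2 ^ k\<close> increments of variance proportional to
  \<open>1 / 2 ^ k\<close>. Second moments would give a divergent series there; fourth moments gain
  another factor \<open>1 / 2 ^ k\<close>.\<close>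

lemma normal_fourth_moment_tail:
  assumes "prob_space M" and X: "distributed M lborel X (normal_density 0 \<sigma>)"
    and "\<sigma> > 0" "a > 0"
  shows "measure M {w \<in> space M. a \<le> \<bar>X w\<bar>} \<le> 3 * \<sigma> ^ 4 / a ^ 4"
proof -
  interpret prob_space M by fact
  have mom: "has_bochner_integral lborel (\<lambda>x. normal_density 0 \<sigma> x * x ^ 4) (3 * \<sigma> ^ 4)"
  proof -
    have *: "fact (2 * 2) / ((2 / \<sigma>\<^sup>2) ^ 2 * fact 2) = 3 * \<sigma> ^ 4"
      using \<open>\<sigma> > 0\<close> by (simp add: fact_numeral field_simps eval_nat_numeral)
    have "has_bochner_integral lborel (\<lambda>x. normal_density 0 \<sigma> x * (x - 0) ^ (2 * 2)) (3 * \<sigma> ^ 4)"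
      unfolding *[symmetric] by (rule normal_moment_even) fact
    thus ?thesis by simp
  qed
  have int: "integrable M (\<lambda>w. X w ^ 4)"
    using distributed_integrable[OF X, of "\<lambda>x. x ^ 4"] mom
    by (auto simp: has_bochner_integral_iff)
  have ex: "(\<integral>w. X w ^ 4 \<partial>M) = 3 * \<sigma> ^ 4"
    using distributed_integral[OF X, of "\<lambda>x. x ^ 4"] mom
    by (auto simp: has_bochner_integral_iff)
  have "a \<le> \<bar>X w\<bar> \<longleftrightarrow> a ^ 4 \<le> X w ^ 4" for w
    using power_mono_iff[of a "\<bar>X w\<bar>" 4] \<open>a > 0\<close> by (simp add: power_abs)
  hence "measure M {w \<in> space M. a \<le> \<bar>X w\<bar>} = measure M {w \<in> space M. a ^ 4 \<le> X w ^ 4}" by simp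
  also have "\<dots> \<le> 3 * \<sigma> ^ 4 / a ^ 4"
    using integral_Markov_inequality_measure[OF int, of "{}" "a ^ 4"] \<open>a > 0\<close> by (simp add: ex)
  finally show ?thesis .
qed

lemma continuous_le_dyadic:
  fixes f :: "real \<Rightarrow> real"
  assumes h: "h > 0" and cont: "continuous_on {a..a + h} f"
    and le: "\<And>K l. l \<le> 2 ^ K \<Longrightarrow> f (a + h * real l / 2 ^ K) \<le> c"
    and s: "s \<in> {a..a + h}"
  shows "f s \<le> c"
proof -
  define u where "u = (s - a) / h"
  have u: "0 \<le> u" "u \<le> 1" and su: "s = a + h * u" using s h by (auto simp: u_def field_simps)
  define d where "d K = a + h * real (nat \<lfloor>u * 2 ^ K\<rfloor>) / 2 ^ K" for K :: nat
  have fl: "real (nat \<lfloor>u * 2 ^ K\<rfloor>) = of_int \<lfloor>u * 2 ^ K\<rfloor>" for K using u by simp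
  have dle: "nat \<lfloor>u * 2 ^ K\<rfloor> \<le> 2 ^ K" for K
  proof -
    have "u * 2 ^ K \<le> 2 ^ K" using u by simp
    hence "\<lfloor>u * 2 ^ K\<rfloor> \<le> \<lfloor>2 ^ K :: real\<rfloor>" by (rule floor_mono)
    thus ?thesis by (simp add: nat_le_iff)
  qed
  have d_bounds: "d K \<le> s" "s - h / 2 ^ K \<le> d K" for K
  proof -
    have "real_of_int \<lfloor>u * 2 ^ K\<rfloor> / 2 ^ K \<le> u" by (simp add: divide_le_eq)
    hence "h * (real_of_int \<lfloor>u * 2 ^ K\<rfloor> / 2 ^ K) \<le> h * u" using h by (intro mult_left_mono) auto
    thus "d K \<le> s" unfolding d_def fl su by simp
    have "u * 2 ^ K - 1 \<le> real_of_int \<lfloor>u * 2 ^ K\<rfloor>" by linarith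
    hence "(u * 2 ^ K - 1) / 2 ^ K \<le> real_of_int \<lfloor>u * 2 ^ K\<rfloor> / 2 ^ K" by (rule divide_right_mono) simp
    hence "u - 1 / 2 ^ K \<le> real_of_int \<lfloor>u * 2 ^ K\<rfloor> / 2 ^ K" by (simp add: diff_divide_distrib)
    hence "h * (u - 1 / 2 ^ K) \<le> h * (real_of_int \<lfloor>u * 2 ^ K\<rfloor> / 2 ^ K)" using h by (intro mult_left_mono) auto
    thus "s - h / 2 ^ K \<le> d K" unfolding d_def fl su by (simp add: algebra_simps)
  qed
  have "(\<lambda>K. s - h / 2 ^ K) \<longlonglongrightarrow> s" by real_asymp
  hence "d \<longlonglongrightarrow> s"
    by (intro tendsto_sandwich[of "\<lambda>K. s - h / 2 ^ K" d _ "\<lambda>_. s"] always_eventually allI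
        d_bounds tendsto_const)
  moreover have "d K \<in> {a..a + h}" for K
    using d_bounds(1)[of K] s h by (auto simp: d_def)
  ultimately have "(\<lambda>K. f (d K)) \<longlonglongrightarrow> f s"
    by (intro continuous_on_tendsto_compose[OF cont]) (use s in auto)
  moreover have "f (d K) \<le> c" for K
    unfolding d_def by (rule le[OF dle])
  ultimately show ?thesis using LIMSEQ_le_const2 by blast
qed

text \<open>A dyadic point of level K+1 either has level K already or is one increment away from
  such a point. The tolerances \<open>e / 10 * (9/10) ^ k\<close> add up to
  \<open>e\<close>.\<close>

lemma dyadic_chaining:
  fixes f :: "real \<Rightarrow> real"
  assumes h: "h > 0" and e: "e > 0"
    and cont: "continuous_on {a..a + h} f"
    and incr: "\<And>k l. l < 2 ^ k \<Longrightarrow>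
      \<bar>f (a + h * (real l + 1) / 2 ^ k) - f (a + h * real l / 2 ^ k)\<bar> \<le> e / 10 * (9/10) ^ k"
    and s: "s \<in> {a..a + h}"
  shows "\<bar>f s - f a\<bar> \<le> e"
proof -
  have dyadic: "\<bar>f (a + h * real l / 2 ^ K) - f a\<bar> \<le> e * (1 - (9/10) ^ Suc K)" if "l \<le> 2 ^ K" for K l
    using that
  proof (induction K arbitrary: l)
    case 0
    hence "l = 0 \<or> l = 1" by auto
    thus ?case using incr[of 0 0] e by auto
  next
    case (Suc K)
    show ?case
    proof (cases "even l")
      case True
      then obtain j where j: "l = 2 * j" by blast
      have "\<bar>f (a + h * real j / 2 ^ K) - f a\<bar> \<le> e * (1 - (9/10) ^ Suc K)"
        using Suc.prems by (intro Suc.IH) (simp add: j)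
      also have "\<dots> \<le> e * (1 - (9/10) ^ Suc (Suc K))"
        using e by (intro mult_left_mono) auto
      finally show ?thesis by (simp add: j)
    next
      case False
      then obtain j where j: "l = 2 * j + 1" by (elim oddE)
      have jK: "j < 2 ^ K" using Suc.prems by (simp add: j)
      have "\<bar>f (a + h * real j / 2 ^ K) - f a\<bar> \<le> e * (1 - (9/10) ^ Suc K)"
        using jK by (intro Suc.IH) auto
      moreover have "\<bar>f (a + h * (real (2 * j) + 1) / 2 ^ Suc K) - f (a + h * real (2 * j) / 2 ^ Suc K)\<bar>
          \<le> e / 10 * (9/10) ^ Suc K"
        using jK by (intro incr) simp
      moreover have "e * (1 - (9/10) ^ Suc K) + e / 10 * (9/10) ^ Suc K = e * (1 - (9/10) ^ Suc (Suc K))"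
        by (simp add: algebra_simps)
      moreover have "h * real (2 * j) / 2 ^ Suc K = h * real j / 2 ^ K"
        "h * real l / 2 ^ Suc K = h * (real (2 * j) + 1) / 2 ^ Suc K"
        by (simp_all add: j algebra_simps)
      ultimately show ?thesis by (smt (verit))
    qed
  qed
  have "\<bar>f (a + h * real l / 2 ^ K) - f a\<bar> \<le> e" if "l \<le> 2 ^ K" for K l
  proof -
    have "\<bar>f (a + h * real l / 2 ^ K) - f a\<bar> \<le> e * (1 - (9/10) ^ Suc K)"
      by (rule dyadic[OF that])
    also have "\<dots> \<le> e * 1" using e by (intro mult_left_mono) auto
    finally show ?thesis by simp
  qed
  moreover have "continuous_on {a..a + h} (\<lambda>s. \<bar>f s - f a\<bar>)"
    by (intro continuous_intros cont)
  ultimately show ?thesis using continuous_le_dyadic[OF h _ _ s] by blast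
qed

lemma brownian_oscillation:
  fixes W :: "real \<Rightarrow> 'w \<Rightarrow> real"
  assumes "prob_space M" and h: "h > 0" and e: "e > 0"
    and W: "\<And>t. a \<le> t \<Longrightarrow> W t \<in> borel_measurable M"
    and incr: "\<And>s t. a \<le> s \<Longrightarrow> s < t \<Longrightarrow>
      distributed M lborel (\<lambda>w. W t w - W s w) (normal_density 0 (sqrt (t - s)))"
    and cont: "AE w in M. continuous_on {a..a + h} (\<lambda>t. W t w)"
  obtains A where "A \<in> sets M" "measure M A \<le> 200000 * h\<^sup>2 / e ^ 4"
    "AE w in M. w \<notin> A \<longrightarrow> (\<forall>s\<in>{a..a + h}. \<bar>W s w - W a w\<bar> \<le> e)"
proof -
  interpret prob_space M by fact
  define D where "D k l w = W (a + h * (real l + 1) / 2 ^ k) w - W (a + h * real l / 2 ^ k) w" for k l :: nat and w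
  \<comment> \<open>The ratio 9/10 is close enough to 1: its fourth power 6561/10000 exceeds 1/2, so
    the tail bounds of the levels form a convergent geometric series.\<close>
  define c where "c k = e / 10 * (9/10) ^ k" for k :: nat
  define B where "B k l = {w \<in> space M. c k \<le> \<bar>D k l w\<bar>}" for k l
  define A where "A = (\<Union>k. \<Union>l<2 ^ k. B k l)"
  have c: "c k > 0" for k using e by (simp add: c_def)
  have [measurable]: "D k l \<in> borel_measurable M" for k l
    unfolding D_def using h by (intro borel_measurable_diff W) auto
  have B [measurable]: "B k l \<in> sets M" for k l unfolding B_def by measurable
  have A: "A \<in> sets M" unfolding A_def by measurable
  have PB: "prob (B k l) \<le> 3 * (h / 2 ^ k)\<^sup>2 / c k ^ 4" for k l
  proof -
    have "h * (real l + 1) / 2 ^ k - h * real l / 2 ^ k = h / 2 ^ k"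
      by (simp add: field_simps)
    hence "distributed M lborel (D k l) (normal_density 0 (sqrt (h / 2 ^ k)))"
      using incr[of "a + h * real l / 2 ^ k" "a + h * (real l + 1) / 2 ^ k"] h
      by (simp add: D_def[abs_def] divide_strict_right_mono)
    from normal_fourth_moment_tail[OF prob_space_axioms this _ c[of k]] h
    have "prob (B k l) \<le> 3 * sqrt (h / 2 ^ k) ^ 4 / c k ^ 4" by (simp add: B_def)
    also have "sqrt (h / 2 ^ k) ^ 4 = ((sqrt (h / 2 ^ k))\<^sup>2)\<^sup>2" by (simp flip: power_mult)
    also have "\<dots> = (h / 2 ^ k)\<^sup>2" using h by (subst real_sqrt_pow2) auto
    finally show ?thesis .
  qed
  \<comment> \<open>\<open>K\<close> collects the factor 3 of the fourth moment and the fourth power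
    of 10 from \<open>c\<close>. The ratio 5000/6561 is 1/2 divided by 6561/10000; the sum of the
    series is below 20/3, which turns 30000 into 200000.\<close>
  define K where "K = 30000 * h\<^sup>2 / e ^ 4"
  have level: "prob (\<Union>l<2 ^ k. B k l) \<le> K * (5000/6561) ^ k" for k
  proof -
    have "prob (\<Union>l<2 ^ k. B k l) \<le> (\<Sum>l<2 ^ k. prob (B k l))"
      by (rule finite_measure_subadditive_finite) auto
    also have "\<dots> \<le> (\<Sum>l<(2::nat) ^ k. 3 * (h / 2 ^ k)\<^sup>2 / c k ^ 4)" by (intro sum_mono PB)
    also have "\<dots> = 2 ^ k * (3 * (h / 2 ^ k)\<^sup>2 / c k ^ 4)" by simp
    also have "\<dots> = 3 * h\<^sup>2 / (e / 10) ^ 4 * (2 ^ k * (1/4) ^ k / (6561/10000) ^ k)"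
    proof -
      have *: "((9/10) ^ k) ^ 4 = ((9/10) ^ 4 :: real) ^ k" "(2 ^ k)\<^sup>2 = (2\<^sup>2 :: real) ^ k"
        by (simp_all only: power_mult[symmetric] mult.commute)
      have "c k ^ 4 = (e / 10) ^ 4 * (6561/10000) ^ k"
        unfolding c_def power_mult_distrib * by (simp add: power_divide)
      moreover have "(h / 2 ^ k)\<^sup>2 = h\<^sup>2 * (1/4) ^ k"
        unfolding power_divide * by (simp add: power_divide)
      ultimately show ?thesis by simp
    qed
    also have "2 ^ k * (1/4) ^ k / (6561/10000) ^ k = (5000/6561 :: real) ^ k"
      by (simp flip: power_mult_distrib power_divide)
    also have "3 * h\<^sup>2 / (e / 10) ^ 4 = K" by (simp add: K_def power_divide)
    finally show ?thesis .
  qed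
  have sm: "summable (\<lambda>k. K * (5000/6561 :: real) ^ k)"
    by (intro summable_mult summable_geometric) simp
  have sm': "summable (\<lambda>k. prob (\<Union>l<2 ^ k. B k l))"
    by (rule summable_comparison_test'[OF sm]) (use level in auto)
  have "prob A \<le> (\<Sum>k. prob (\<Union>l<2 ^ k. B k l))"
    unfolding A_def by (rule finite_measure_subadditive_countably) (use sm' in auto)
  also have "\<dots> \<le> (\<Sum>k. K * (5000/6561) ^ k)"
    by (intro suminf_le level sm sm')
  also have "\<dots> = K * (6561 / 1561)"
    by (subst suminf_mult, rule summable_geometric, simp, subst suminf_geometric) simp_all
  also have "\<dots> \<le> 200000 * h\<^sup>2 / e ^ 4"
  proof -
    have "K * (6561 / 1561) \<le> K * (20 / 3)"
      by (rule mult_left_mono) (simp_all add: K_def)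
    thus ?thesis by (simp add: K_def)
  qed
  finally have PA: "prob A \<le> 200000 * h\<^sup>2 / e ^ 4" .
  have "AE w in M. w \<notin> A \<longrightarrow> (\<forall>s\<in>{a..a + h}. \<bar>W s w - W a w\<bar> \<le> e)"
    using cont AE_space
  proof eventually_elim
    case (elim w)
    show ?case
    proof (intro impI ballI)
      fix s assume wA: "w \<notin> A" and s: "s \<in> {a..a + h}"
      show "\<bar>W s w - W a w\<bar> \<le> e"
      proof (rule dyadic_chaining[OF h e elim(1) _ s])
        fix k l :: nat assume "l < 2 ^ k"
        hence "\<not> c k \<le> \<bar>D k l w\<bar>" using wA elim(2) by (auto simp: A_def B_def)
        thus "\<bar>W (a + h * (real l + 1) / 2 ^ k) w - W (a + h * real l / 2 ^ k) w\<bar> \<le> e / 10 * (9/10) ^ k"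
          by (simp add: D_def c_def)
      qed
    qed
  qed
  thus ?thesis using that A PA by blast
qed

section \<open>Oscillations of the particle system\<close>

lemma set_integral_diff_bounded:
  fixes f :: "real \<Rightarrow> real"
  assumes [measurable]: "f \<in> borel_measurable borel" and D: "\<And>u. \<bar>f u\<bar> \<le> D"
    and st: "0 \<le> s" "s \<le> t"
  shows "\<bar>(\<integral>u\<in>{0..t}. f u \<partial>lborel) - (\<integral>u\<in>{0..s}. f u \<partial>lborel)\<bar> \<le> D * (t - s)"
proof -
  have int: "set_integrable lborel A f" if "A \<in> sets borel" "emeasure lborel A < \<infinity>" for A
    unfolding set_integrable_def using that D
    by (intro integrableI_bounded_set_indicator[where B = D]) auto
  have "{0..t} = {0..s} \<union> {s<..t}" using st by auto
  hence "(\<integral>u\<in>{0..t}. f u \<partial>lborel) = (\<integral>u\<in>{0..s}. f u \<partial>lborel) + (\<integral>u\<in>{s<..t}. f u \<partial>lborel)"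
    using st by (simp only:) (rule set_integral_Un, auto intro!: int)
  moreover have "\<bar>\<integral>u\<in>{s<..t}. f u \<partial>lborel\<bar> \<le> (\<integral>u\<in>{s<..t}. \<bar>f u\<bar> \<partial>lborel)"
    using set_integral_norm_bound[of lborel "{s<..t}" f] st int by simp
  moreover have "(\<integral>u\<in>{s<..t}. \<bar>f u\<bar> \<partial>lborel) \<le> (\<integral>u\<in>{s<..t}. D \<partial>lborel)"
    using st D by (intro set_integral_mono set_integrable_abs int) (auto simp: set_integrable_def)
  moreover have "(\<integral>u\<in>{s<..t}. D \<partial>lborel) = D * (t - s)"
    using st by (simp add: set_lebesgue_integral_def)
  ultimately show ?thesis by simp
qed

text \<open>There are fewer than n terms, each bounded by a constant times the scale. This crude
  bound is enough because any polynomial growth can be beaten by refining the time mesh.\<close>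

lemma (in admissible_potential) drift_bound:
  obtains C where "C > 0" "\<And>n y i. \<bar>drift V \<alpha> n y i\<bar> \<le> C * real n powr (2 + \<alpha>)"
proof -
  obtain C where C: "C > 0" "\<And>z. \<bar>deriv V z\<bar> \<le> C" using deriv_V_bounded by blast
  have "\<bar>drift V \<alpha> n y i\<bar> \<le> C * real n powr (2 + \<alpha>)" for n y i
  proof (cases "n = 0")
    case False
    have "\<bar>\<Sum>j\<in>{..<n} - {i}. deriv V (real n powr (1 + \<alpha>) * circle_diff (y i) (y j))\<bar>
        \<le> (\<Sum>j\<in>{..<n} - {i}. C)"
      by (rule order_trans[OF sum_abs sum_mono]) (rule C)
    also have "\<dots> \<le> (\<Sum>j<n. C)" using C(1) by (intro sum_mono2) auto
    finally have "real n powr (1 + \<alpha>) *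
        \<bar>\<Sum>j\<in>{..<n} - {i}. deriv V (real n powr (1 + \<alpha>) * circle_diff (y i) (y j))\<bar>
        \<le> real n powr (1 + \<alpha>) * (real n * C)" by (intro mult_left_mono) auto
    also have "real n powr (1 + \<alpha>) * (real n * C) = C * real n powr (2 + \<alpha>)"
      using False by (simp add: powr_add power2_eq_square)
    finally show ?thesis by (simp add: drift_def abs_mult)
  qed (simp add: drift_def)
  thus ?thesis using that C(1) by blast
qed

lemma (in admissible_potential) drift_integral_diff:
  assumes y: "\<And>j. j < n \<Longrightarrow> continuous_on {0..} (\<lambda>t. y t j)"
    and D: "\<And>z. \<bar>drift V \<alpha> n z i\<bar> \<le> D"
    and i: "i < n" and st: "0 \<le> s" "s \<le> t"
  shows "\<bar>(\<integral>u\<in>{0..t}. drift V \<alpha> n (y u) i \<partial>lborel) - (\<integral>u\<in>{0..s}. drift V \<alpha> n (y u) i \<partial>lborel)\<bar>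
    \<le> D * (t - s)"
proof -
  \<comment> \<open>The paths are continuous on the half-line only; freezing them at time 0 for
    negative times gives a Borel function on the whole line with the same integrals.\<close>
  define f where "f u = drift V \<alpha> n (y (max 0 u)) i" for u
  have [measurable]: "(\<lambda>u. y (max 0 u) j) \<in> borel \<rightarrow>\<^sub>M borel" if "j < n" for j
    by (intro borel_measurable_continuous_onI continuous_on_compose2[OF y[OF that]] continuous_intros) auto
  have f: "f \<in> borel_measurable borel"
    unfolding f_def drift_def using i by measurable
  have eq: "(\<integral>u\<in>{0..r}. drift V \<alpha> n (y u) i \<partial>lborel) = (\<integral>u\<in>{0..r}. f u \<partial>lborel)" for r
    unfolding set_lebesgue_integral_def f_def
    by (intro Bochner_Integration.integral_cong refl) (auto simp: indicator_def max_def)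
  show ?thesis
    unfolding eq by (rule set_integral_diff_bounded[OF f _ st]) (simp add: f_def D)
qed

text \<open>The noise is additive, so a particle moves at most by its drift integral plus its
  Brownian increment; each is allowed \<open>e\<close>. The probability is a union bound over the
  particles.\<close>

lemma (in admissible_potential) sde_solution_oscillation:
  assumes sol: "sde_solution V \<alpha> n M x \<eta>"
    and cont: "\<And>w i. w \<in> space M \<Longrightarrow> i < n \<Longrightarrow> continuous_on {0..} (\<lambda>t. x t w i)"
    and D: "\<And>z i. \<bar>drift V \<alpha> n z i\<bar> \<le> D"
    and a: "0 \<le> a" and h: "h > 0" and e: "e > 0" "D * h \<le> e"
  obtains A where "A \<in> sets M" "measure M A \<le> real n * (200000 * h\<^sup>2 / e ^ 4)"
    "AE w in M. w \<notin> A \<longrightarrow> (\<forall>i<n. \<forall>s\<in>{a..a + h}. dist (x s w i) (x a w i) \<le> 2 * e)"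
proof -
  obtain F B where "prob_space M" and bm: "brownian_motions M F n B"
    and eq: "AE w in M. \<forall>t\<ge>0. \<forall>i<n. x t w i = rotate_circle (x 0 w i)
             ((\<integral>s\<in>{0..t}. drift V \<alpha> n (x s w) i \<partial>lborel) + B i t w)"
    using sol unfolding sde_solution_def by blast
  interpret prob_space M by fact
  note bm' = bm[unfolded brownian_motions_def]
  note subalg = bm'[THEN conjunct1] and meas = bm'[THEN conjunct2, THEN conjunct2, THEN conjunct1]
    and bm_cont = bm'[THEN conjunct2, THEN conjunct2, THEN conjunct2, THEN conjunct1]
    and bm_incr = bm'[THEN conjunct2, THEN conjunct2, THEN conjunct2, THEN conjunct2]
  have "\<exists>A. A \<in> sets M \<and> prob A \<le> 200000 * h\<^sup>2 / e ^ 4 \<and>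
      (AE w in M. w \<notin> A \<longrightarrow> (\<forall>s\<in>{a..a + h}. \<bar>B i s w - B i a w\<bar> \<le> e))" if i: "i < n" for i
  proof -
    have m: "B i t \<in> borel_measurable M" if "a \<le> t" for t
      by (rule measurable_from_subalg[of M "F t"]) (use subalg meas order_trans[OF a that] i in auto)
    have inc: "distributed M lborel (\<lambda>w. B i t w - B i s w) (normal_density 0 (sqrt (t - s)))"
      if "a \<le> s" "s < t" for s t
      using bm_incr[rule_format, of s t, THEN conjunct1] order_trans[OF a that(1)] that(2) i by simp
    have co: "AE w in M. continuous_on {a..a + h} (\<lambda>t. B i t w)"
      using bm_cont by eventually_elim (use i a in \<open>auto intro: continuous_on_subset\<close>)
    obtain A where "A \<in> sets M" "prob A \<le> 200000 * h\<^sup>2 / e ^ 4"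
      "AE w in M. w \<notin> A \<longrightarrow> (\<forall>s\<in>{a..a + h}. \<bar>B i s w - B i a w\<bar> \<le> e)"
      by (rule brownian_oscillation[OF prob_space_axioms h e(1) m inc co])
    thus ?thesis by blast
  qed
  hence "\<forall>i\<in>{..<n}. \<exists>A. A \<in> sets M \<and> prob A \<le> 200000 * h\<^sup>2 / e ^ 4 \<and>
      (AE w in M. w \<notin> A \<longrightarrow> (\<forall>s\<in>{a..a + h}. \<bar>B i s w - B i a w\<bar> \<le> e))" by blast
  from bchoice[OF this] obtain A where A: "\<And>i. i < n \<Longrightarrow> A i \<in> sets M"
    "\<And>i. i < n \<Longrightarrow> prob (A i) \<le> 200000 * h\<^sup>2 / e ^ 4"
    "\<And>i. i < n \<Longrightarrow> AE w in M. w \<notin> A i \<longrightarrow> (\<forall>s\<in>{a..a + h}. \<bar>B i s w - B i a w\<bar> \<le> e)"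
    by (auto simp: Ball_def)
  show ?thesis
  proof (rule that[of "\<Union>i<n. A i"])
    show "(\<Union>i<n. A i) \<in> sets M" using A by auto
    have "prob (\<Union>i<n. A i) \<le> (\<Sum>i<n. prob (A i))"
      using A by (intro finite_measure_subadditive_finite) auto
    also have "\<dots> \<le> (\<Sum>i<n. 200000 * h\<^sup>2 / e ^ 4)" using A by (intro sum_mono) auto
    finally show "prob (\<Union>i<n. A i) \<le> real n * (200000 * h\<^sup>2 / e ^ 4)" by simp
    have "AE w in M. \<forall>i\<in>{..<n}. w \<notin> A i \<longrightarrow> (\<forall>s\<in>{a..a + h}. \<bar>B i s w - B i a w\<bar> \<le> e)"
      by (rule AE_finite_allI) (use A(3) in simp_all)
    thus "AE w in M. w \<notin> (\<Union>i<n. A i) \<longrightarrow> (\<forall>i<n. \<forall>s\<in>{a..a + h}. dist (x s w i) (x a w i) \<le> 2 * e)"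
      using eq AE_space[of M]
    proof eventually_elim
      case (elim w)
      show ?case
      proof (intro impI allI ballI)
        fix i s assume w: "w \<notin> (\<Union>i<n. A i)" and i: "i < n" and s: "s \<in> {a..a + h}"
        define I where "I t = (\<integral>u\<in>{0..t}. drift V \<alpha> n (x u w) i \<partial>lborel)" for t
        have rot: "x t w i = rotate_circle (x 0 w i) (I t + B i t w)" if "0 \<le> t" for t
          using elim(2) that i unfolding I_def by blast
        have "dist (x s w i) (x a w i) = dist (rotate_circle (x 0 w i) (I s + B i s w))
            (rotate_circle (x 0 w i) (I a + B i a w))"
          by (rule arg_cong2[where f = dist, OF rot rot]) (use a s in auto)
        also have "\<dots> \<le> \<bar>(I s + B i s w) - (I a + B i a w)\<bar>"
          by (rule dist_rotate_circle_le)
        also have "\<dots> \<le> \<bar>I s - I a\<bar> + \<bar>B i s w - B i a w\<bar>" by linarith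
        also have "\<bar>B i s w - B i a w\<bar> \<le> e" using elim(1) w i s by blast
        also have "\<bar>I s - I a\<bar> \<le> D * (s - a)"
          unfolding I_def using s a i cont[OF elim(3)] by (intro drift_integral_diff D) auto
        also have "\<dots> \<le> D * h"
          \<comment> \<open>An arbitrary instance of the drift bound shows that \<open>D\<close> is
            nonnegative.\<close>
          using s D[of undefined undefined] by (intro mult_left_mono) auto
        finally show "dist (x s w i) (x a w i) \<le> 2 * e" using e(2) by linarith
      qed
    qed
  qed
qed

text \<open>The Brownian motions exist separately for each initial configuration. This event refers
  to the particles alone, so it is the same set under all kernels and its probability can be
  integrated.\<close>

definition calm :: "'w measure \<Rightarrow> (real \<Rightarrow> 'w \<Rightarrow> nat \<Rightarrow> circle) \<Rightarrow> nat \<Rightarrow> real \<Rightarrow> real \<Rightarrow> real \<Rightarrow> 'w set" where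
  "calm M x n a h c = {w \<in> space M. \<forall>i<n. \<forall>s\<in>{a..a + h}. dist (x s w i) (x a w i) \<le> c}"

text \<open>By continuity the uncountable quantifier over times may be restricted to dyadic
  ones.\<close>

lemma calm_measurable:
  assumes x: "\<And>t. 0 \<le> t \<Longrightarrow> x t \<in> M \<rightarrow>\<^sub>M circle_power n"
    and cont: "\<And>w i. w \<in> space M \<Longrightarrow> i < n \<Longrightarrow> continuous_on {0..} (\<lambda>t. x t w i)"
    and a: "0 \<le> a" and h: "h > 0"
  shows "calm M x n a h c \<in> sets M"
proof -
  have "(\<forall>s\<in>{a..a + h}. dist (x s w i) (x a w i) \<le> c) \<longleftrightarrow>
      (\<forall>K l. l \<le> 2 ^ K \<longrightarrow> dist (x (a + h * real l / 2 ^ K) w i) (x a w i) \<le> c)" (is "?L \<longleftrightarrow> ?R")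
    if w: "w \<in> space M" "i < n" for w i
  proof
    assume L: ?L
    show ?R
    proof (intro allI impI)
      fix K l :: nat assume "l \<le> 2 ^ K"
      hence "real l \<le> 2 ^ K" by (metis of_nat_le_iff of_nat_numeral of_nat_power)
      hence "h * real l / 2 ^ K \<le> h" using h by (simp add: divide_le_eq)
      thus "dist (x (a + h * real l / 2 ^ K) w i) (x a w i) \<le> c" using L h by simp
    qed
  next
    assume R: ?R
    have "continuous_on {a..a + h} (\<lambda>s. dist (x s w i) (x a w i))"
      by (intro continuous_intros continuous_on_subset[OF cont[OF w]]) (use a in auto)
    thus ?L using continuous_le_dyadic[OF h] R by blast
  qed
  hence "calm M x n a h c = {w \<in> space M. \<forall>i K l. i < n \<longrightarrow> l \<le> 2 ^ K \<longrightarrow>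
      dist (x (a + h * real l / 2 ^ K) w i) (x a w i) \<le> c}"
    unfolding calm_def by blast
  also have "\<dots> \<in> sets M"
  proof -
    have x_i: "(\<lambda>w. x t w i) \<in> M \<rightarrow>\<^sub>M borel" if "0 \<le> t" "i < n" for t i
      by (rule measurable_compose[OF x[OF that(1)] circle_power_component[OF that(2)]])
    have "Measurable.pred M (\<lambda>w. dist (x (a + h * real l / 2 ^ K) w i) (x a w i) \<le> c)"
      if "i < n" for i K and l :: nat
      unfolding pred_def using that a h
      by (intro borel_measurable_le dist_circle_measurable x_i borel_measurable_const) auto
    hence "Measurable.pred M (\<lambda>w. i < n \<longrightarrow> l \<le> 2 ^ K \<longrightarrow>
        dist (x (a + h * real l / 2 ^ K) w i) (x a w i) \<le> c)" for i K and l :: nat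
      by (cases "i < n") auto
    thus ?thesis unfolding pred_def by (intro sets.sets_Collect_countable_All)
  qed
  finally show ?thesis .
qed

section \<open>Measurability of the empirical processes\<close>

lemma prohorov_triangle:
  assumes "\<mu> \<in> space (prob_algebra borel)" "\<nu> \<in> space (prob_algebra borel)" "\<kappa> \<in> space (prob_algebra borel)"
  shows "prohorov_dist \<mu> \<kappa> \<le> prohorov_dist \<mu> \<nu> + prohorov_dist \<nu> \<kappa>"
  using Metric_space.triangle[OF Metric_space_prohorov assms] .

lemma prohorov_commute: "prohorov_dist \<mu> \<nu> = prohorov_dist \<nu> \<mu>"
  using Metric_space.commute[OF Metric_space_prohorov] .

lemma topspace_prohorov: "topspace (mtopology_of prohorov_metric) = space (prob_algebra borel)"
  by (simp add: topspace_mtopology_of)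

section \<open>Countably many scales and discrete codes of configurations\<close>

lemma open_entourage:
  assumes "openin (mtopology_of m) U" "p \<in> U"
  shows "\<exists>k::nat. \<forall>q\<in>mspace m. mdist m p q < 1 / (real k + 1) \<longrightarrow> q \<in> U"
proof -
  obtain r where r: "r > 0" "Metric_space.mball (mspace m) (mdist m) p r \<subseteq> U"
    and p: "p \<in> mspace m"
    using assms unfolding mtopology_of_def
    by (meson Metric_space.openin_mtopology Metric_space_mspace_mdist subsetD)
  obtain k where "1 / (real k + 1) < r"
    using reals_Archimedean[OF r(1)] by (auto simp: inverse_eq_divide add.commute)
  thus ?thesis
    using r(2) p by (intro exI[of _ k]) (auto simp: Metric_space.in_mball[OF Metric_space_mspace_mdist])
qed

text \<open>With radii \<open>1 / (k + 1)\<close>, passing from index k to 2 k + 1 halves the radius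
  exactly; this serves the triangle inequality.\<close>

lemma half_entourage: "1 / (real (2 * k + 1) + 1) = 1 / (real k + 1) / 2"
  by (simp add: field_simps)

text \<open>Lists over a countable type form a countable type, so finitely many discrete
  observations can be combined into one that is measurable for the full power set.\<close>

lemma measurable_map_count_space:
  fixes f :: "'b \<Rightarrow> 'a \<Rightarrow> 'c::countable"
  assumes "\<And>j. j \<in> set js \<Longrightarrow> f j \<in> M \<rightarrow>\<^sub>M count_space UNIV"
  shows "(\<lambda>w. map (\<lambda>j. f j w) js) \<in> M \<rightarrow>\<^sub>M count_space UNIV"
  using assms
proof (induction js)
  case (Cons a js)
  have "(\<lambda>w. map (\<lambda>j. f j w) js) \<in> M \<rightarrow>\<^sub>M count_space UNIV" using Cons by simp
  hence "(\<lambda>w. c # map (\<lambda>j. f j w) js) \<in> M \<rightarrow>\<^sub>M count_space UNIV" for c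
    by (rule measurable_compose) simp
  hence "(\<lambda>w. f a w # map (\<lambda>j. f j w) js) \<in> M \<rightarrow>\<^sub>M count_space UNIV"
    by (rule measurable_compose_countable) (use Cons.prems in simp)
  thus ?case by simp
qed simp

definition grid_code :: "nat \<Rightarrow> circle \<Rightarrow> nat" where
  "grid_code k y = nat \<lfloor>(real k + 1) * rep_circle y\<rfloor>"

definition grid_point :: "nat \<Rightarrow> nat \<Rightarrow> circle" where
  "grid_point k j = to_circle (real j / (real k + 1))"

lemma grid_code_measurable [measurable]: "grid_code k \<in> borel \<rightarrow>\<^sub>M count_space UNIV"
  unfolding grid_code_def by measurable

lemma floor_approx:
  assumes "0 \<le> (u::real)"
  shows "real (nat \<lfloor>(real k + 1) * u\<rfloor>) / (real k + 1) \<le> u"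
    and "u - real (nat \<lfloor>(real k + 1) * u\<rfloor>) / (real k + 1) \<le> 1 / (real k + 1)"
proof -
  have fl: "real (nat \<lfloor>(real k + 1) * u\<rfloor>) = of_int \<lfloor>(real k + 1) * u\<rfloor>" using assms by simp
  have "of_int \<lfloor>(real k + 1) * u\<rfloor> \<le> (real k + 1) * u" by linarith
  thus "real (nat \<lfloor>(real k + 1) * u\<rfloor>) / (real k + 1) \<le> u"
    unfolding fl by (simp add: divide_le_eq mult.commute)
  have "(real k + 1) * u \<le> of_int \<lfloor>(real k + 1) * u\<rfloor> + 1" by linarith
  hence "u \<le> (of_int \<lfloor>(real k + 1) * u\<rfloor> + 1) / (real k + 1)" by (simp add: le_divide_eq mult.commute)
  thus "u - real (nat \<lfloor>(real k + 1) * u\<rfloor>) / (real k + 1) \<le> 1 / (real k + 1)"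
    unfolding fl by (simp add: add_divide_distrib)
qed

lemma dist_grid_point: "dist (grid_point k (grid_code k y)) y \<le> 1 / (real k + 1)"
  using dist_to_circle_le[of "real (grid_code k y) / (real k + 1)" "rep_circle y"]
    floor_approx[OF rep_circle_bounds(1)[of y], of k]
  by (simp add: grid_point_def grid_code_def)

lemma eventually_inverse_Suc_less: "e > 0 \<Longrightarrow> \<forall>\<^sub>F k in sequentially. 1 / (real k + 1) < e"
  by (rule order_tendstoD(2)[of _ 0]) real_asymp+

text \<open>Moving every particle to a grid point makes the empirical measure a function of a list
  of naturals, which is measurable for the discrete sigma-algebra, and it changes the Prohorov
  distance by at most the mesh.\<close>

lemma empirical_measurable:
  assumes n: "n \<ge> 1"
  shows "empirical n \<in> circle_power n \<rightarrow>\<^sub>M borel_of (mtopology_of prohorov_metric)"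
proof (rule measurable_borel_of_approx[where S = "space (prob_algebra borel)" and h = "\<lambda>m. 2 * m + 1"
      and R = "\<lambda>m \<mu> \<nu>. prohorov_dist \<mu> \<nu> < 1 / (real m + 1)"
      and X' = "\<lambda>k w. empirical n (\<lambda>i. grid_point k (map (\<lambda>i. grid_code k (w i)) [0..<n] ! i))"])
  fix k
  have "(\<lambda>w. map (\<lambda>i. grid_code k (w i)) [0..<n]) \<in> circle_power n \<rightarrow>\<^sub>M count_space UNIV"
    by (rule measurable_map_count_space) (auto intro: measurable_compose[OF circle_power_component])
  thus "(\<lambda>w. empirical n (\<lambda>i. grid_point k (map (\<lambda>i. grid_code k (w i)) [0..<n] ! i)))
      \<in> circle_power n \<rightarrow>\<^sub>M count_space UNIV"
    by (rule measurable_compose) simp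
next
  fix m and w :: "nat \<Rightarrow> circle"
  define e where "e = 1 / (real m + 1)"
  have e: "e > 0" by (simp add: e_def)
  have "\<forall>\<^sub>F k in sequentially. 1 / (real k + 1) < e / 2"
    by (rule eventually_inverse_Suc_less) (use e in simp)
  thus "\<forall>\<^sub>F k in sequentially.
      prohorov_dist (empirical n w) (empirical n (\<lambda>i. grid_point k (map (\<lambda>i. grid_code k (w i)) [0..<n] ! i)))
        < 1 / (real m + 1) \<and>
      prohorov_dist (empirical n (\<lambda>i. grid_point k (map (\<lambda>i. grid_code k (w i)) [0..<n] ! i))) (empirical n w)
        < 1 / (real m + 1)"
  proof eventually_elim
    case (elim k)
    have "prohorov_dist (empirical n (\<lambda>i. grid_point k (map (\<lambda>i. grid_code k (w i)) [0..<n] ! i))) (empirical n w)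
        \<le> e / 2"
      by (rule prohorov_empirical_le[OF n]) (use le_less_trans[OF dist_grid_point elim] in simp)
    thus ?case using e by (simp add: e_def[symmetric] prohorov_commute[of "empirical n w"])
  qed
next
  fix U p assume "openin (mtopology_of prohorov_metric) U" "p \<in> U"
  from open_entourage[OF this]
  show "\<exists>m. \<forall>q\<in>topspace (mtopology_of prohorov_metric). prohorov_dist p q < 1 / (real m + 1) \<longrightarrow> q \<in> U"
    by (simp add: topspace_prohorov)
next
  fix m and p q r :: "circle measure"
  assume "p \<in> topspace (mtopology_of prohorov_metric)" "q \<in> space (prob_algebra borel)"
    "r \<in> topspace (mtopology_of prohorov_metric)"
  hence "prohorov_dist p r \<le> prohorov_dist p q + prohorov_dist q r"
    using prohorov_triangle[of p q r] by (simp add: topspace_prohorov)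
  moreover assume "prohorov_dist p q < 1 / (real (2 * m + 1) + 1)" "prohorov_dist q r < 1 / (real (2 * m + 1) + 1)"
  ultimately show "prohorov_dist p r < 1 / (real m + 1)"
    unfolding half_entourage by linarith
qed (use n in \<open>auto simp: topspace_prohorov empirical_in_prob\<close>)

section \<open>Continuous paths in the Skorohod space\<close>

lemma uniformly_continuous_paths:
  fixes y :: "real \<Rightarrow> nat \<Rightarrow> circle"
  assumes "\<And>i. i < n \<Longrightarrow> continuous_on {0..} (\<lambda>t. y t i)" "e > 0"
  shows "\<exists>d>0. \<forall>s\<in>{0..T}. \<forall>t\<in>{0..T}. \<bar>s - t\<bar> < d \<longrightarrow> (\<forall>i<n. dist (y s i) (y t i) < e)"
  using assms(1)
proof (induction n)
  case (Suc n)
  obtain d where d: "d > 0" "\<forall>s\<in>{0..T}. \<forall>t\<in>{0..T}. \<bar>s - t\<bar> < d \<longrightarrow> (\<forall>i<n. dist (y s i) (y t i) < e)"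
    using Suc by auto
  have "uniformly_continuous_on {0..T} (\<lambda>t. y t n)"
    by (intro compact_uniformly_continuous continuous_on_subset[OF Suc.prems]) auto
  then obtain d' where d': "d' > 0" "\<forall>s\<in>{0..T}. \<forall>t\<in>{0..T}. \<bar>s - t\<bar> < d' \<longrightarrow> dist (y s n) (y t n) < e"
    using assms(2) unfolding uniformly_continuous_on_def dist_real_def
    by (metis abs_minus_commute dist_commute)
  show ?case
    by (rule exI[of _ "min d d'"]) (use d d' in \<open>auto simp: less_Suc_eq\<close>)
qed (auto intro: exI[of _ 1])

lemma cadlag_continuous:
  assumes "p \<in> {0..} \<rightarrow>\<^sub>E mspace m"
    and cont: "\<And>t e. t \<ge> 0 \<Longrightarrow> e > 0 \<Longrightarrow> \<exists>d>0. \<forall>s\<ge>0. \<bar>s - t\<bar> < d \<longrightarrow> mdist m (p s) (p t) < e"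
  shows "p \<in> cadlag m"
proof -
  have p: "p t \<in> mspace m" if "t \<ge> 0" for t using assms(1) that by auto
  have lim: "limitin (mtopology_of m) p (p t) F"
    if t: "t \<ge> 0" and F: "\<forall>\<^sub>F s in F. s \<ge> 0" "\<And>d. d > 0 \<Longrightarrow> \<forall>\<^sub>F s in F. \<bar>s - t\<bar> < d" for t F
    unfolding mtopology_of_def Metric_space.limitin_metric[OF Metric_space_mspace_mdist]
  proof (intro conjI allI impI p t)
    fix e :: real assume "e > 0"
    then obtain d where d: "d > 0" "\<forall>s\<ge>0. \<bar>s - t\<bar> < d \<longrightarrow> mdist m (p s) (p t) < e"
      using cont[OF t] by blast
    show "\<forall>\<^sub>F s in F. p s \<in> mspace m \<and> mdist m (p s) (p t) < e"
      using F(1) F(2)[OF d(1)] by eventually_elim (use d p in auto)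
  qed
  have near: "\<forall>\<^sub>F s in at t within A. \<bar>s - t\<bar> < d" if "d > 0" for t d :: real and A
    using that unfolding eventually_at by (auto simp: dist_real_def)
  have "limitin (mtopology_of m) p (p t) (at_right t)" if "t \<ge> 0" for t
    using that by (intro lim near) (auto simp: eventually_at_topological)
  moreover have "limitin (mtopology_of m) p (p t) (at_left t)" if "t > 0" for t
    using that eventually_at_left_real[OF that] by (intro lim near) (auto elim: eventually_mono)
  ultimately show ?thesis unfolding cadlag_def using assms(1) by blast
qed

lemma empirical_path_cadlag:
  assumes n: "n \<ge> 1" and x: "\<And>i. i < n \<Longrightarrow> continuous_on {0..} (\<lambda>t. x t w i)"
  shows "empirical_path n x w \<in> cadlag prohorov_metric"
proof (rule cadlag_continuous)
  show "empirical_path n x w \<in> {0..} \<rightarrow>\<^sub>E mspace prohorov_metric"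
    by (auto simp: empirical_path_def empirical_in_prob[OF n])
  fix t e :: real assume t: "t \<ge> 0" and e: "e > 0"
  obtain d where d: "d > 0" "\<forall>s\<in>{0..t + 1}. \<forall>t'\<in>{0..t + 1}. \<bar>s - t'\<bar> < d \<longrightarrow> (\<forall>i<n. dist (x s w i) (x t' w i) < e / 2)"
    using uniformly_continuous_paths[of n "\<lambda>t. x t w" "e / 2" "t + 1"] x e by auto
  show "\<exists>d>0. \<forall>s\<ge>0. \<bar>s - t\<bar> < d \<longrightarrow>
      mdist prohorov_metric (empirical_path n x w s) (empirical_path n x w t) < e"
  proof (intro exI[of _ "min d 1"] conjI allI impI)
    fix s assume s: "s \<ge> 0" "\<bar>s - t\<bar> < min d 1"
    hence "prohorov_dist (empirical n (x s w)) (empirical n (x t w)) \<le> e / 2"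
      using d t by (intro prohorov_empirical_le[OF n]) auto
    thus "mdist prohorov_metric (empirical_path n x w s) (empirical_path n x w t) < e"
      using e s t by (simp add: empirical_path_def)
  qed (use d in simp)
qed

text \<open>One index governs both the time horizon and the accuracy, so countably many relations
  describe locally uniform convergence.\<close>

definition path_close :: "'e metric \<Rightarrow> nat \<Rightarrow> (real \<Rightarrow> 'e) \<Rightarrow> (real \<Rightarrow> 'e) \<Rightarrow> bool" where
  "path_close m k p q \<longleftrightarrow> (\<forall>t\<in>{0..real k}. mdist m (p t) (q t) < 1 / (real k + 1))"

text \<open>Locally uniform convergence is Skorohod convergence with trivial time changes.\<close>

lemma skorohod_entourage:
  assumes U: "openin (skorohod_topology m) U" and p: "p \<in> U"
  shows "\<exists>k. \<forall>q\<in>cadlag m. path_close m k p q \<longrightarrow> q \<in> U"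
proof (rule ccontr)
  assume "\<not> ?thesis"
  \<comment> \<open>Otherwise every scale \<open>k\<close> has a path outside \<open>U\<close> close
    to \<open>p\<close>; these paths converge to \<open>p\<close>, against sequential openness of
    \<open>U\<close>.\<close>
  then obtain q where q: "\<And>k. q k \<in> cadlag m" "\<And>k. path_close m k p (q k)" "\<And>k. q k \<notin> U"
    by metis
  have "skorohod_conv m q p"
    unfolding skorohod_conv_def
  proof (intro exI[of _ "\<lambda>_ t. t"] conjI allI impI)
    fix T e :: real assume T: "T \<ge> 0" and e: "e > 0"
    have "\<forall>\<^sub>F k in sequentially. T \<le> real k"
      using eventually_ge_at_top[of "nat \<lceil>T\<rceil>"] by eventually_elim linarith
    thus "\<forall>\<^sub>F k in sequentially. \<forall>t\<in>{0..T}. mdist m (q k t) (p t) < e"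
      using eventually_inverse_Suc_less[OF e]
    proof eventually_elim
      case (elim k)
      show ?case
      proof
        fix t assume "t \<in> {0..T}"
        hence "mdist m (p t) (q k t) < 1 / (real k + 1)"
          using q(2)[of k] elim(1) by (auto simp: path_close_def)
        thus "mdist m (q k t) (p t) < e" using elim(2) by (simp add: mdist_commute)
      qed
    qed
  qed (auto simp: strict_mono_on_def uniform_limit_iff)
  hence "\<forall>\<^sub>F k in sequentially. q k \<in> U"
    using U p q(1) unfolding openin_skorohod_topology by blast
  thus False using q(3) by (simp add: eventually_False_sequentially)
qed

lemma path_close_half:
  assumes "path_close m (2 * k + 1) p q" "path_close m (2 * k + 1) q r"
    and "\<And>t. t \<ge> 0 \<Longrightarrow> p t \<in> mspace m \<and> q t \<in> mspace m \<and> r t \<in> mspace m"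
  shows "path_close m k p r"
  unfolding path_close_def
proof
  fix t assume t: "t \<in> {0..real k}"
  hence "mdist m (p t) (r t) \<le> mdist m (p t) (q t) + mdist m (q t) (r t)"
    using assms(3)[of t] by (intro mdist_triangle) auto
  moreover have "mdist m (p t) (q t) < 1 / (real k + 1) / 2" "mdist m (q t) (r t) < 1 / (real k + 1) / 2"
    using assms(1,2) t unfolding path_close_def half_entourage by auto
  ultimately show "mdist m (p t) (r t) < 1 / (real k + 1)" by linarith
qed

text \<open>The cap leaves finitely many grid times, so a path is encoded by a finite table; it
  takes effect only beyond time k + 1.\<close>

definition time_code :: "nat \<Rightarrow> real \<Rightarrow> nat" where
  "time_code k t = min (nat \<lfloor>(real k + 1) * t\<rfloor>) ((k + 1)\<^sup>2)"

lemma time_code: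
  assumes "0 \<le> t" "t \<le> real k + 1"
  shows "real (time_code k t) / (real k + 1) \<le> t" "t - real (time_code k t) / (real k + 1) \<le> 1 / (real k + 1)"
proof -
  have "(real k + 1) * t \<le> (real k + 1) * (real k + 1)" using assms by (intro mult_left_mono) auto
  hence "nat \<lfloor>(real k + 1) * t\<rfloor> \<le> (k + 1)\<^sup>2"
    using assms by (simp add: nat_le_iff floor_le_iff power2_eq_square algebra_simps)
  hence "time_code k t = nat \<lfloor>(real k + 1) * t\<rfloor>" by (simp add: time_code_def)
  thus "real (time_code k t) / (real k + 1) \<le> t" "t - real (time_code k t) / (real k + 1) \<le> 1 / (real k + 1)"
    using floor_approx[OF assms(1), of k] by simp_all
qed

text \<open>A path is approximated by a step path determined by the grid codes of all particles at
  finitely many times. Uniform continuity on compact intervals gives locally uniform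
  convergence.\<close>

lemma empirical_path_measurable:
  assumes n: "n \<ge> 1"
    and x: "\<And>t. 0 \<le> t \<Longrightarrow> x t \<in> M \<rightarrow>\<^sub>M circle_power n"
    and cont: "\<And>w i. w \<in> space M \<Longrightarrow> i < n \<Longrightarrow> continuous_on {0..} (\<lambda>t. x t w i)"
  shows "empirical_path n x \<in> M \<rightarrow>\<^sub>M borel_of (skorohod_topology prohorov_metric)"
proof -
  define code where "code k w = map (\<lambda>j. map (\<lambda>i. grid_code k (x (real j / (real k + 1)) w i)) [0..<n])
    [0..<(k + 1)\<^sup>2 + 1]" for k w
  define step where "step k L t = empirical n (\<lambda>i. grid_point k (L ! time_code k t ! i))"
    for k and L :: "nat list list" and t
  have step_code: "step k (code k w) t =
      empirical n (\<lambda>i. grid_point k (map (\<lambda>i. grid_code k (x (real (time_code k t) / (real k + 1)) w i)) [0..<n] ! i))" for k w t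
  proof -
    have "time_code k t < (k + 1)\<^sup>2 + 1" by (simp add: time_code_def)
    hence "code k w ! time_code k t = map (\<lambda>i. grid_code k (x (real (time_code k t) / (real k + 1)) w i)) [0..<n]"
      unfolding code_def by (subst nth_map) (simp_all del: upt_Suc)
    thus ?thesis by (simp add: step_def)
  qed
  show ?thesis
  proof (rule measurable_borel_of_approx[where h = "\<lambda>m. 2 * m + 1" and R = "path_close prohorov_metric"
        and S = "{p. \<forall>t\<ge>0. p t \<in> space (prob_algebra borel)}" and X' = "\<lambda>k w. step k (code k w)"])
    show "empirical_path n x w \<in> topspace (skorohod_topology prohorov_metric)" if "w \<in> space M" for w
      using empirical_path_cadlag[OF n, of x w] cont[OF that] by simp
    show "(\<lambda>w. step k (code k w)) \<in> M \<rightarrow>\<^sub>M count_space UNIV" for k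
    proof -
      have x_i: "(\<lambda>w. x t w i) \<in> M \<rightarrow>\<^sub>M borel" if "0 \<le> t" "i < n" for t i
        by (rule measurable_compose[OF x[OF that(1)] circle_power_component[OF that(2)]])
      have "code k \<in> M \<rightarrow>\<^sub>M count_space UNIV"
        unfolding code_def
        by (intro measurable_map_count_space measurable_compose[OF x_i grid_code_measurable]) auto
      thus ?thesis by (rule measurable_compose) simp
    qed
    show "step k (code k w) \<in> {p. \<forall>t\<ge>0. p t \<in> space (prob_algebra borel)}" for k w
      by (simp add: step_def empirical_in_prob[OF n])
    show "\<exists>m. \<forall>q\<in>topspace (skorohod_topology prohorov_metric). path_close prohorov_metric m p q \<longrightarrow> q \<in> U"
      if "openin (skorohod_topology prohorov_metric) U" "p \<in> U" for U and p :: "real \<Rightarrow> circle measure"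
      using skorohod_entourage[OF that] by simp
    show "path_close prohorov_metric m p r"
      if "p \<in> topspace (skorohod_topology prohorov_metric)" "q \<in> {p. \<forall>t\<ge>0. p t \<in> space (prob_algebra borel)}"
        "r \<in> topspace (skorohod_topology prohorov_metric)"
        "path_close prohorov_metric (2 * m + 1) p q" "path_close prohorov_metric (2 * m + 1) q r"
      for m and p q r :: "real \<Rightarrow> circle measure"
      by (rule path_close_half[OF that(4,5)]) (use that(1-3) in \<open>auto simp: cadlag_def PiE_iff\<close>)
    fix m w assume w: "w \<in> space M"
    define e where "e = 1 / (real m + 1)"
    have e: "e > 0" by (simp add: e_def)
    obtain d where d: "d > 0" "\<forall>s\<in>{0..real m}. \<forall>t\<in>{0..real m}. \<bar>s - t\<bar> < d \<longrightarrow> (\<forall>i<n. dist (x s w i) (x t w i) < e / 4)"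
      using uniformly_continuous_paths[of n "\<lambda>t. x t w" "e / 4" "real m"] cont[OF w] e by auto
    have "\<forall>\<^sub>F k in sequentially. 1 / (real k + 1) < min d (e / 4)"
      by (rule eventually_inverse_Suc_less) (use e d in simp)
    thus "\<forall>\<^sub>F k in sequentially. path_close prohorov_metric m (empirical_path n x w) (step k (code k w)) \<and>
        path_close prohorov_metric m (step k (code k w)) (empirical_path n x w)"
      using eventually_ge_at_top[of m]
    proof eventually_elim
      case (elim k)
      have "prohorov_dist (step k (code k w) t) (empirical n (x t w)) < e" if t: "t \<in> {0..real m}" for t
      proof -
        define s where "s = real (time_code k t) / (real k + 1)"
        have s: "0 \<le> s" "s \<le> t" "t - s \<le> 1 / (real k + 1)"
          using time_code[of t k] t elim(2) by (auto simp: s_def)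
        have "prohorov_dist (step k (code k w) t) (empirical n (x t w)) \<le> e / 2"
          unfolding step_code s_def[symmetric]
        proof (rule prohorov_empirical_le[OF n])
          fix i assume i: "i < n"
          have "dist (grid_point k (grid_code k (x s w i))) (x t w i)
              \<le> dist (grid_point k (grid_code k (x s w i))) (x s w i) + dist (x s w i) (x t w i)"
            by (rule dist_triangle)
          also have "\<dots> < e / 4 + e / 4"
            using elim(1) s t i d(2) by (intro add_strict_mono le_less_trans[OF dist_grid_point]) auto
          finally show "dist (grid_point k (map (\<lambda>i. grid_code k (x s w i)) [0..<n] ! i)) (x t w i) < e / 2"
            using i by simp
        qed
        thus ?thesis using e by simp
      qed
      thus ?case
        by (auto simp: path_close_def empirical_path_def e_def[symmetric] prohorov_commute[of "empirical n _"])
    qed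
  qed
qed

section \<open>Convergence\<close>

context admissible_potential
begin

lemma empirical_gibbs_weak_conv:
  "weak_conv_in (mtopology_of prohorov_metric) (\<lambda>n. empirical_gibbs V \<alpha> n)
     (return (borel_of (mtopology_of prohorov_metric)) circle_lebesgue)"
proof (rule weak_conv_in_return[where Q = "gibbs V \<alpha>" and X = empirical
      and R = "\<lambda>m \<mu>. prohorov_dist circle_lebesgue \<mu> < 1 / (real m + 1)"])
  show "circle_lebesgue \<in> topspace (mtopology_of prohorov_metric)"
    by (simp add: topspace_prohorov circle_lebesgue_in_prob)
  show "\<exists>m. \<forall>\<mu>\<in>topspace (mtopology_of prohorov_metric). prohorov_dist circle_lebesgue \<mu> < 1 / (real m + 1) \<longrightarrow> \<mu> \<in> U"
    if "openin (mtopology_of prohorov_metric) U" "circle_lebesgue \<in> U" for U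
    using open_entourage[OF that] by (simp add: topspace_prohorov)
  show "\<forall>\<^sub>F n in sequentially. prob_space (gibbs V \<alpha> n)
      \<and> empirical n \<in> gibbs V \<alpha> n \<rightarrow>\<^sub>M borel_of (mtopology_of prohorov_metric)
      \<and> empirical_gibbs V \<alpha> n = distr (gibbs V \<alpha> n) (borel_of (mtopology_of prohorov_metric)) (empirical n)"
    using eventually_ge_at_top[of 1]
    by eventually_elim (simp add: prob_space_gibbs empirical_gibbs_def empirical_measurable
        measurable_cong_sets[OF sets_gibbs refl])
  fix m :: nat
  define e where "e = 1 / (real m + 1)"
  \<comment> \<open>A mesh of half the accuracy \<open>e\<close> leaves room for the strict bounds:
    the distance comes out at most \<open>3/4 * e\<close>.\<close>
  define M where "M = 2 * (m + 1)"
  have e: "e > 0" and M: "M \<ge> 1" "1 / real M = e / 2"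
    by (simp_all add: e_def M_def field_simps)
  obtain C \<kappa> N where C: "C > 0" "\<kappa> > 0"
    "\<And>n. n \<ge> N \<Longrightarrow> measure (gibbs V \<alpha> n) (atypical n M) \<le> C * exp (- \<kappa> * real n)"
    using measure_gibbs_atypical[OF M(1)] by blast
  have "(\<lambda>n. measure (gibbs V \<alpha> n) (atypical n M)) \<longlonglongrightarrow> 0"
  proof (rule tendsto_sandwich[OF _ _ tendsto_const])
    show "\<forall>\<^sub>F n in sequentially. measure (gibbs V \<alpha> n) (atypical n M) \<le> C * exp (- \<kappa> * real n)"
      using eventually_ge_at_top[of N] by eventually_elim (rule C)
    show "(\<lambda>n. C * exp (- \<kappa> * real n)) \<longlonglongrightarrow> 0" using C(2) by real_asymp
  qed simp
  moreover have "\<forall>\<^sub>F n in sequentially. atypical n M \<in> sets (gibbs V \<alpha> n)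
      \<and> (\<forall>w\<in>space (gibbs V \<alpha> n) - atypical n M. prohorov_dist circle_lebesgue (empirical n w) < 1 / (real m + 1))"
    using eventually_ge_at_top[of 1]
  proof eventually_elim
    case (elim n)
    have "prohorov_dist circle_lebesgue (empirical n w) < e"
      if "w \<in> space (gibbs V \<alpha> n) - atypical n M" for w
    proof -
      have "prohorov_dist (empirical n w) circle_lebesgue \<le> 3/4 * e"
        using that M e by (intro prohorov_typical[OF elim, where m = M]) (auto simp: space_gibbs)
      thus ?thesis using e by (simp add: prohorov_commute[of circle_lebesgue])
    qed
    thus ?case by (auto simp: e_def sets_gibbs)
  qed
  ultimately show "\<exists>A. (\<forall>\<^sub>F n in sequentially. A n \<in> sets (gibbs V \<alpha> n)
      \<and> (\<forall>w\<in>space (gibbs V \<alpha> n) - A n. prohorov_dist circle_lebesgue (empirical n w) < 1 / (real m + 1)))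
      \<and> (\<lambda>n. measure (gibbs V \<alpha> n) (A n)) \<longlonglongrightarrow> 0"
    by (intro exI[of _ "\<lambda>n. atypical n M"] conjI)
qed

section \<open>The stationary process\<close>

context
  fixes n :: nat and \<Omega> :: "'w measure" and x P
  assumes n: "n \<ge> 1" and diffusion: "sde_diffusion V \<alpha> n \<Omega> x P"
begin

lemma diffusion_measurable: "0 \<le> t \<Longrightarrow> x t \<in> \<Omega> \<rightarrow>\<^sub>M circle_power n"
  and diffusion_continuous: "w \<in> space \<Omega> \<Longrightarrow> i < n \<Longrightarrow> continuous_on {0..} (\<lambda>t. x t w i)"
  and diffusion_kernel: "P \<in> circle_power n \<rightarrow>\<^sub>M prob_algebra \<Omega>"
  and diffusion_solution: "\<eta> \<in> space (circle_power n) \<Longrightarrow> sde_solution V \<alpha> n (P \<eta>) x \<eta>"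
  using diffusion unfolding sde_diffusion_def by blast+

lemma gibbs_in_prob: "gibbs V \<alpha> n \<in> space (prob_algebra (circle_power n))"
  by (simp add: space_prob_algebra prob_space_gibbs[OF n] sets_gibbs)

lemma kernel_gibbs: "P \<in> gibbs V \<alpha> n \<rightarrow>\<^sub>M subprob_algebra \<Omega>"
  using measurable_prob_algebraD[OF diffusion_kernel]
  by (simp add: measurable_cong_sets[OF sets_gibbs refl])

lemma space_gibbs_nonempty: "space (gibbs V \<alpha> n) \<noteq> {}"
  by (simp add: space_gibbs space_PiM PiE_eq_empty_iff)

lemma prob_space_stationary: "prob_space (gibbs V \<alpha> n \<bind> P)"
  by (rule prob_space_bind'[OF gibbs_in_prob diffusion_kernel])

lemma sets_stationary: "sets (gibbs V \<alpha> n \<bind> P) = sets \<Omega>"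
  by (rule sets_bind'[OF gibbs_in_prob diffusion_kernel])

lemma diffusion_path_measurable:
  "empirical_path n x \<in> \<Omega> \<rightarrow>\<^sub>M borel_of (skorohod_topology prohorov_metric)"
  using diffusion_measurable diffusion_continuous by (rule empirical_path_measurable[OF n])

text \<open>Mixing commutes with taking image measures, so the stationary law is the image of a
  single probability measure on which events can be estimated.\<close>

lemma stationary_law_distr:
  "stationary_empirical_law V \<alpha> n x P =
     distr (gibbs V \<alpha> n \<bind> P) (borel_of (skorohod_topology prohorov_metric)) (empirical_path n x)"
  unfolding stationary_empirical_law_def empirical_law_def
  by (rule distr_bind[OF kernel_gibbs space_gibbs_nonempty diffusion_path_measurable, symmetric])

lemma measure_stationary_le:
  assumes A: "A \<in> sets \<Omega>" and b: "0 \<le> b"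
    and le: "\<And>\<eta>. \<eta> \<in> space (circle_power n) \<Longrightarrow> measure (P \<eta>) A \<le> b"
  shows "measure (gibbs V \<alpha> n \<bind> P) A \<le> b"
proof -
  interpret G: prob_space "gibbs V \<alpha> n" by (rule prob_space_gibbs[OF n])
  interpret Q: prob_space "gibbs V \<alpha> n \<bind> P" by (rule prob_space_stationary)
  have "emeasure (gibbs V \<alpha> n \<bind> P) A = (\<integral>\<^sup>+\<eta>. emeasure (P \<eta>) A \<partial>gibbs V \<alpha> n)"
    by (rule emeasure_bind[OF space_gibbs_nonempty kernel_gibbs A])
  also have "\<dots> \<le> (\<integral>\<^sup>+\<eta>. ennreal b \<partial>gibbs V \<alpha> n)"
  proof (rule nn_integral_mono)
    fix \<eta> assume "\<eta> \<in> space (gibbs V \<alpha> n)"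
    hence \<eta>: "\<eta> \<in> space (circle_power n)" by (simp add: space_gibbs)
    interpret prob_space "P \<eta>"
      using measurable_space[OF diffusion_kernel \<eta>] by (simp add: space_prob_algebra)
    show "emeasure (P \<eta>) A \<le> ennreal b"
      using le[OF \<eta>] by (simp add: emeasure_eq_measure ennreal_leI)
  qed
  also have "\<dots> = ennreal b" by (simp add: G.emeasure_space_1)
  finally show ?thesis using b by (simp add: Q.emeasure_eq_measure ennreal_le_iff)
qed

lemma measure_stationary_not_calm:
  assumes D: "\<And>z i. \<bar>drift V \<alpha> n z i\<bar> \<le> D"
    and a: "0 \<le> a" and h: "h > 0" and e: "e > 0" "D * h \<le> e"
  shows "measure (gibbs V \<alpha> n \<bind> P) (space \<Omega> - calm \<Omega> x n a h (2 * e)) \<le> real n * (200000 * h\<^sup>2 / e ^ 4)"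
proof (rule measure_stationary_le)
  have calm: "calm \<Omega> x n a h (2 * e) \<in> sets \<Omega>"
    using diffusion_measurable diffusion_continuous by (rule calm_measurable[OF _ _ a h])
  thus "space \<Omega> - calm \<Omega> x n a h (2 * e) \<in> sets \<Omega>" by simp
  show "0 \<le> real n * (200000 * h\<^sup>2 / e ^ 4)" by simp
  fix \<eta> assume \<eta>: "\<eta> \<in> space (circle_power n)"
  interpret prob_space "P \<eta>"
    using measurable_space[OF diffusion_kernel \<eta>] by (simp add: space_prob_algebra)
  have sets: "sets (P \<eta>) = sets \<Omega>"
    using measurable_space[OF diffusion_kernel \<eta>] by (simp add: space_prob_algebra)
  hence space: "space (P \<eta>) = space \<Omega>" by (rule sets_eq_imp_space_eq)
  have cont: "continuous_on {0..} (\<lambda>t. x t w i)" if "w \<in> space (P \<eta>)" "i < n" for w i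
    using that diffusion_continuous by (simp add: space)
  obtain A where A: "A \<in> sets (P \<eta>)" "prob A \<le> real n * (200000 * h\<^sup>2 / e ^ 4)"
    "AE w in P \<eta>. w \<notin> A \<longrightarrow> (\<forall>i<n. \<forall>s\<in>{a..a + h}. dist (x s w i) (x a w i) \<le> 2 * e)"
    by (rule sde_solution_oscillation[OF diffusion_solution[OF \<eta>] cont D a h e])
  \<comment> \<open>The set \<open>A\<close> depends on \<eta> through the Brownian motions; up to a
    null set it contains the complement of the calm event, which does not depend on \<eta>.\<close>
  have "prob (space \<Omega> - calm \<Omega> x n a h (2 * e)) \<le> prob A"
  proof (rule finite_measure_mono_AE[OF _ A(1)])
    show "AE w in P \<eta>. w \<in> space \<Omega> - calm \<Omega> x n a h (2 * e) \<longrightarrow> w \<in> A"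
      using A(3) by eventually_elim (auto simp: calm_def)
  qed
  with A(2) show "prob (space \<Omega> - calm \<Omega> x n a h (2 * e)) \<le> real n * (200000 * h\<^sup>2 / e ^ 4)"
    by linarith
qed

text \<open>Between the points of a time grid the particles hardly move, and at the grid points the
  empirical measure has the stationary law.\<close>

lemma measure_stationary_exceptional:
  fixes h e :: real and J M :: nat
  assumes invariant: "\<And>t. t \<ge> 0 \<Longrightarrow> distr (gibbs V \<alpha> n \<bind> P) (circle_power n) (x t) = gibbs V \<alpha> n"
    and D: "\<And>z i. \<bar>drift V \<alpha> n z i\<bar> \<le> D"
    and h: "h > 0" and e: "e > 0" "D * h \<le> e"
  defines "A \<equiv> (\<Union>j<J. (space \<Omega> - calm \<Omega> x n (real j * h) h (2 * e))
      \<union> {w \<in> space \<Omega>. x (real j * h) w \<in> atypical n M})"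
  shows "A \<in> sets \<Omega>"
    and "measure (gibbs V \<alpha> n \<bind> P) A
      \<le> real J * (real n * (200000 * h\<^sup>2 / e ^ 4) + measure (gibbs V \<alpha> n) (atypical n M))"
proof -
  interpret Q: prob_space "gibbs V \<alpha> n \<bind> P" by (rule prob_space_stationary)
  define B1 where "B1 j = space \<Omega> - calm \<Omega> x n (real j * h) h (2 * e)" for j :: nat
  define B2 where "B2 j = {w \<in> space \<Omega>. x (real j * h) w \<in> atypical n M}" for j :: nat
  have x: "x (real j * h) \<in> \<Omega> \<rightarrow>\<^sub>M circle_power n" for j
    using h by (intro diffusion_measurable) simp
  have B1: "B1 j \<in> sets \<Omega>" for j
    unfolding B1_def using calm_measurable[OF diffusion_measurable diffusion_continuous, of "real j * h" h] h by simp
  have B2_eq: "B2 j = x (real j * h) -` atypical n M \<inter> space \<Omega>" for j by (auto simp: B2_def)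
  have B2: "B2 j \<in> sets \<Omega>" for j
    unfolding B2_eq by (rule measurable_sets[OF x]) measurable
  show "A \<in> sets \<Omega>" unfolding A_def using B1 B2 by (simp add: B1_def B2_def)
  have 1: "Q.prob (B1 j) \<le> real n * (200000 * h\<^sup>2 / e ^ 4)" for j
    unfolding B1_def using D h e by (intro measure_stationary_not_calm) auto
  have 2: "Q.prob (B2 j) = measure (gibbs V \<alpha> n) (atypical n M)" for j
  proof -
    have "measure (gibbs V \<alpha> n) (atypical n M) =
        measure (distr (gibbs V \<alpha> n \<bind> P) (circle_power n) (x (real j * h))) (atypical n M)"
      using invariant[of "real j * h"] h by simp
    also have "\<dots> = Q.prob (x (real j * h) -` atypical n M \<inter> space (gibbs V \<alpha> n \<bind> P))"
      by (rule measure_distr) (use x in \<open>auto simp: measurable_cong_sets[OF sets_stationary refl]\<close>)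
    finally show ?thesis
      by (simp add: B2_eq sets_eq_imp_space_eq[OF sets_stationary])
  qed
  have "Q.prob A \<le> (\<Sum>j<J. Q.prob (B1 j \<union> B2 j))"
    unfolding A_def B1_def[symmetric] B2_def[symmetric] using B1 B2
    by (intro Q.finite_measure_subadditive_finite) (auto simp: sets_stationary)
  also have "\<dots> \<le> (\<Sum>j<J. Q.prob (B1 j) + Q.prob (B2 j))"
    using B1 B2 by (intro sum_mono measure_Un_le) (auto simp: sets_stationary)
  also have "\<dots> \<le> (\<Sum>j<J. real n * (200000 * h\<^sup>2 / e ^ 4) + measure (gibbs V \<alpha> n) (atypical n M))"
    using 1 2 by (intro sum_mono add_mono) auto
  finally show "measure (gibbs V \<alpha> n \<bind> P) A
      \<le> real J * (real n * (200000 * h\<^sup>2 / e ^ 4) + measure (gibbs V \<alpha> n) (atypical n M))"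
    by simp
qed

end

end

section \<open>Passage to the limit\<close>

text \<open>The displacement bound \<open>2 * e\<close> is enlarged to \<open>3 * e\<close>, and the
  mesh bound \<open>3 * e\<close> to \<open>6 * e\<close>, because the two Prohorov estimates take
  strict inequalities; the sum is below \<open>12 * e\<close>.\<close>

lemma prohorov_calm_typical:
  assumes n: "n \<ge> 1" and x: "x a w \<in> space (circle_power n)" "x a w \<notin> atypical n M"
    and calm: "w \<in> calm \<Omega> x n a h (2 * e)" and t: "t \<in> {a..a + h}"
    and e: "e > 0" and M: "M > 0" "1 / real M \<le> 3 * e"
  shows "prohorov_dist circle_lebesgue (empirical n (x t w)) < 12 * e"
proof -
  have "dist (x t w i) (x a w i) < 3 * e" if "i < n" for i
  proof -
    have "dist (x t w i) (x a w i) \<le> 2 * e" using calm t that unfolding calm_def by blast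
    thus ?thesis using e by linarith
  qed
  hence "prohorov_dist (empirical n (x t w)) (empirical n (x a w)) \<le> 3 * e"
    by (rule prohorov_empirical_le[OF n])
  moreover have "prohorov_dist (empirical n (x a w)) circle_lebesgue \<le> 6 * e"
    using M e by (intro prohorov_typical[OF n x]) auto
  moreover have "prohorov_dist (empirical n (x t w)) circle_lebesgue
      \<le> prohorov_dist (empirical n (x t w)) (empirical n (x a w)) + prohorov_dist (empirical n (x a w)) circle_lebesgue"
    by (intro prohorov_triangle empirical_in_prob n circle_lebesgue_in_prob)
  ultimately show ?thesis using e by (subst prohorov_commute) linarith
qed

lemma power_times_exp_tendsto_0:
  fixes \<kappa> :: real
  assumes "\<kappa> > 0"
  shows "(\<lambda>n. (real n ^ p + 1) * (C * exp (- \<kappa> * real n))) \<longlonglongrightarrow> 0"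
  using assms by real_asymp

lemma const_path_cadlag:
  assumes "\<mu> \<in> mspace m"
  shows "(\<lambda>t\<in>{0..}. \<mu>) \<in> cadlag m"
proof (rule cadlag_continuous)
  have zero: "mdist m \<mu> \<mu> = 0" using Metric_space.zero[OF Metric_space_mspace_mdist assms assms] by simp
  show "\<exists>d>0. \<forall>s\<ge>0. \<bar>s - t\<bar> < d \<longrightarrow> mdist m ((\<lambda>t\<in>{0..}. \<mu>) s) ((\<lambda>t\<in>{0..}. \<mu>) t) < e"
    if "0 \<le> t" "0 < e" for t e :: real
    using that by (intro exI[of _ 1]) (simp add: zero)
qed (use assms in auto)

theorem theorem4p4:
  fixes V :: "real \<Rightarrow> real" and \<alpha> \<beta> :: real
    and \<Omega> :: "nat \<Rightarrow> 'w measure"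
    and x :: "nat \<Rightarrow> real \<Rightarrow> 'w \<Rightarrow> nat \<Rightarrow> circle"
    and P :: "nat \<Rightarrow> (nat \<Rightarrow> circle) \<Rightarrow> 'w measure"
  assumes "admissible_potential V \<alpha> \<beta>"
    and diffusion: "\<And>n. n \<ge> 1 \<Longrightarrow> sde_diffusion V \<alpha> n (\<Omega> n) (x n) (P n)"
    and invariant: "\<And>n t. n \<ge> 1 \<Longrightarrow> t \<ge> 0 \<Longrightarrow>
      distr (gibbs V \<alpha> n \<bind> P n) (circle_power n) (x n t) = gibbs V \<alpha> n"
  shows "weak_conv_in (mtopology_of prohorov_metric)
           (\<lambda>n. empirical_gibbs V \<alpha> n)
           (return (borel_of (mtopology_of prohorov_metric)) circle_lebesgue) \<and>
         weak_conv_in (skorohod_topology prohorov_metric)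
           (\<lambda>n. stationary_empirical_law V \<alpha> n (x n) (P n))
           (return (borel_of (skorohod_topology prohorov_metric)) (\<lambda>t\<in>{0..}. circle_lebesgue))"
proof
  interpret admissible_potential V \<alpha> \<beta> by fact
  show "weak_conv_in (mtopology_of prohorov_metric) (\<lambda>n. empirical_gibbs V \<alpha> n)
      (return (borel_of (mtopology_of prohorov_metric)) circle_lebesgue)"
    by (rule empirical_gibbs_weak_conv)
  let ?q = "\<lambda>t\<in>{0..}. circle_lebesgue"
  let ?Q = "\<lambda>n. gibbs V \<alpha> n \<bind> P n"
  show "weak_conv_in (skorohod_topology prohorov_metric)
      (\<lambda>n. stationary_empirical_law V \<alpha> n (x n) (P n))
      (return (borel_of (skorohod_topology prohorov_metric)) ?q)"
  proof (rule weak_conv_in_return[where Q = ?Q and X = "\<lambda>n. empirical_path n (x n)"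
        and R = "\<lambda>m. path_close prohorov_metric m ?q"])
    show "?q \<in> topspace (skorohod_topology prohorov_metric)"
      by (simp add: const_path_cadlag circle_lebesgue_in_prob)
    show "\<exists>m. \<forall>p\<in>topspace (skorohod_topology prohorov_metric). path_close prohorov_metric m ?q p \<longrightarrow> p \<in> U"
      if "openin (skorohod_topology prohorov_metric) U" "?q \<in> U" for U
      using skorohod_entourage[OF that] by simp
    show "\<forall>\<^sub>F n in sequentially. prob_space (?Q n)
        \<and> empirical_path n (x n) \<in> ?Q n \<rightarrow>\<^sub>M borel_of (skorohod_topology prohorov_metric)
        \<and> stationary_empirical_law V \<alpha> n (x n) (P n) =
          distr (?Q n) (borel_of (skorohod_topology prohorov_metric)) (empirical_path n (x n))"
      using eventually_ge_at_top[of 1]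
    proof eventually_elim
      case (elim n)
      note d = diffusion[OF elim]
      show ?case
        using prob_space_stationary[OF elim d] stationary_law_distr[OF elim d]
          diffusion_path_measurable[OF elim d]
        by (simp add: measurable_cong_sets[OF sets_stationary[OF elim d] refl])
    qed
    fix m :: nat
    \<comment> \<open>These choices give \<open>12 * e = 1 / (m + 1)\<close> and
      \<open>1 / M = 3 * e\<close>, as \<open>prohorov_calm_typical\<close> requires.\<close>
    define e where "e = 1 / (12 * (real m + 1))"
    define M where "M = 4 * (m + 1)"
    define T where "T = real m + 1"
    \<comment> \<open>The exponent has two duties: \<open>p - 1\<close> is at least
      \<open>2 + \<alpha>\<close>, so the drift moves a particle by at most \<open>D * T / n\<close>
      in one step, and it is large enough for the summed oscillation probabilities, of order
      \<open>n powr (1 - p)\<close>, to vanish.\<close>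
    define p where "p = nat \<lceil>\<alpha>\<rceil> + 4"
    define h where "h n = T / real n ^ p" for n :: nat
    \<comment> \<open>The index of the last grid time up to \<open>t\<close> is bounded by
      \<open>n ^ p\<close>, so one more than \<open>n ^ p\<close> intervals are taken.\<close>
    define J where "J n = n ^ p + 1" for n :: nat
    define A where "A n = (\<Union>j<J n. (space (\<Omega> n) - calm (\<Omega> n) (x n) n (real j * h n) (h n) (2 * e))
      \<union> {w \<in> space (\<Omega> n). x n (real j * h n) w \<in> atypical n M})" for n
    have e: "e > 0" and M: "M \<ge> 1" "1 / real M \<le> 3 * e" and T: "T > 0"
      by (simp_all add: e_def M_def T_def field_simps)
    obtain D where D: "D > 0" "\<And>n y i. \<bar>drift V \<alpha> n y i\<bar> \<le> D * real n powr (2 + \<alpha>)"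
      using drift_bound by blast
    obtain C \<kappa> N where C: "C > 0" "\<kappa> > 0"
      "\<And>n. n \<ge> N \<Longrightarrow> measure (gibbs V \<alpha> n) (atypical n M) \<le> C * exp (- \<kappa> * real n)"
      using measure_gibbs_atypical[OF M(1)] by blast
    have "(\<lambda>n. D * T / real n) \<longlonglongrightarrow> 0" by real_asymp
    hence "\<forall>\<^sub>F n in sequentially. D * T / real n < e"
      using e by (rule order_tendstoD(2))
    hence large: "\<forall>\<^sub>F n in sequentially. n \<ge> 1 \<and> n \<ge> N \<and> h n > 0 \<and> D * real n powr (2 + \<alpha>) * h n \<le> e"
      using eventually_ge_at_top[of "max 1 N"]
    proof eventually_elim
      case (elim n)
      hence n: "real n \<ge> 1" by simp
      have "real n powr (2 + \<alpha>) \<le> real n powr (real (p - 1))"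
        using n by (intro powr_mono) (auto simp: p_def, linarith)
      also have "\<dots> = real n ^ (p - 1)" using n by (simp add: powr_realpow)
      also have "\<dots> = real n ^ p / real n^1"
        using n by (intro power_diff) (auto simp: p_def)
      finally have "D * real n powr (2 + \<alpha>) * h n \<le> D * (real n ^ p / real n^1) * h n"
        using n D T by (intro mult_right_mono mult_left_mono) (auto simp: h_def)
      also have "\<dots> = D * T / real n" using n by (simp add: h_def)
      finally show ?case using elim n T by (simp add: h_def)
    qed
    have upper: "\<forall>\<^sub>F n in sequentially. measure (?Q n) (A n)
        \<le> 400000 * T\<^sup>2 / e ^ 4 / real n + (real n ^ p + 1) * (C * exp (- \<kappa> * real n))"
      using large
    proof eventually_elim
      case (elim n)
      hence n: "n \<ge> 1" by simp
      have "measure (?Q n) (A n) \<le> real (J n) *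
          (real n * (200000 * (h n)\<^sup>2 / e ^ 4) + measure (gibbs V \<alpha> n) (atypical n M))"
        unfolding A_def using elim invariant[OF n] e D(2)
        by (intro measure_stationary_exceptional[OF n diffusion[OF n]]) auto
      also have "\<dots> \<le> real (J n) * (real n * (200000 * (h n)\<^sup>2 / e ^ 4) + C * exp (- \<kappa> * real n))"
        using C(3) elim by (intro mult_left_mono add_left_mono) auto
      also have "\<dots> = real (J n) * (real n * (200000 * (h n)\<^sup>2 / e ^ 4))
          + (real n ^ p + 1) * (C * exp (- \<kappa> * real n))"
        by (simp add: J_def algebra_simps)
      also have "real (J n) * (real n * (200000 * (h n)\<^sup>2 / e ^ 4)) \<le> 400000 * T\<^sup>2 / e ^ 4 / real n"
      proof -
        \<comment> \<open>Writing \<open>n ^ p\<close> as \<open>y * n\<^sup>2\<close> shows that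
          the oscillation term is at most a constant divided by n and by \<open>y\<close>, with
          \<open>y\<close> at least 1.\<close>
        define y where "y = real n ^ (p - 2)"
        have y: "y \<ge> 1" using n unfolding y_def by (intro one_le_power) simp
        have "p = (p - 2) + 2" by (simp add: p_def)
        hence np: "real n ^ p = y * (real n)\<^sup>2" unfolding y_def by (metis power_add)
        have "1 \<le> (real n)\<^sup>2" using n by simp
        hence "1 * 1 \<le> y * (real n)\<^sup>2" using y by (intro mult_mono) auto
        hence "real (J n) \<le> 2 * (y * (real n)\<^sup>2)" by (simp add: J_def np)
        hence "real (J n) * (real n * (200000 * (h n)\<^sup>2 / e ^ 4))
            \<le> 2 * (y * (real n)\<^sup>2) * (real n * (200000 * (h n)\<^sup>2 / e ^ 4))"
          by (rule mult_right_mono) simp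
        also have "\<dots> = 400000 * T\<^sup>2 / e ^ 4 / real n * (1 / y)"
          using n y by (simp add: h_def np power_divide power_mult_distrib field_simps power2_eq_square)
        also have "\<dots> \<le> 400000 * T\<^sup>2 / e ^ 4 / real n * 1"
          using y by (intro mult_left_mono) auto
        finally show ?thesis by simp
      qed
      finally show ?case by simp
    qed
    have "(\<lambda>n. 400000 * T\<^sup>2 / e ^ 4 / real n + (real n ^ p + 1) * (C * exp (- \<kappa> * real n))) \<longlonglongrightarrow> 0 + 0"
      by (rule tendsto_add[OF _ power_times_exp_tendsto_0[OF C(2)]]) real_asymp
    hence "(\<lambda>n. measure (?Q n) (A n)) \<longlonglongrightarrow> 0"
      by (intro tendsto_sandwich[OF _ upper tendsto_const]) simp_all
    moreover have "\<forall>\<^sub>F n in sequentially. A n \<in> sets (?Q n)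
        \<and> (\<forall>w\<in>space (?Q n) - A n. path_close prohorov_metric m ?q (empirical_path n (x n) w))"
      using large
    proof eventually_elim
      case (elim n)
      hence n: "n \<ge> 1" and h: "h n > 0" by auto
      note d = diffusion[OF n]
      have "A n \<in> sets (\<Omega> n)"
        unfolding A_def using elim invariant[OF n] e D(2)
        by (intro measure_stationary_exceptional[OF n d]) auto
      moreover have "path_close prohorov_metric m ?q (empirical_path n (x n) w)"
        if w: "w \<in> space (\<Omega> n)" "w \<notin> A n" for w
        unfolding path_close_def
      proof
        fix t assume t: "t \<in> {0..real m}"
        \<comment> \<open>The grid interval containing \<open>t\<close>; its left end is a time at
          which the configuration is typical.\<close>
        define j where "j = nat \<lfloor>t / h n\<rfloor>"
        have j: "real j = of_int \<lfloor>t / h n\<rfloor>" using t h by (simp add: j_def)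
        have "t / h n \<le> T / h n" using t h by (intro divide_right_mono) (auto simp: T_def)
        also have "\<dots> = real n ^ p" using T n by (simp add: h_def)
        finally have "real j \<le> real (n ^ p)" unfolding j by (simp, linarith)
        hence jJ: "j < J n" unfolding J_def of_nat_le_iff by simp
        have "real j \<le> t / h n" "t / h n \<le> real j + 1" unfolding j by linarith+
        hence "real j * h n \<le> t" "t \<le> (real j + 1) * h n"
          using h by (simp_all add: le_divide_eq divide_le_eq)
        hence tj: "t \<in> {real j * h n..real j * h n + h n}" by (simp add: distrib_right)
        have "x n (real j * h n) w \<in> space (circle_power n)"
          using measurable_space[OF diffusion_measurable[OF n d] w(1), of "real j * h n"] h by simp
        moreover have "x n (real j * h n) w \<notin> atypical n M" "w \<in> calm (\<Omega> n) (x n) n (real j * h n) (h n) (2 * e)"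
          using w jJ unfolding A_def by blast+
        ultimately have "prohorov_dist circle_lebesgue (empirical n (x n t w)) < 12 * e"
          using tj e M by (intro prohorov_calm_typical[OF n]) auto
        also have "12 * e = 1 / (real m + 1)" by (simp add: e_def field_simps)
        finally show "mdist prohorov_metric (?q t) (empirical_path n (x n) w t) < 1 / (real m + 1)"
          using t by (simp add: empirical_path_def)
      qed
      ultimately show ?case
        by (simp add: sets_stationary[OF n d] sets_eq_imp_space_eq[OF sets_stationary[OF n d]])
    qed
    ultimately show "\<exists>A. (\<forall>\<^sub>F n in sequentially. A n \<in> sets (?Q n)
        \<and> (\<forall>w\<in>space (?Q n) - A n. path_close prohorov_metric m ?q (empirical_path n (x n) w)))
        \<and> (\<lambda>n. measure (?Q n) (A n)) \<longlonglongrightarrow> 0"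
      by blast
  qed
qed

end
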